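(* Let $d\in\mathbb{R}$ and let $(\hat f_1,\hat f_2)$ be a pair of generic $q$-Gevrey series, each $Gq$-summable in the direction $d$ (i.e. $\hat f_1,\hat f_2\in\mathbb{C}\{x\}_{q;1}^d$). Then the product $\hat f_1\hat f_2$ is $Gq$-summable of double level $(1,2)$ in the direction $d$ (i.e. $\hat f_1\hat f_2\in\mathbb{C}\{x\}_{q;(1,2)}^d$), and $$\mathcal{S}_{q;(1,2)}^{d}(\hat f_1\,\hat f_2)=\mathcal{S}_{q;1}^{d}(\hat f_1)\,\mathcal{S}_{q;1}^{d}(\hat f_2).$$
   Context: $q>1$ is a fixed real number and $\sigma_q y(x)=y(qx)$. $\mathbb{C}[[x]]$ is the space of formal power series, $\mathbb{C}\{x\}$ the space of convergent ones (germs of analytic functions at $0$). Generic $q$-Gevrey series: a series $\hat f\in\mathbb{C}[[x]]$ such that $\Delta\hat f\in\mathbb{C}\{x\}$ for some operator $\Delta=\sum_{k=0}^n a_{n-k}(x)(x\sigma_q)^k$ with $n\ge 0$, $a_0,\dots,a_n\in\mathbb{C}\{x\}$ and $a_0(0)a_n(0)\neq 0$. $\tilde{\mathbb{C}}^*$ is the Riemann surface of the logarithm, on which $\arg$ (real-valued) and $\log x=\ln|x|+i\arg x$ are single-valued. For real $p>1$ put $e_p(x)=\sqrt{2\pi\log p}\;e^{(\log(\sqrt p\,x))^2/(2\log p)}$, $x\in\tilde{\mathbb{C}}^*$. For $R,\varepsilon>0$, $d\in\mathbb{R}$: $\tilde D_R=\{x\in\tilde{\mathbb{C}}^*:|x|<R\}$,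 $V_\varepsilon^d=\{\xi\in\tilde{\mathbb{C}}^*:|\arg\xi-d|<\varepsilon\}$. $\mathcal{C}^d$ denotes analytic continuation along the direction $d$ in some sector $V_\varepsilon^d$. Level 1. $\hat{\mathcal{B}}_{q;1}(\sum a_nx^n)=\sum a_nq^{-n(n-1)/2}\xi^n$. For real $p>1$, $\mathbb{H}_{p;1}^d$ is the space of germs of analytic functions at $0\in\mathbb{C}$ that continue to an analytic function $\phi$ in some sector $V_\epsilon^d$ with, for some $A>0$, $\phi(\xi)=O(e_p(A\xi))$ as $|\xi|\to\infty$ in $V_\epsilon^d$; and $\mathcal{L}_{p;1}^d\phi(x)=\int_0^{\infty e^{id}}\frac{\phi(\xi)}{e_p(\xi/x)}\frac{d\xi}{\xi}$, for $x$ in some $\tilde D_R$. A series $\hat f$ is $Gq$-summable in the direction $d$, written $\hat f\in\mathbb{C}\{x\}_{q;1}^d$, if $\hat{\mathcal{B}}_{q;1}\hat f\in\mathbb{H}_{q;1}^d$; its $Gq$-sum is $\mathcal{S}_{q;1}^d\hat f=\mathcal{L}_{q;1}^d\mathcal{C}^d\hat{\mathcal{B}}_{q;1}\hat f$. Level $(1,2)$. Put $\mathbb{H}_{q;2}^d=\mathbb{H}_{q^{1/2};1}^d$ and $\mathcal{L}_{q;2}^d=\mathcal{L}_{q^{1/2};1}^d$. $\tilde{\mathbb{H}}_{q;2}^d$ is the space of analytic functions $\phi$ in some sector $V_\epsilon^d$ with $\phi(\xi)=O(1)$ as $\xi\to0$ in $V_\epsilon^d$ and, for some $A>0$, $\phi(\xi)=O(e_{q^{1/2}}(A\xi))$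 as $|\xi|\to\infty$ in $V_\epsilon^d$. One writes $\hat f\in\mathbb{C}\{x\}_{q;(1,2)}^d$ if $\phi_0:=\mathcal{C}^d\hat{\mathcal{B}}_{q;1}\hat f$ satisfies $\hat{\mathcal{B}}_{q;1}\hat f\in\mathbb{H}_{q;2}^d$ and the continuation $\phi_1^d:=\mathcal{C}^d\mathcal{L}_{q;2}^d\phi_0$ belongs to $\tilde{\mathbb{H}}_{q;2}^d$; then $\mathcal{S}_{q;(1,2)}^d\hat f:=\mathcal{L}_{q;2}^d\phi_1^d$. Equality of $Gq$-sums is equality of analytic functions on some $\tilde D_R$, $R>0$. *)

theory Defs
  imports "HOL-Complex_Analysis.Complex_Analysis" "HOL-Library.Landau_Symbols"
begin

section \<open>The Riemann surface of the logarithm\<close>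

text \<open>
  A point \<open>x\<close> of the Riemann surface of the logarithm is represented by its logarithm
  \<open>w = ln |x| + i arg x\<close>, an arbitrary complex number. Analyticity on the surface is
  holomorphy in \<open>w\<close>, products become sums (a positive real factor \<open>A\<close> becomes the shift by
  \<open>ln A\<close>), and the projection to the punctured plane is \<open>exp\<close>.
\<close>

type_synonym logpt = complex

definition lmod :: "logpt \<Rightarrow> real" where "lmod w = exp (Re w)"

definition larg :: "logpt \<Rightarrow> real" where "larg w = Im w"

definition disc :: "real \<Rightarrow> logpt set" where
  "disc R = {w. lmod w < R}"

definition sector :: "real \<Rightarrow> real \<Rightarrow> logpt set" where
  "sector d \<epsilon> = {w. \<bar>larg w - d\<bar> < \<epsilon>}"

definition to_infinity_in :: "logpt set \<Rightarrow> logpt filter" where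
  "to_infinity_in S = inf (filtercomap lmod at_top) (principal S)"

definition to_zero_in :: "logpt set \<Rightarrow> logpt filter" where
  "to_zero_in S = inf (filtercomap lmod (at_right 0)) (principal S)"

definition e_fun :: "real \<Rightarrow> logpt \<Rightarrow> complex" where
  "e_fun p w = complex_of_real (sqrt (2 * pi * ln p)) *
     exp ((complex_of_real (ln (sqrt p)) + w)\<^sup>2 / (2 * complex_of_real (ln p)))"

definition is_continuation ::
    "real \<Rightarrow> real \<Rightarrow> (logpt \<Rightarrow> complex) \<Rightarrow> (logpt \<Rightarrow> complex) \<Rightarrow> bool" where
  "is_continuation d \<epsilon> g \<phi> \<longleftrightarrow>
     \<phi> holomorphic_on sector d \<epsilon> \<and> (\<exists>R>0. \<forall>w \<in> sector d \<epsilon> \<inter> disc R. \<phi> w = g w)"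

text \<open>
  The sector is not canonical, so neither is the chosen function off the ray \<open>arg = d\<close>; by the
  identity theorem any two choices agree on a common smaller sector, hence on the ray, which is
  all the Laplace transform uses.
\<close>

definition continuation :: "real \<Rightarrow> (logpt \<Rightarrow> complex) \<Rightarrow> logpt \<Rightarrow> complex" where
  "continuation d g = (SOME \<phi>. \<exists>\<epsilon>>0. is_continuation d \<epsilon> g \<phi>)"

text \<open>
  A germ at \<open>0\<close> is given by its Taylor series, of positive radius of convergence; the
  following is its lift, meaningful for small \<open>lmod w\<close>.
\<close>

definition lift_germ :: "complex fps \<Rightarrow> logpt \<Rightarrow> complex" where
  "lift_germ g w = eval_fps g (exp w)"


section \<open>Generic $q$-Gevrey series\<close>

definition sigma_q :: "real \<Rightarrow> complex fps \<Rightarrow> complex fps" where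
  "sigma_q q f = fps_compose f (fps_const (complex_of_real q) * fps_X)"

definition generic_q_Gevrey :: "real \<Rightarrow> complex fps \<Rightarrow> bool" where
  "generic_q_Gevrey q f \<longleftrightarrow>
     (\<exists>(n::nat) (a :: nat \<Rightarrow> complex fps).
        (\<forall>k\<le>n. fps_conv_radius (a k) > 0) \<and>
        fps_nth (a 0) 0 * fps_nth (a n) 0 \<noteq> 0 \<and>
        fps_conv_radius (\<Sum>k=0..n. a (n - k) * ((\<lambda>g. fps_X * sigma_q q g) ^^ k) f) > 0)"


section \<open>Level 1\<close>

definition qBorel :: "real \<Rightarrow> complex fps \<Rightarrow> complex fps" where
  "qBorel q f = Abs_fps (\<lambda>n. fps_nth f n / complex_of_real q ^ (n * (n - 1) div 2))"

definition H1 :: "real \<Rightarrow> real \<Rightarrow> complex fps set" where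
  "H1 p d = {g. fps_conv_radius g > 0 \<and>
     (\<exists>\<epsilon>>0. \<exists>\<phi>. is_continuation d \<epsilon> (lift_germ g) \<phi> \<and>
        (\<exists>A>0. \<phi> \<in> O[to_infinity_in (sector d \<epsilon>)](\<lambda>w. e_fun p (complex_of_real (ln A) + w))))}"

text \<open>
  In the coordinate \<open>log \<xi>\<close> the ray from \<open>0\<close> to \<open>\<infinity>\<close> in the direction \<open>d\<close> is the line
  \<open>t + i d\<close>, \<open>d\<xi>/\<xi>\<close> is \<open>dt\<close>, and \<open>\<xi>/x\<close> is a difference. For \<open>\<phi>\<close> in one of the spaces
  below the integral converges absolutely on some \<open>disc R\<close>; elsewhere the value is irrelevant.
\<close>

definition qLaplace :: "real \<Rightarrow> real \<Rightarrow> (logpt \<Rightarrow> complex) \<Rightarrow> logpt \<Rightarrow> complex" where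
  "qLaplace p d \<phi> w = (LINT t|lborel. \<phi> (Complex t d) / e_fun p (Complex t d - w))"

definition Gq_summable1 :: "real \<Rightarrow> real \<Rightarrow> complex fps set" where
  "Gq_summable1 q d = {f. qBorel q f \<in> H1 q d}"

definition Gq_sum1 :: "real \<Rightarrow> real \<Rightarrow> complex fps \<Rightarrow> logpt \<Rightarrow> complex" where
  "Gq_sum1 q d f = qLaplace q d (continuation d (lift_germ (qBorel q f)))"


section \<open>Level $(1,2)$\<close>

definition H2 :: "real \<Rightarrow> real \<Rightarrow> complex fps set" where
  "H2 q d = H1 (sqrt q) d"

definition qLaplace2 :: "real \<Rightarrow> real \<Rightarrow> (logpt \<Rightarrow> complex) \<Rightarrow> logpt \<Rightarrow> complex" where
  "qLaplace2 q d = qLaplace (sqrt q) d"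

text \<open>Membership in the space of functions for a given sector; the sector is quantified below.\<close>

definition Htilde2 :: "real \<Rightarrow> real \<Rightarrow> real \<Rightarrow> (logpt \<Rightarrow> complex) set" where
  "Htilde2 q d \<epsilon> = {\<phi>. \<phi> holomorphic_on sector d \<epsilon> \<and>
     \<phi> \<in> O[to_zero_in (sector d \<epsilon>)](\<lambda>_. 1) \<and>
     (\<exists>A>0. \<phi> \<in> O[to_infinity_in (sector d \<epsilon>)](\<lambda>w.
                 e_fun (sqrt q) (complex_of_real (ln A) + w)))}"

definition phi0 :: "real \<Rightarrow> real \<Rightarrow> complex fps \<Rightarrow> logpt \<Rightarrow> complex" where
  "phi0 q d f = continuation d (lift_germ (qBorel q f))"

definition phi1 :: "real \<Rightarrow> real \<Rightarrow> complex fps \<Rightarrow> logpt \<Rightarrow> complex" where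
  "phi1 q d f = continuation d (qLaplace2 q d (phi0 q d f))"

text \<open>
  The continuation is required to exist, rather than \<open>phi1\<close> merely to lie in the space: without
  a continuation \<open>phi1\<close> would be an arbitrary function.
\<close>

definition Gq_summable12 :: "real \<Rightarrow> real \<Rightarrow> complex fps set" where
  "Gq_summable12 q d = {f. qBorel q f \<in> H2 q d \<and>
     (\<exists>\<epsilon>>0. \<exists>\<phi> \<in> Htilde2 q d \<epsilon>. is_continuation d \<epsilon> (qLaplace2 q d (phi0 q d f)) \<phi>)}"

definition Gq_sum12 :: "real \<Rightarrow> real \<Rightarrow> complex fps \<Rightarrow> logpt \<Rightarrow> complex" where
  "Gq_sum12 q d f = qLaplace2 q d (phi1 q d f)"

end

theory Submission imports Defs begin

text \<open>
Write \<open>h = ln q\<close> and let \<open>f\<close>, \<open>g\<close> be the continuations along \<open>d\<close> of the Borel transforms of the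
two series, as functions of the logarithm \<open>w\<close> of the variable. On a common sector both are
bounded by \<open>C exp (max 0 (Re w + a)\<^sup>2 / (2h))\<close>. The two functions that occur in the double
summation of the product can be written down in terms of \<open>f\<close> and \<open>g\<close>.

The function of the second stage is the Gaussian mean
\<open>\<Phi>(u) = (\<pi> h) powr (-1/2) * \<integral> f(u - h/4 + \<tau>) g(u - h/4 - \<tau>) exp (- \<tau>\<^sup>2/h) d\<tau>\<close>.
Indeed, the product of the two Laplace integrals of level 1 is a double integral, and in the
coordinates given by the mean and half the difference of the two logarithmic variables the product
of the two kernels splits into the kernel of level 2 for the mean and a Gaussian in \<open>\<tau>\<close>. Hence the
Laplace transform of level 2 of \<open>\<Phi>\<close> is the product of the two sums (\<open>qLaplace_gauss_prod\<close>). Far out,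
only one of the factors \<open>f\<close>, \<open>g\<close> is large, at most of size \<open>exp (\<tau>\<^sup>2/(2h))\<close> up to lower order, which the
Gaussian absorbs; so \<open>\<Phi>\<close> is analytic in the sector, bounded at \<open>0\<close> and of growth of level 2
(\<open>gauss_prod_holomorphic\<close>, \<open>gauss_prod_growth\<close>).

The function of the first stage continues the Borel transform of the product, the series in \<open>\<xi>\<close>
with the double expansion \<open>\<Sum> A\<^sub>k B\<^sub>m q\<^bsup>-km\<^esup> \<xi>\<^bsup>k+m\<^esup>\<close> (\<open>qBorel_mult\<close>),
where \<open>A\<close> and \<open>B\<close> are the two Borel transforms. Summed over \<open>m\<close> it is
\<open>\<Sum> A\<^sub>k \<xi>\<^sup>k g(q\<^bsup>-k\<^esup> \<xi>)\<close>, where every term is analytic in the sector, but the series over \<open>k\<close> converges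
for small \<open>\<xi>\<close> only. The remedy is to sum in this way over \<open>k < N\<close>, symmetrically over
\<open>m < N\<close>, to subtract the terms counted twice, and to leave the terms with \<open>k \<ge> N\<close> and \<open>m \<ge> N\<close> as a power
series. Since \<open>km \<ge> N(k + m - N)\<close> for these, that power series converges up to a multiple of \<open>q\<^sup>N\<close>.
The expressions for different \<open>N\<close> agree and define the continuation in the sector
(\<open>star_ext_holomorphic\<close>); with \<open>N\<close> close to \<open>ln |\<xi>| / h\<close> the terms are bounded by the growth of level 2
(\<open>star_ext_growth\<close>).

It remains to see that the Laplace transform of level 2 maps the continuation to \<open>\<Phi>\<close>. By a
translation of the integration variable it maps \<open>\<xi>\<^sup>k g(q\<^bsup>-k\<^esup> \<xi>)\<close> to the Gaussian mean formed with \<open>\<xi>\<^sup>k\<close> and \<open>g\<close>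
(\<open>qLaplace_exp_times_shift\<close>). Therefore, for every \<open>N\<close>, the difference of the two sides only involves
the remainders of order \<open>N\<close>; on the ray and close to \<open>0\<close> both contributions tend to \<open>0\<close> as \<open>N\<close>
grows (\<open>qLaplace_star_ext_on_ray\<close>). The identity theorem then gives the equality in the sector.
\<close>

section \<open>Integrals depending holomorphically on a parameter\<close>

text \<open>
The functions \<open>exp (- \<delta> \<bar>t\<bar>)\<close> serve as the common integrable majorants: every Gaussian
exponent met below is at most a constant minus a multiple of \<open>\<bar>t\<bar>\<close>.
\<close>

lemma integrable_exp_neg_abs:
  fixes \<delta> :: real
  assumes "\<delta> > 0"
  shows "integrable lborel (\<lambda>t::real. exp (- (\<delta> * \<bar>t\<bar>)))"
proof -
  have "(\<lambda>x::real. exp (-\<delta>*x)) absolutely_integrable_on {0..}"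
    using integrable_on_exp_minus_to_infinity[OF assms, of 0]
    by (intro nonnegative_absolutely_integrable_1) auto
  then have "set_integrable lborel {0..} (\<lambda>x::real. exp (-\<delta>*x))"
    unfolding set_integrable_def by (subst (asm) integrable_completion) auto
  then have right: "integrable lborel (\<lambda>x::real. indicator {0..} x *\<^sub>R exp (-\<delta>*x))"
    by (simp add: set_integrable_def)
  \<comment> \<open>reflection gives the other half line\<close>
  from lborel_integrable_real_affine[OF right, of "-1" 0]
  have left: "integrable lborel (\<lambda>x::real. indicator {0..} (-x) *\<^sub>R exp (\<delta>*x))" by simp
  show ?thesis
    by (rule Bochner_Integration.integrable_bound[OF Bochner_Integration.integrable_add[OF right left]])
       (auto split: split_indicator)
qed

text \<open>
Cauchy's inequality bounds the derivative on the ball of half the radius, so that a majorant for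
the function also dominates its difference quotients.
\<close>

lemma holomorphic_difference_quotient_bound:
  fixes f :: "complex \<Rightarrow> complex"
  assumes f: "f holomorphic_on ball z r" "continuous_on (cball z r) f" and r: "r > 0"
    and M: "\<And>w. w \<in> cball z r \<Longrightarrow> norm (f w) \<le> M"
    and w: "w \<in> ball z (r/2)"
  shows "norm (f w - f z) \<le> 2 * M / r * norm (w - z)"
proof (rule field_differentiable_bound[where S = "ball z (r/2)" and f' = "deriv f"])
  fix x assume x: "x \<in> ball z (r/2)"
  have sub: "cball x (r/2) \<subseteq> cball z r" "ball x (r/2) \<subseteq> ball z r"
    using x by (auto simp: cball_subset_cball_iff ball_subset_ball_iff dist_commute)
  have "x \<in> ball z r" using x r by auto
  then show "(f has_field_derivative deriv f x) (at x within ball z (r/2))"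
    using f(1) by (metis DERIV_subset holomorphic_derivI open_ball subset_UNIV)
  have "norm ((deriv ^^ 1) f x) \<le> fact 1 * M / (r/2) ^ 1"
  proof (rule Cauchy_inequality)
    show "f holomorphic_on ball x (r/2)" using f(1) sub(2) holomorphic_on_subset by blast
    show "continuous_on (cball x (r/2)) f" using f(2) sub(1) continuous_on_subset by blast
    fix y assume "norm (x - y) = r/2"
    then have "y \<in> cball x (r/2)" by (simp add: dist_norm)
    then show "norm (f y) \<le> M" using M sub(1) by blast
  qed (use r in auto)
  then show "norm (deriv f x) \<le> 2 * M / r" by (simp add: field_simps)
qed (use r w in auto)

text \<open>
Dominated convergence, applied to the difference quotients along sequences \<open>X \<longlonglongrightarrow> z\<close>. The
derivative of the integrand with respect to the parameter need not be known to be measurable in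
advance, being a limit of measurable functions.
\<close>

lemma holomorphic_on_parameter_integral:
  fixes F :: "complex \<Rightarrow> real \<Rightarrow> complex"
  assumes S: "open S"
    and hol: "\<And>t. (\<lambda>w. F w t) holomorphic_on S"
    and meas: "\<And>w. w \<in> S \<Longrightarrow> F w \<in> borel_measurable lborel"
    and dom: "\<And>z. z \<in> S \<Longrightarrow> \<exists>r>0. \<exists>G. cball z r \<subseteq> S \<and> integrable lborel G \<and>
        (\<forall>w\<in>cball z r. \<forall>t. norm (F w t) \<le> G t)"
  shows "(\<lambda>w. LINT t|lborel. F w t) holomorphic_on S"
proof -
  have "\<exists>f'. ((\<lambda>w. LINT t|lborel. F w t) has_field_derivative f') (at z)" if z: "z \<in> S" for z
  proof -
    obtain r G where r: "r > 0" "cball z r \<subseteq> S" and G: "integrable lborel G"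
      and FG: "\<And>w t. w \<in> cball z r \<Longrightarrow> norm (F w t) \<le> G t"
      using dom[OF z] by blast
    have int: "integrable lborel (F w)" if "w \<in> cball z r" for w
    proof (rule Bochner_Integration.integrable_bound[OF G])
      show "F w \<in> borel_measurable lborel" using meas that r by blast
      show "AE t in lborel. norm (F w t) \<le> norm (G t)"
        using FG[OF that] by (auto intro!: AE_I2 order_trans[OF FG[OF that]])
    qed
    define D where "D t = deriv (\<lambda>w. F w t) z" for t
    have "((\<lambda>w. ((LINT t|lborel. F w t) - (LINT t|lborel. F z t)) / (w - z))
        \<longlongrightarrow> (LINT t|lborel. D t)) (at z)"
      unfolding tendsto_at_iff_sequentially comp_def
    proof (intro allI impI)
      fix X :: "nat \<Rightarrow> complex"
      assume X: "\<forall>i. X i \<in> UNIV - {z}" "X \<longlonglongrightarrow> z"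
      have "\<forall>\<^sub>F i in sequentially. X i \<in> ball z (r/2)"
        using tendstoD[OF X(2), of "r/2"] r(1) by (simp add: dist_commute)
      then obtain N where N: "\<And>i. i \<ge> N \<Longrightarrow> X i \<in> ball z (r/2)"
        by (auto simp: eventually_sequentially)
      define Y where "Y i = X (i + N)" for i
      have Y: "Y i \<in> ball z (r/2)" "Y i \<noteq> z" "Y i \<in> cball z r" for i
        using X N[of "i+N"] r(1) unfolding Y_def by auto
      have Ylim: "Y \<longlonglongrightarrow> z" unfolding Y_def using X(2) by (rule LIMSEQ_ignore_initial_segment)
      have lim: "(\<lambda>i. (F (Y i) t - F z t) / (Y i - z)) \<longlonglongrightarrow> D t" for t
      proof -
        have "((\<lambda>w. F w t) has_field_derivative D t) (at z)"
          unfolding D_def using hol S z by (rule holomorphic_derivI)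
        then have "((\<lambda>w. (F w t - F z t) / (w - z)) \<longlongrightarrow> D t) (at z)"
          by (simp add: has_field_derivative_iff)
        then show ?thesis
          using Y(2) Ylim unfolding tendsto_at_iff_sequentially comp_def by auto
      qed
      have meas_q: "(\<lambda>t. (F (Y i) t - F z t) / (Y i - z)) \<in> borel_measurable lborel" for i
      proof -
        have "Y i \<in> S" using Y(3) r(2) by blast
        then show ?thesis
          using meas[of "Y i"] meas[OF z] by (intro borel_measurable_divide borel_measurable_diff) auto
      qed
      have "(\<lambda>i. LINT t|lborel. (F (Y i) t - F z t) / (Y i - z)) \<longlonglongrightarrow> (LINT t|lborel. D t)"
      proof (rule integral_dominated_convergence[where w = "\<lambda>t. 2 / r * G t" and f = D])
        show "D \<in> borel_measurable lborel"
          using meas_q lim by (rule borel_measurable_LIMSEQ_metric)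
        show "integrable lborel (\<lambda>t. 2 / r * G t)" using G by simp
        show "AE t in lborel. norm ((F (Y i) t - F z t) / (Y i - z)) \<le> 2 / r * G t" for i
        proof (rule AE_I2)
          fix t
          have "norm (F (Y i) t - F z t) \<le> 2 * G t / r * norm (Y i - z)"
          proof (rule holomorphic_difference_quotient_bound[OF _ _ r(1)])
            show "(\<lambda>w. F w t) holomorphic_on ball z r"
              using hol r(2) ball_subset_cball holomorphic_on_subset by blast
            show "continuous_on (cball z r) (\<lambda>w. F w t)"
              using hol r(2) by (meson continuous_on_subset holomorphic_on_imp_continuous_on)
          qed (use FG Y in auto)
          then show "norm ((F (Y i) t - F z t) / (Y i - z)) \<le> 2 / r * G t"
            using Y(2)[of i] by (simp add: norm_divide divide_le_eq)
        qed
        show "AE t in lborel. (\<lambda>i. (F (Y i) t - F z t) / (Y i - z)) \<longlonglongrightarrow> D t"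
          by (intro AE_I2 lim)
      qed (rule meas_q)
      moreover have "(LINT t|lborel. (F (Y i) t - F z t) / (Y i - z)) =
          ((LINT t|lborel. F (Y i) t) - (LINT t|lborel. F z t)) / (Y i - z)" for i
        using int[OF Y(3)[of i]] int[of z] r(1) by simp
      ultimately have "(\<lambda>i. ((LINT t|lborel. F (X (i+N)) t) - (LINT t|lborel. F z t)) / (X (i+N) - z))
          \<longlonglongrightarrow> (LINT t|lborel. D t)"
        by (simp only: Y_def)
      then show "(\<lambda>i. ((LINT t|lborel. F (X i) t) - (LINT t|lborel. F z t)) / (X i - z))
          \<longlonglongrightarrow> (LINT t|lborel. D t)"
        by (rule LIMSEQ_offset)
    qed
    then show ?thesis by (auto simp: has_field_derivative_iff)
  qed
  then show ?thesis using S by (simp add: holomorphic_on_open)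
qed

section \<open>Gaussian growth and the $q$-Laplace integral\<close>

text \<open>
On the right the squares cancel and leave a negative linear term because \<open>a < b\<close>; on the left
the maximum vanishes and the remaining Gaussian decays faster than any linear term. The constant is
uniform for \<open>b\<close> in a compact interval, since \<open>b\<close> will contain the real part of the variable of
the Laplace transform.
\<close>

lemma gaussian_quotient_exponent:
  fixes \<kappa> a b0 b1 :: real
  assumes "\<kappa> > 0" and "a < b0"
  shows "\<exists>K. \<forall>b\<in>{b0..b1}. \<forall>s. (max 0 (s + a))\<^sup>2 / (2*\<kappa>) - (s + b)\<^sup>2 / (2*\<kappa>)
            \<le> K - (b0 - a) / \<kappa> * \<bar>s\<bar>"
proof -
  define \<delta> where "\<delta> = (b0 - a) / \<kappa>"
  have \<delta>: "\<delta> > 0" "\<kappa> * \<delta> = b0 - a" unfolding \<delta>_def using assms by auto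
  \<comment> \<open>generous enough for both cases below: \<open>\<kappa> \<delta>\<^sup>2 / 2\<close> comes from completing a square on the left\<close>
  define K where "K = \<delta> * (3 * \<bar>a\<bar> + 2 * \<bar>b0\<bar> + \<bar>b1\<bar>) + \<kappa> * \<delta>\<^sup>2 / 2"
  have "(max 0 (s + a))\<^sup>2 / (2*\<kappa>) - (s + b)\<^sup>2 / (2*\<kappa>) \<le> K - \<delta> * \<bar>s\<bar>" if b: "b \<in> {b0..b1}" for b s
  proof -
    have "(max 0 (s + a))\<^sup>2 - (s + b)\<^sup>2 \<le> 2 * \<kappa> * (K - \<delta> * \<bar>s\<bar>)"
    proof (cases "s + a \<ge> 0")
      case True
      have "\<bar>s\<bar> \<le> s + 2 * \<bar>a\<bar>" using True by (auto simp: abs_if)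
      moreover have "- s - (a + b0) / 2 \<le> 3 * A + 2 * B0 + B1 - S"
        if "S \<le> s + 2 * A" "- a \<le> A" "- b0 \<le> B0" "0 \<le> A" "0 \<le> B0" "0 \<le> B1" for A B0 B1 S :: real
        using that by (simp add: field_simps)
      ultimately have *: "- s - (a + b0) / 2 \<le> 3 * \<bar>a\<bar> + 2 * \<bar>b0\<bar> + \<bar>b1\<bar> - \<bar>s\<bar>" by simp
      have "(max 0 (s + a))\<^sup>2 - (s + b)\<^sup>2 = - ((b - a) * (2 * s + a + b))"
        using True by (simp add: power2_eq_square algebra_simps)
      also have "\<dots> \<le> - ((b0 - a) * (2 * s + a + b0))"
        using b assms True by (intro le_imp_neg_le mult_mono) auto
      also have "\<dots> = 2 * \<kappa> * (\<delta> * (- s - (a + b0) / 2))"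
        unfolding \<delta>(2)[symmetric] by (simp add: algebra_simps)
      also have "\<dots> \<le> 2 * \<kappa> * (\<delta> * (3 * \<bar>a\<bar> + 2 * \<bar>b0\<bar> + \<bar>b1\<bar> - \<bar>s\<bar>))"
        using * assms(1) \<delta>(1) by (intro mult_left_mono) auto
      also have "\<dots> \<le> 2 * \<kappa> * (K - \<delta> * \<bar>s\<bar>)"
        unfolding K_def using assms \<delta>(1) by (intro mult_left_mono) (auto simp: algebra_simps)
      finally show ?thesis .
    next
      case False
      have "0 \<le> (\<bar>s + b\<bar> - \<kappa> * \<delta>)\<^sup>2" by simp
      also have "\<dots> = (s + b)\<^sup>2 - 2 * \<kappa> * \<delta> * \<bar>s + b\<bar> + (\<kappa> * \<delta>)\<^sup>2"
        by (simp add: power2_diff power_mult_distrib)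
      finally have "- (s + b)\<^sup>2 \<le> 2 * \<kappa> * (\<delta> * (- \<bar>s + b\<bar>) + \<kappa> * \<delta>\<^sup>2 / 2)"
        by (simp add: algebra_simps power2_eq_square)
      also have "\<dots> \<le> 2 * \<kappa> * (\<delta> * (3 * \<bar>a\<bar> + 2 * \<bar>b0\<bar> + \<bar>b1\<bar> - \<bar>s\<bar>) + \<kappa> * \<delta>\<^sup>2 / 2)"
        using b assms \<delta>(1) by (intro mult_left_mono add_right_mono) auto
      also have "\<dots> = 2 * \<kappa> * (K - \<delta> * \<bar>s\<bar>)"
        unfolding K_def by (simp add: algebra_simps)
      finally show ?thesis using False by simp
    qed
    then show ?thesis
      using assms(1) by (simp add: field_simps)
  qed
  then show ?thesis unfolding \<delta>_def by blast
qed

lemma e_fun_eq: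
  assumes "p > 1"
  shows "e_fun p z = complex_of_real (sqrt (2 * pi * ln p)) *
     exp ((complex_of_real (ln p / 2) + z)\<^sup>2 / (2 * complex_of_real (ln p)))"
  using assms by (simp add: e_fun_def ln_sqrt)

lemma norm_e_fun:
  assumes "p > 1"
  shows "norm (e_fun p z) = sqrt (2 * pi * ln p) * exp (((ln p / 2 + Re z)\<^sup>2 - (Im z)\<^sup>2) / (2 * ln p))"
proof -
  have "Re ((complex_of_real (ln p / 2) + z)\<^sup>2 / (2 * complex_of_real (ln p)))
      = ((ln p / 2 + Re z)\<^sup>2 - (Im z)\<^sup>2) / (2 * ln p)"
    using Re_divide_of_real[of "(complex_of_real (ln p / 2) + z)\<^sup>2" "2 * ln p"]
    by (simp add: power2_eq_square)
  then show ?thesis using assms by (simp add: e_fun_eq norm_mult)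
qed

lemma e_fun_nonzero: "p > 1 \<Longrightarrow> e_fun p z \<noteq> 0"
  by (simp add: e_fun_eq)

lemma holomorphic_on_e_fun [holomorphic_intros]:
  assumes "p > 1" "f holomorphic_on S"
  shows "(\<lambda>z. e_fun p (f z)) holomorphic_on S"
  unfolding e_fun_eq[OF assms(1)] using assms by (intro holomorphic_intros) auto

lemma continuous_on_e_fun [continuous_intros]:
  assumes "continuous_on S f"
  shows "continuous_on S (\<lambda>z. e_fun p (f z))"
  unfolding e_fun_def divide_inverse using assms by (intro continuous_intros) 

text \<open>
Growth like \<open>e_fun p\<close> at infinity with \<open>\<kappa> = ln p\<close>, together with boundedness at \<open>0\<close>: the
maximum makes a single explicit inequality out of the two asymptotic conditions.
\<close>

definition q_growth :: "real \<Rightarrow> real \<Rightarrow> real \<Rightarrow> complex set \<Rightarrow> (complex \<Rightarrow> complex) \<Rightarrow> bool" where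
  "q_growth \<kappa> a C S \<phi> \<longleftrightarrow> (\<forall>w\<in>S. norm (\<phi> w) \<le> C * exp ((max 0 (Re w + a))\<^sup>2 / (2*\<kappa>)))"

lemma q_growthD: "q_growth \<kappa> a C S \<phi> \<Longrightarrow> w \<in> S \<Longrightarrow> norm (\<phi> w) \<le> C * exp ((max 0 (Re w + a))\<^sup>2 / (2*\<kappa>))"
  by (simp add: q_growth_def)

lemma q_growth_constant_nonneg:
  assumes "q_growth \<kappa> a C S \<phi>" "w \<in> S"
  shows "0 \<le> C"
proof -
  have "0 \<le> C * exp ((max 0 (Re w + a))\<^sup>2 / (2*\<kappa>))"
    using q_growthD[OF assms] norm_ge_zero order_trans by blast
  then show ?thesis by (simp add: zero_le_mult_iff)
qed

text \<open>
The imaginary part of the variable only contributes a constant factor, which is why the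
Laplace transform exists for all arguments once the modulus is small.
\<close>

lemma norm_qLaplace_integrand:
  assumes p: "p > 1" and \<phi>: "q_growth (ln p) a C {w. Im w = d} \<phi>"
  shows "norm (\<phi> (Complex t d) / e_fun p (Complex t d - w)) \<le>
    C / sqrt (2 * pi * ln p) * exp ((d - Im w)\<^sup>2 / (2 * ln p)) *
    exp ((max 0 (t + a))\<^sup>2 / (2 * ln p) - (t + (ln p / 2 - Re w))\<^sup>2 / (2 * ln p))"
proof -
  have "norm (\<phi> (Complex t d) / e_fun p (Complex t d - w)) =
     norm (\<phi> (Complex t d)) / (sqrt (2 * pi * ln p) *
       exp (((ln p / 2 + (t - Re w))\<^sup>2 - (d - Im w)\<^sup>2) / (2 * ln p)))"
    by (simp add: norm_divide norm_e_fun[OF p])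
  also have "\<dots> \<le> C * exp ((max 0 (t + a))\<^sup>2 / (2 * ln p)) / (sqrt (2 * pi * ln p) *
       exp (((ln p / 2 + (t - Re w))\<^sup>2 - (d - Im w)\<^sup>2) / (2 * ln p)))"
    using q_growthD[OF \<phi>, of "Complex t d"] p by (intro divide_right_mono) auto
  also have "\<dots> = C / sqrt (2 * pi * ln p) * (exp ((max 0 (t + a))\<^sup>2 / (2 * ln p)) /
      exp (((ln p / 2 + (t - Re w))\<^sup>2 - (d - Im w)\<^sup>2) / (2 * ln p)))"
    by simp
  also have "exp ((max 0 (t + a))\<^sup>2 / (2 * ln p)) /
      exp (((ln p / 2 + (t - Re w))\<^sup>2 - (d - Im w)\<^sup>2) / (2 * ln p)) =
      exp ((d - Im w)\<^sup>2 / (2 * ln p)) *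
      exp ((max 0 (t + a))\<^sup>2 / (2 * ln p) - (t + (ln p / 2 - Re w))\<^sup>2 / (2 * ln p))"
    unfolding exp_diff[symmetric] exp_add[symmetric] diff_divide_distrib by (simp add: algebra_simps)
  finally show ?thesis by simp
qed

lemma continuous_on_Complex: "continuous_on S (\<lambda>t. Complex t d)"
  unfolding Complex_eq by (intro continuous_intros)

lemma continuous_on_ray: 
  assumes "continuous_on {w. Im w = d} \<phi>"
  shows "continuous_on UNIV (\<lambda>t. \<phi> (Complex t d))"
  by (rule continuous_on_compose2[OF assms continuous_on_Complex]) auto

lemma qLaplace_integrable_and_holomorphic:
  assumes p: "p > 1" and \<phi>: "q_growth (ln p) a C {w. Im w = d} \<phi>"
    and cont: "continuous_on {w. Im w = d} \<phi>"
  shows qLaplace_integrable: "Re w < ln p / 2 - a \<Longrightarrow>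
          integrable lborel (\<lambda>t. \<phi> (Complex t d) / e_fun p (Complex t d - w))"
    and qLaplace_holomorphic: "qLaplace p d \<phi> holomorphic_on {w. Re w < ln p / 2 - a}"
proof -
  have \<kappa>: "ln p > 0" using p by simp
  have C: "C \<ge> 0"
    using q_growth_constant_nonneg[OF \<phi>, of "Complex 0 d"] by simp
  have int_cont: "continuous_on UNIV (\<lambda>t. \<phi> (Complex t d) / e_fun p (Complex t d - w))" for w
    by (intro continuous_on_divide continuous_on_ray[OF cont] continuous_on_e_fun continuous_on_diff
          continuous_on_Complex continuous_on_const) (simp add: e_fun_nonzero[OF p])
  have dom: "\<exists>r>0. \<exists>G. cball z r \<subseteq> {w. Re w < ln p / 2 - a} \<and> integrable lborel G \<and>
        (\<forall>w\<in>cball z r. \<forall>t. norm (\<phi> (Complex t d) / e_fun p (Complex t d - w)) \<le> G t)"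
    if z: "z \<in> {w. Re w < ln p / 2 - a}" for z
  proof -
    define r where "r = (ln p / 2 - a - Re z) / 2"
    define b0 b1 where "b0 = ln p / 2 - Re z - r" "b1 = ln p / 2 - Re z + r"
    have r: "r > 0" and b0: "a < b0" using z unfolding r_def b0_b1_def by (auto simp: field_simps)
    obtain K where K: "\<And>b s. b \<in> {b0..b1} \<Longrightarrow> (max 0 (s + a))\<^sup>2 / (2*ln p) - (s + b)\<^sup>2 / (2*ln p)
            \<le> K - (b0 - a) / ln p * \<bar>s\<bar>"
      using gaussian_quotient_exponent[OF \<kappa> b0] by blast
    define B where "B = C / sqrt (2 * pi * ln p) * exp ((\<bar>d - Im z\<bar> + r)\<^sup>2 / (2 * ln p)) * exp K"
    define G where "G t = B * exp (- ((b0 - a) / ln p * \<bar>t\<bar>))" for t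
    have "norm (\<phi> (Complex t d) / e_fun p (Complex t d - w)) \<le> G t" if w: "w \<in> cball z r" for w t
    proof -
      have "\<bar>Re (z - w)\<bar> \<le> r" "\<bar>Im (z - w)\<bar> \<le> r"
        using w abs_Re_le_cmod[of "z - w"] abs_Im_le_cmod[of "z - w"] by (auto simp: dist_norm)
      then have "ln p / 2 - Re w \<in> {b0..b1}" and im: "\<bar>d - Im w\<bar> \<le> \<bar>d - Im z\<bar> + r"
        unfolding b0_b1_def by auto
      from K[OF this(1), of t] have
        "exp ((max 0 (t + a))\<^sup>2 / (2 * ln p) - (t + (ln p / 2 - Re w))\<^sup>2 / (2 * ln p))
          \<le> exp K * exp (- ((b0 - a) / ln p * \<bar>t\<bar>))"
        by (simp flip: exp_add)
      moreover have "exp ((d - Im w)\<^sup>2 / (2 * ln p)) \<le> exp ((\<bar>d - Im z\<bar> + r)\<^sup>2 / (2 * ln p))"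
        using \<kappa> power_mono[OF im, of 2] by (simp add: divide_right_mono)
      ultimately show ?thesis
        unfolding G_def B_def
        using C \<kappa> by (intro order_trans[OF norm_qLaplace_integrand[OF p \<phi>]])
          (auto simp: mult.assoc intro!: divide_right_mono mult_left_mono mult_mono)
    qed
    moreover have "integrable lborel G"
      unfolding G_def using integrable_exp_neg_abs[of "(b0 - a) / ln p"] b0 \<kappa> by simp
    moreover have "cball z r \<subseteq> {w. Re w < ln p / 2 - a}"
    proof
      fix w assume "w \<in> cball z r"
      then have "\<bar>Re (z - w)\<bar> \<le> r"
        using abs_Re_le_cmod[of "z - w"] by (auto simp: dist_norm)
      moreover have "Re z + 2 * r = ln p / 2 - a" unfolding r_def by (simp add: field_simps)
      ultimately have "Re w < ln p / 2 - a" using r by simp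
      then show "w \<in> {w. Re w < ln p / 2 - a}" by simp
    qed
    ultimately show ?thesis using r by blast
  qed
  show "qLaplace p d \<phi> holomorphic_on {w. Re w < ln p / 2 - a}"
    unfolding qLaplace_def
  proof (rule holomorphic_on_parameter_integral[OF _ _ _ dom])
    show "(\<lambda>w. \<phi> (Complex t d) / e_fun p (Complex t d - w)) holomorphic_on {w. Re w < ln p / 2 - a}" for t
      using p e_fun_nonzero[OF p] by (intro holomorphic_intros) auto
    show "(\<lambda>t. \<phi> (Complex t d) / e_fun p (Complex t d - w)) \<in> borel_measurable lborel" for w
      using borel_measurable_continuous_onI[OF int_cont] by simp
  qed (auto simp: open_halfspace_Re_lt)
  show "integrable lborel (\<lambda>t. \<phi> (Complex t d) / e_fun p (Complex t d - w))" if w: "Re w < ln p / 2 - a"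
  proof -
    obtain r G where "r > 0" "integrable lborel G"
        and G: "\<forall>w\<in>cball w r. \<forall>t. norm (\<phi> (Complex t d) / e_fun p (Complex t d - w)) \<le> G t"
      using dom[of w] w by auto
    then have *: "norm (\<phi> (Complex t d) / e_fun p (Complex t d - w)) \<le> G t" for t by auto
    show ?thesis
    proof (rule Bochner_Integration.integrable_bound[OF \<open>integrable lborel G\<close>])
      show "AE t in lborel. norm (\<phi> (Complex t d) / e_fun p (Complex t d - w)) \<le> norm (G t)"
        using * by (auto intro!: AE_I2 order_trans[OF *])
      show "(\<lambda>t. \<phi> (Complex t d) / e_fun p (Complex t d - w)) \<in> borel_measurable lborel"
        using borel_measurable_continuous_onI[OF int_cont] by simp
    qed
  qed
qed

section \<open>Sectors and continuation along a direction\<close>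

lemma open_sector: "open (sector d \<epsilon>)"
proof -
  have "sector d \<epsilon> = {w. Im w > d - \<epsilon>} \<inter> {w. Im w < d + \<epsilon>}"
    by (auto simp: sector_def larg_def abs_less_iff)
  then show ?thesis by (simp add: open_Int open_halfspace_Im_gt open_halfspace_Im_lt)
qed

lemma convex_sector: "convex (sector d \<epsilon>)"
proof -
  have "sector d \<epsilon> = {w. Im w > d - \<epsilon>} \<inter> {w. Im w < d + \<epsilon>}"
    by (auto simp: sector_def larg_def abs_less_iff)
  then show ?thesis by (simp add: convex_Int convex_halfspace_Im_gt convex_halfspace_Im_lt)
qed

lemma ray_in_sector [simp]: "\<epsilon> > 0 \<Longrightarrow> Complex t d \<in> sector d \<epsilon>"
  by (simp add: sector_def larg_def)

lemma ray_subset_sector: "\<epsilon> > 0 \<Longrightarrow> {w. Im w = d} \<subseteq> sector d \<epsilon>"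
  by (auto simp: sector_def larg_def)

lemma sector_mono: "\<epsilon> \<le> \<epsilon>' \<Longrightarrow> sector d \<epsilon> \<subseteq> sector d \<epsilon>'"
  by (auto simp: sector_def)

lemma disc_eq: "R > 0 \<Longrightarrow> disc R = {w. Re w < ln R}"
  using exp_less_cancel_iff[of _ "ln R"] unfolding disc_def lmod_def by simp

text \<open>
The identity theorem on a sector cut off at a modulus, both being convex in the logarithmic
coordinate.
\<close>

lemma strip_identity:
  assumes \<epsilon>: "\<epsilon> > 0"
    and f: "f holomorphic_on sector d \<epsilon> \<inter> {w. Re w < \<rho>}"
    and g: "g holomorphic_on sector d \<epsilon> \<inter> {w. Re w < \<rho>}"
    and eq: "\<And>w. w \<in> sector d \<epsilon> \<Longrightarrow> Re w < r \<Longrightarrow> Re w < \<rho> \<Longrightarrow> f w = g w"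
    and w: "w \<in> sector d \<epsilon>" "Re w < \<rho>"
  shows "f w = g w"
proof (rule analytic_continuation_open[where f = f and g = g and z = w and s = "sector d \<epsilon> \<inter> {w. Re w < min r \<rho>}"
      and s' = "sector d \<epsilon> \<inter> {w. Re w < \<rho>}"])
  show "open (sector d \<epsilon> \<inter> {w. Re w < min r \<rho>})" "open (sector d \<epsilon> \<inter> {w. Re w < \<rho>})"
    using open_sector open_halfspace_Re_lt by blast+
  have "Complex (min r \<rho> - 1) d \<in> sector d \<epsilon> \<inter> {w. Re w < min r \<rho>}"
    using \<epsilon> by (simp add: min_def)
  then show "sector d \<epsilon> \<inter> {w. Re w < min r \<rho>} \<noteq> {}" by blast
  show "connected (sector d \<epsilon> \<inter> {w. Re w < \<rho>})"
    by (intro convex_connected convex_Int convex_sector convex_halfspace_Re_lt)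
qed (use f g eq w in auto)

lemma sector_identity:
  assumes \<epsilon>: "\<epsilon> > 0" and f: "f holomorphic_on sector d \<epsilon>" and g: "g holomorphic_on sector d \<epsilon>"
    and eq: "\<And>w. w \<in> sector d \<epsilon> \<Longrightarrow> Re w < r \<Longrightarrow> f w = g w"
    and w: "w \<in> sector d \<epsilon>"
  shows "f w = g w"
proof (rule strip_identity[OF \<epsilon>, where f = f and g = g and \<rho> = "Re w + 1" and r = r])
  show "f holomorphic_on sector d \<epsilon> \<inter> {z. Re z < Re w + 1}"
    using f by (rule holomorphic_on_subset) blast
  show "g holomorphic_on sector d \<epsilon> \<inter> {z. Re z < Re w + 1}"
    using g by (rule holomorphic_on_subset) blast
qed (use eq w in auto)

text \<open>
Any two continuations agree on the smaller of their two sectors. Thus the arbitrary choice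
contained in \<open>continuation\<close> is invisible to the Laplace transform.
\<close>

lemma continuation_on_ray:
  assumes \<phi>: "is_continuation d \<epsilon> g \<phi>" and \<epsilon>: "\<epsilon> > 0"
  shows "continuation d g (Complex t d) = \<phi> (Complex t d)"
proof -
  have "\<exists>\<epsilon>>0. is_continuation d \<epsilon> g (continuation d g)"
    unfolding continuation_def
    by (rule someI_ex[of "\<lambda>\<phi>. \<exists>\<epsilon>>0. is_continuation d \<epsilon> g \<phi>"]) (use assms in blast)
  then obtain \<epsilon>' where \<epsilon>': "\<epsilon>' > 0" and \<psi>: "is_continuation d \<epsilon>' g (continuation d g)"
    by blast
  define \<eta> where "\<eta> = min \<epsilon> \<epsilon>'"
  have \<eta>: "\<eta> > 0" "sector d \<eta> \<subseteq> sector d \<epsilon>" "sector d \<eta> \<subseteq> sector d \<epsilon>'"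
    unfolding \<eta>_def using \<epsilon> \<epsilon>' by (auto intro!: sector_mono)
  obtain R where R: "R > 0" "\<And>w. w \<in> sector d \<epsilon> \<Longrightarrow> Re w < ln R \<Longrightarrow> \<phi> w = g w"
    using \<phi> unfolding is_continuation_def by (metis IntI disc_eq mem_Collect_eq)
  obtain R' where R': "R' > 0" "\<And>w. w \<in> sector d \<epsilon>' \<Longrightarrow> Re w < ln R' \<Longrightarrow> continuation d g w = g w"
    using \<psi> unfolding is_continuation_def by (metis IntI disc_eq mem_Collect_eq)
  show ?thesis
  proof (rule sector_identity[OF \<eta>(1), where f = "continuation d g" and g = \<phi> and r = "min (ln R) (ln R')"])
    show "continuation d g holomorphic_on sector d \<eta>" "\<phi> holomorphic_on sector d \<eta>"
      using \<phi> \<psi> \<eta> holomorphic_on_subset unfolding is_continuation_def by blast+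
    show "continuation d g w = \<phi> w" if "w \<in> sector d \<eta>" "Re w < min (ln R) (ln R')" for w
    proof -
      have "w \<in> sector d \<epsilon>" "w \<in> sector d \<epsilon>'" using that \<eta> by blast+
      then show ?thesis using R(2)[of w] R'(2)[of w] that(2) by simp
    qed
    show "Complex t d \<in> sector d \<eta>" using \<eta>(1) by simp
  qed
qed

lemma qLaplace_continuation:
  assumes "is_continuation d \<epsilon> g \<phi>" "\<epsilon> > 0"
  shows "qLaplace p d (continuation d g) = qLaplace p d \<phi>"
  unfolding qLaplace_def continuation_on_ray[OF assms] ..

lemma eventually_to_infinity_in:
  "eventually P (to_infinity_in S) \<longleftrightarrow> (\<exists>r. \<forall>w\<in>S. Re w \<ge> r \<longrightarrow> P w)"
proof -
  have "eventually P (to_infinity_in S) \<longleftrightarrow> (\<exists>X. \<forall>w. X \<le> lmod w \<longrightarrow> w \<in> S \<longrightarrow> P w)"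
    unfolding to_infinity_in_def eventually_inf_principal eventually_filtercomap_at_top_linorder ..
  also have "\<dots> \<longleftrightarrow> (\<exists>r. \<forall>w\<in>S. Re w \<ge> r \<longrightarrow> P w)"
  proof
    assume "\<exists>X. \<forall>w. X \<le> lmod w \<longrightarrow> w \<in> S \<longrightarrow> P w"
    then obtain X where X: "\<forall>w. X \<le> lmod w \<longrightarrow> w \<in> S \<longrightarrow> P w" by blast
    have "P w" if "w \<in> S" "Re w \<ge> ln (max 1 X)" for w
    proof -
      have "max 1 X \<le> lmod w" using that(2) exp_le_cancel_iff[of "ln (max 1 X)" "Re w"]
        by (simp add: lmod_def less_max_iff_disj del: exp_le_cancel_iff)
      then show ?thesis using X that(1) by auto
    qed
    then show "\<exists>r. \<forall>w\<in>S. Re w \<ge> r \<longrightarrow> P w" by blast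
  next
    assume "\<exists>r. \<forall>w\<in>S. Re w \<ge> r \<longrightarrow> P w"
    then obtain r where "\<forall>w\<in>S. Re w \<ge> r \<longrightarrow> P w" by blast
    then have "\<forall>w. exp r \<le> lmod w \<longrightarrow> w \<in> S \<longrightarrow> P w" unfolding lmod_def by auto
    then show "\<exists>X. \<forall>w. X \<le> lmod w \<longrightarrow> w \<in> S \<longrightarrow> P w" by blast
  qed
  finally show ?thesis .
qed

lemma eventually_to_zero_inI:
  assumes "\<And>w. w \<in> S \<Longrightarrow> Re w < r \<Longrightarrow> P w"
  shows "eventually P (to_zero_in S)"
proof -
  have "eventually (\<lambda>x. x < exp r) (at_right (0::real))"
    unfolding eventually_at_right_field by (rule exI[of _ "exp r"]) auto
  then have "eventually (\<lambda>w. lmod w < exp r) (filtercomap lmod (at_right 0))"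
    by (rule eventually_filtercomapI)
  then show ?thesis
    unfolding to_zero_in_def eventually_inf_principal
    by eventually_elim (use assms in \<open>auto simp: lmod_def\<close>)
qed

lemma q_growth_imp_bigo_e_fun:
  assumes p: "p > 1" and \<phi>: "q_growth (ln p) a C (sector d \<epsilon>) \<phi>" and C: "C \<ge> 0"
  shows "\<exists>A>0. \<phi> \<in> O[to_infinity_in (sector d \<epsilon>)](\<lambda>w. e_fun p (complex_of_real (ln A) + w))"
proof (intro exI[of _ "exp a"] conjI bigoI)
  have \<kappa>: "ln p > 0" using p by simp
  define c where "c = C / sqrt (2 * pi * ln p) * exp ((\<bar>d\<bar> + \<epsilon>)\<^sup>2 / (2 * ln p))"
  have "norm (\<phi> w) \<le> c * norm (e_fun p (complex_of_real (ln (exp a)) + w))"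
    if w: "w \<in> sector d \<epsilon>" "Re w \<ge> - a" for w
  proof -
    have "\<bar>Im w\<bar> \<le> \<bar>d\<bar> + \<epsilon>" using w(1) by (auto simp: sector_def larg_def)
    then have im: "(Im w)\<^sup>2 \<le> (\<bar>d\<bar> + \<epsilon>)\<^sup>2"
      using power_mono[of "\<bar>Im w\<bar>" "\<bar>d\<bar> + \<epsilon>" 2] by simp
    have re: "(max 0 (Re w + a))\<^sup>2 \<le> (ln p / 2 + (a + Re w))\<^sup>2"
      using w(2) \<kappa> by (intro power_mono) auto
    have "norm (\<phi> w) \<le> C * exp ((max 0 (Re w + a))\<^sup>2 / (2 * ln p))"
      by (rule q_growthD[OF \<phi> w(1)])
    also have "\<dots> \<le> C * exp ((\<bar>d\<bar> + \<epsilon>)\<^sup>2 / (2 * ln p) + ((ln p / 2 + (a + Re w))\<^sup>2 - (Im w)\<^sup>2) / (2 * ln p))"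
      using C \<kappa> im re by (intro mult_left_mono) (auto simp: divide_right_mono simp flip: add_divide_distrib)
    also have "\<dots> = c * norm (e_fun p (complex_of_real (ln (exp a)) + w))"
      using \<kappa> unfolding c_def norm_e_fun[OF p] exp_add by simp
    finally show ?thesis .
  qed
  then show "\<forall>\<^sub>F w in to_infinity_in (sector d \<epsilon>).
      norm (\<phi> w) \<le> c * norm (e_fun p (complex_of_real (ln (exp a)) + w))"
    unfolding eventually_to_infinity_in by blast
qed simp

lemma q_growth_imp_bigo_1:
  assumes \<phi>: "q_growth \<kappa> a C S \<phi>"
  shows "\<phi> \<in> O[to_zero_in S](\<lambda>_. 1)"
proof (rule bigoI[where c = C])
  show "\<forall>\<^sub>F w in to_zero_in S. norm (\<phi> w) \<le> C * norm (1::complex)"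
  proof (rule eventually_to_zero_inI)
    fix w assume w: "w \<in> S" "Re w < - a"
    then have "max 0 (Re w + a) = 0" by simp
    then show "norm (\<phi> w) \<le> C * norm (1::complex)" using q_growthD[OF \<phi> w(1)] by simp
  qed
qed

section \<open>Continuations of convergent germs\<close>

text \<open>
The power series is dominated by a geometric series of ratio at most \<open>exp (-1) \<le> 1/2\<close>.
\<close>

lemma norm_eval_fps_exp_le:
  fixes g :: "complex fps"
  assumes g: "\<And>n. norm (fps_nth g n) \<le> M * exp (a * real n)" and r: "Re w \<le> - a - 1"
  shows "summable (\<lambda>n. norm (fps_nth g n * exp w ^ n))" and "norm (eval_fps g (exp w)) \<le> 2 * M"
proof -
  have M: "M \<ge> 0" using g[of 0] norm_ge_zero[of "fps_nth g 0"] by (simp only: mult_zero_right exp_zero mult_1_right of_nat_0)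
  have le: "norm (fps_nth g n * exp w ^ n) \<le> M * (1/2) ^ n" for n
  proof -
    have "norm (fps_nth g n * exp w ^ n) \<le> M * exp (a * real n) * exp (real n * Re w)"
      using g[of n] by (simp add: norm_mult norm_power exp_of_nat_mult mult_right_mono)
    also have "\<dots> = M * exp (a + Re w) ^ n"
      unfolding exp_of_nat_mult[symmetric] mult.assoc exp_add[symmetric] by (simp add: algebra_simps)
    also have "\<dots> \<le> M * (1/2) ^ n"
    proof -
      have "exp (a + Re w) \<le> exp (-1)" using r by simp
      also have "\<dots> \<le> (1/2 :: real)"
        using exp_ge_add_one_self[of "1::real"] by (simp add: exp_minus field_simps)
      finally show ?thesis using M by (intro mult_left_mono power_mono) auto
    qed
    finally show ?thesis .
  qed
  have geo: "(\<lambda>n. M * (1/2::real) ^ n) sums (M * 2)"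
    using sums_mult[OF geometric_sums[of "1/2::real"], of M] by simp
  show *: "summable (\<lambda>n. norm (fps_nth g n * exp w ^ n))"
    by (rule summable_comparison_test'[OF sums_summable[OF geo]]) (use le in auto)
  have "norm (eval_fps g (exp w)) \<le> (\<Sum>n. norm (fps_nth g n * exp w ^ n))"
    unfolding eval_fps_def by (rule summable_norm[OF *])
  also have "\<dots> \<le> (\<Sum>n. M * (1/2) ^ n)"
    by (rule suminf_le[OF le * sums_summable[OF geo]])
  also have "\<dots> = 2 * M" using sums_unique[OF geo] by simp
  finally show "norm (eval_fps g (exp w)) \<le> 2 * M" .
qed

lemma fps_coefficients_geometric_bound:
  fixes g :: "complex fps"
  assumes "fps_conv_radius g > 0"
  obtains M a where "\<And>n. norm (fps_nth g n) \<le> M * exp (a * real n)"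
proof -
  obtain s where s: "s > 0" "ereal s < fps_conv_radius g"
    using ereal_dense2[of 0 "fps_conv_radius g"] assms by (metis ereal_less(2))
  have "summable (\<lambda>n. norm (fps_nth g n * complex_of_real s ^ n))"
    by (rule abs_summable_in_conv_radius) (use s in \<open>simp add: fps_conv_radius_def\<close>)
  then have "bounded (range (\<lambda>n. norm (fps_nth g n * complex_of_real s ^ n)))"
    using summable_LIMSEQ_zero convergentI convergent_imp_bounded by blast
  then obtain M where M: "\<And>n. norm (fps_nth g n * complex_of_real s ^ n) \<le> M"
    by (auto simp: bounded_iff)
  have "norm (fps_nth g n) \<le> M * exp (- ln s * real n)" for n
  proof -
    have "exp (- ln s * real n) = inverse (s ^ n)"
      using s(1) by (simp add: exp_minus mult.commute exp_of_nat_mult)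
    then have "M * exp (- ln s * real n) = M / s ^ n" by (simp only: divide_inverse)
    then show ?thesis using M[of n] s(1) by (simp add: norm_mult norm_power pos_le_divide_eq)
  qed
  then show ?thesis by (rule that)
qed

text \<open>
Near \<open>0\<close> the function is bounded by its power series, near infinity by hypothesis, and in
between by compactness; the last part needs a slightly smaller sector, whose closure lies in the
original one.
\<close>

lemma H1_growth:
  assumes p: "p > 1" and g: "g \<in> H1 p d"
  obtains \<epsilon> \<phi> a C where "\<epsilon> > 0" "is_continuation d \<epsilon> (lift_germ g) \<phi>" "C \<ge> 0"
    "q_growth (ln p) a C (sector d \<epsilon>) \<phi>"
    "\<And>n. norm (fps_nth g n) \<le> C * exp (a * real n)"
    "\<And>w. w \<in> sector d \<epsilon> \<Longrightarrow> Re w < - a \<Longrightarrow> \<phi> w = eval_fps g (exp w)"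
proof -
  have \<kappa>: "ln p > 0" using p by simp
  obtain \<epsilon> \<phi> A where \<epsilon>: "\<epsilon> > 0" and \<phi>: "is_continuation d \<epsilon> (lift_germ g) \<phi>" and "A > 0"
    and O: "\<phi> \<in> O[to_infinity_in (sector d \<epsilon>)](\<lambda>w. e_fun p (complex_of_real (ln A) + w))"
    and rad: "fps_conv_radius g > 0"
    using g unfolding H1_def by blast
  obtain M a1 where M: "\<And>n. norm (fps_nth g n) \<le> M * exp (a1 * real n)"
    using fps_coefficients_geometric_bound[OF rad] by blast
  have "M \<ge> 0" using M[of 0] norm_ge_zero[of "fps_nth g 0"] by (simp only: mult_zero_right exp_zero mult_1_right of_nat_0)
  obtain R where R: "R > 0" "\<And>w. w \<in> sector d \<epsilon> \<Longrightarrow> Re w < ln R \<Longrightarrow> \<phi> w = eval_fps g (exp w)"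
    using \<phi> unfolding is_continuation_def lift_germ_def by (metis IntI disc_eq mem_Collect_eq)
  obtain c where "c > 0" and
    "\<forall>\<^sub>F w in to_infinity_in (sector d \<epsilon>). norm (\<phi> w) \<le> c * norm (e_fun p (complex_of_real (ln A) + w))"
    using O by (elim landau_o.bigE)
  then obtain r1 where r1: "\<And>w. w \<in> sector d \<epsilon> \<Longrightarrow> Re w \<ge> r1 \<Longrightarrow>
      norm (\<phi> w) \<le> c * norm (e_fun p (complex_of_real (ln A) + w))"
    unfolding eventually_to_infinity_in by blast
  define a0 where "a0 = ln p / 2 + ln A"
  define a where "a = max (max (a1 + 1) a0) (1 - ln R)"
  have a: "a \<ge> a1 + 1" "a \<ge> a0" "a \<ge> 1 - ln R" unfolding a_def by auto
  \<comment> \<open>beyond \<open>r2\<close> the number \<open>a0 + Re w\<close> is nonnegative, so that its square increases with \<open>a0\<close>\<close>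
  define r2 where "r2 = max r1 (- a0)"
  define B where "B = cbox (Complex (- a) (d - \<epsilon>/2)) (Complex r2 (d + \<epsilon>/2))"
  have sub: "sector d (\<epsilon>/2) \<subseteq> sector d \<epsilon>" using \<epsilon> by (intro sector_mono) simp
  have "B \<subseteq> sector d \<epsilon>"
    unfolding B_def sector_def larg_def using \<epsilon> by (auto simp: in_cbox_complex_iff abs_if)
  then have "continuous_on B \<phi>"
    using \<phi> unfolding is_continuation_def by (meson continuous_on_subset holomorphic_on_imp_continuous_on)
  moreover have "compact B" unfolding B_def by simp
  ultimately have "bounded (\<phi> ` B)" by (simp add: compact_continuous_image compact_imp_bounded)
  then obtain M3 where M3: "M3 > 0" "\<And>w. w \<in> B \<Longrightarrow> norm (\<phi> w) \<le> M3"
    by (auto simp: bounded_pos)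
  define C where "C = 2 * M + M3 + c * sqrt (2 * pi * ln p)"
  have parts: "0 \<le> 2 * M" "0 \<le> M3" "0 \<le> c * sqrt (2 * pi * ln p)"
    using \<open>M \<ge> 0\<close> \<open>c > 0\<close> \<kappa> M3(1) by auto
  have ge1: "1 \<le> exp ((max 0 (Re w + a))\<^sup>2 / (2 * ln p))" for w using \<kappa> by simp
  have bound: "norm (\<phi> w) \<le> C * exp ((max 0 (Re w + a))\<^sup>2 / (2 * ln p))" if w: "w \<in> sector d (\<epsilon>/2)" for w
  proof -
    consider "Re w \<le> - a" | "- a < Re w" "Re w < r2" | "r2 \<le> Re w" by linarith
    then show ?thesis
    proof cases
      case 1
      then have "norm (\<phi> w) \<le> 2 * M"
        using R(2)[of w] sub w norm_eval_fps_exp_le(2)[OF M, of w] a by auto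
      also have "\<dots> \<le> C" using parts unfolding C_def by linarith
      also have "\<dots> \<le> C * exp ((max 0 (Re w + a))\<^sup>2 / (2 * ln p))"
        using mult_left_mono[OF ge1, of C] parts unfolding C_def by simp
      finally show ?thesis .
    next
      case 2
      then have "w \<in> B" using w unfolding B_def sector_def larg_def
        by (simp add: in_cbox_complex_iff abs_less_iff) argo
      then have "norm (\<phi> w) \<le> M3" by (rule M3)
      also have "\<dots> \<le> C" using parts unfolding C_def by linarith
      also have "\<dots> \<le> C * exp ((max 0 (Re w + a))\<^sup>2 / (2 * ln p))"
        using mult_left_mono[OF ge1, of C] parts unfolding C_def by simp
      finally show ?thesis .
    next
      case 3
      then have nn: "0 \<le> a0 + Re w" "r1 \<le> Re w" unfolding r2_def by auto
      have "(a0 + Re w)\<^sup>2 \<le> (max 0 (Re w + a))\<^sup>2"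
        using nn a(2) by (intro power_mono) auto
      then have le: "((a0 + Re w)\<^sup>2 - (Im w)\<^sup>2) / (2 * ln p) \<le> (max 0 (Re w + a))\<^sup>2 / (2 * ln p)"
        using \<kappa> by (intro divide_right_mono) (auto intro: order_trans[rotated])
      have "norm (\<phi> w) \<le> c * norm (e_fun p (complex_of_real (ln A) + w))"
        using r1 nn(2) w sub by blast
      also have "\<dots> = c * sqrt (2 * pi * ln p) * exp (((a0 + Re w)\<^sup>2 - (Im w)\<^sup>2) / (2 * ln p))"
        unfolding norm_e_fun[OF p] a0_def by (simp add: add.assoc)
      also have "\<dots> \<le> C * exp ((max 0 (Re w + a))\<^sup>2 / (2 * ln p))"
        using parts le unfolding C_def by (intro mult_mono) auto
      finally show ?thesis .
    qed
  qed
  show ?thesis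
  proof (rule that[of "\<epsilon>/2" \<phi> C a])
    show "\<epsilon>/2 > 0" using \<epsilon> by simp
    show "is_continuation d (\<epsilon>/2) (lift_germ g) \<phi>"
      using \<phi> sub unfolding is_continuation_def by (meson IntD1 IntD2 IntI holomorphic_on_subset subsetD)
    show "C \<ge> 0" using parts unfolding C_def by linarith
    show "q_growth (ln p) a C (sector d (\<epsilon>/2)) \<phi>" unfolding q_growth_def using bound by blast
    show "norm (fps_nth g n) \<le> C * exp (a * real n)" for n
    proof -
      have "M \<le> C" using parts unfolding C_def by linarith
      moreover have "exp (a1 * real n) \<le> exp (a * real n)" using a(1) by (simp add: mult_right_mono)
      ultimately show ?thesis using M[of n] \<open>M \<ge> 0\<close>
        by (meson exp_ge_zero mult_mono order_trans)
    qed
    show "\<phi> w = eval_fps g (exp w)" if "w \<in> sector d (\<epsilon>/2)" "Re w < - a" for w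
      using R(2)[of w] that sub a(3) by auto
  qed
qed

section \<open>The Gaussian product and its Laplace transform\<close>

text \<open>
Negative \<open>y\<close> may be replaced by \<open>0\<close>. If \<open>\<bar>\<tau>\<bar> \<le> y\<close>, the parallelogram law shows that the left side is at most \<open>y\<^sup>2 / h\<close>. Beyond, only one
of the first two terms survives and the exponent is \<open>(2 y\<^sup>2 - (\<bar>\<tau>\<bar> - y)\<^sup>2) / (2h)\<close>. The linear decay in
\<open>\<tau>\<close> on the right costs replacing \<open>y\<close> by \<open>y + 1\<close>.
\<close>

lemma gaussian_product_exponent:
  fixes h y \<tau> :: real
  assumes h: "h > 0"
  shows "(max 0 (y + \<tau>))\<^sup>2 / (2*h) + (max 0 (y - \<tau>))\<^sup>2 / (2*h) - \<tau>\<^sup>2 / h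
     \<le> (max 0 y + 1)\<^sup>2 / h - \<bar>\<tau>\<bar> / h"
proof -
  define Y where "Y = max 0 y"
  have Y: "0 \<le> Y" "y \<le> Y" unfolding Y_def by auto
  have main: "(max 0 (y + t))\<^sup>2 + (max 0 (y - t))\<^sup>2 - 2 * t\<^sup>2 \<le> 2 * (Y + 1)\<^sup>2 - 2 * t" if t: "t \<ge> 0" for t
  proof (cases "t \<le> Y")
    case True
    have "(max 0 (y + t))\<^sup>2 + (max 0 (y - t))\<^sup>2 \<le> (Y + t)\<^sup>2 + (Y - t)\<^sup>2"
      using True Y t by (intro add_mono power_mono) auto
    also have "\<dots> = 2 * Y\<^sup>2 + 2 * t\<^sup>2" by (simp add: power2_eq_square algebra_simps)
    finally show ?thesis using True Y by (simp add: power2_eq_square algebra_simps)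
  next
    case False
    have "(max 0 (y + t))\<^sup>2 \<le> (Y + t)\<^sup>2" using Y t by (intro power_mono) auto
    moreover have "(max 0 (y - t))\<^sup>2 = 0" using False Y by simp
    moreover have "(Y + t)\<^sup>2 - 2 * t\<^sup>2 = 2 * (Y + 1)\<^sup>2 - 2 * t - (t - Y - 1)\<^sup>2 - 2 * Y - 1"
      by (simp add: power2_eq_square algebra_simps)
    moreover note Y(1) zero_le_power2[of "t - Y - 1"]
    ultimately show ?thesis by linarith
  qed
  have "(max 0 (y + \<tau>))\<^sup>2 + (max 0 (y - \<tau>))\<^sup>2 - 2 * \<tau>\<^sup>2 \<le> 2 * (Y + 1)\<^sup>2 - 2 * \<bar>\<tau>\<bar>"
    using main[of "\<bar>\<tau>\<bar>"] by (cases "\<tau> \<ge> 0") auto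
  then have "((max 0 (y + \<tau>))\<^sup>2 + (max 0 (y - \<tau>))\<^sup>2 - 2 * \<tau>\<^sup>2) / (2*h) \<le> (2 * (Y + 1)\<^sup>2 - 2 * \<bar>\<tau>\<bar>) / (2*h)"
    using h by (intro divide_right_mono) auto
  then show ?thesis using h unfolding Y_def[symmetric] by (simp add: add_divide_distrib diff_divide_distrib)
qed

definition gauss_integrand ::
    "real \<Rightarrow> (complex \<Rightarrow> complex) \<Rightarrow> (complex \<Rightarrow> complex) \<Rightarrow> complex \<Rightarrow> real \<Rightarrow> complex" where
  "gauss_integrand h f g u \<tau> = f (u - of_real (h/4) + of_real \<tau>) * g (u - of_real (h/4) - of_real \<tau>) *
     of_real (exp (- (\<tau>\<^sup>2 / h)) / sqrt (pi * h))"

text \<open>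
The mean of \<open>f(u - h/4 + \<tau>) g(u - h/4 - \<tau>)\<close> over a centred normal variable \<open>\<tau>\<close> of variance
\<open>h/2\<close>. It sends the Borel transforms of level 1 of two monomials to the Borel transform of level 2
of their product.
\<close>

definition gauss_prod ::
    "real \<Rightarrow> (complex \<Rightarrow> complex) \<Rightarrow> (complex \<Rightarrow> complex) \<Rightarrow> complex \<Rightarrow> complex" where
  "gauss_prod h f g u = (LINT \<tau>|lborel. gauss_integrand h f g u \<tau>)"

lemma sector_translate [simp]:
  "u + complex_of_real x \<in> sector d \<epsilon> \<longleftrightarrow> u \<in> sector d \<epsilon>"
  "u - complex_of_real x \<in> sector d \<epsilon> \<longleftrightarrow> u \<in> sector d \<epsilon>"
  by (simp_all add: sector_def larg_def)

lemma norm_gauss_integrand: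
  assumes h: "h > 0" and f: "q_growth h a C S f" and g: "q_growth h a C' S g"
    and S: "u - of_real (h/4) + of_real \<tau> \<in> S" "u - of_real (h/4) - of_real \<tau> \<in> S"
  shows "norm (gauss_integrand h f g u \<tau>) \<le> C * C' / sqrt (pi * h) *
     exp ((max 0 (Re u - h/4 + a) + 1)\<^sup>2 / h) * exp (- (1/h * \<bar>\<tau>\<bar>))"
proof -
  define y where "y = Re u - h/4 + a"
  have C: "C \<ge> 0" "C' \<ge> 0" 
    using q_growth_constant_nonneg[OF f S(1)] q_growth_constant_nonneg[OF g S(1)] by auto
  have "norm (gauss_integrand h f g u \<tau>) = norm (f (u - of_real (h/4) + of_real \<tau>)) *
      norm (g (u - of_real (h/4) - of_real \<tau>)) * (exp (- (\<tau>\<^sup>2 / h)) / sqrt (pi * h))"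
    using h by (simp add: gauss_integrand_def norm_mult norm_divide)
  also have "\<dots> \<le> (C * exp ((max 0 (y + \<tau>))\<^sup>2 / (2*h))) * (C' * exp ((max 0 (y - \<tau>))\<^sup>2 / (2*h)))
      * (exp (- (\<tau>\<^sup>2 / h)) / sqrt (pi * h))"
    using q_growthD[OF f S(1)] q_growthD[OF g S(2)] C h
    by (intro mult_right_mono mult_mono) (auto simp: y_def algebra_simps)
  also have "\<dots> = C * C' / sqrt (pi * h) *
      exp ((max 0 (y + \<tau>))\<^sup>2 / (2*h) + (max 0 (y - \<tau>))\<^sup>2 / (2*h) - \<tau>\<^sup>2 / h)"
    unfolding diff_conv_add_uminus exp_add times_divide_eq_left times_divide_eq_right by (simp only: mult_ac)
  also have "\<dots> \<le> C * C' / sqrt (pi * h) * exp ((max 0 y + 1)\<^sup>2 / h - \<bar>\<tau>\<bar> / h)"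
    using gaussian_product_exponent[OF h, of y \<tau>] C h by (intro mult_left_mono) auto
  also have "\<dots> = C * C' / sqrt (pi * h) * exp ((max 0 y + 1)\<^sup>2 / h) * exp (- (1/h * \<bar>\<tau>\<bar>))"
    unfolding mult.assoc[of _ "exp _" "exp _"] mult_exp_exp by simp
  finally show ?thesis unfolding y_def .
qed

lemma measurable_gauss_integrand:
  assumes f: "continuous_on S f" and g: "continuous_on S g"
    and S: "\<And>x. u + complex_of_real x \<in> S"
  shows "gauss_integrand h f g u \<in> borel_measurable lborel"
proof -
  have S': "u - complex_of_real x \<in> S" "u - complex_of_real x + complex_of_real y \<in> S"
    "u - complex_of_real x - complex_of_real y \<in> S" for x y
    using S[of "-x"] S[of "y-x"] S[of "-x-y"] by (simp_all add: algebra_simps)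
  have "continuous_on UNIV (\<lambda>\<tau>. f (u - of_real (h/4) + of_real \<tau>))"
  proof (rule continuous_on_compose2[OF f])
    show "range (\<lambda>\<tau>. u - of_real (h/4) + of_real \<tau>) \<subseteq> S" by (simp only: image_subset_iff S') simp
  qed (intro continuous_intros)
  moreover have "continuous_on UNIV (\<lambda>\<tau>. g (u - of_real (h/4) - of_real \<tau>))"
  proof (rule continuous_on_compose2[OF g])
    show "range (\<lambda>\<tau>. u - of_real (h/4) - of_real \<tau>) \<subseteq> S" by (simp only: image_subset_iff S') simp
  qed (intro continuous_intros)
  moreover have "continuous_on UNIV (\<lambda>\<tau>. complex_of_real (exp (- (\<tau>\<^sup>2 / h)) / sqrt (pi * h)))"
    unfolding divide_inverse by (intro continuous_intros)
  ultimately have "continuous_on UNIV (gauss_integrand h f g u)"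
    unfolding gauss_integrand_def[abs_def] by (intro continuous_on_mult)
  from borel_measurable_continuous_onI[OF this] show ?thesis by simp
qed

lemma integrable_gauss_integrand:
  assumes h: "h > 0" and f: "q_growth h a C S f" and g: "q_growth h a C' S g"
    and cont: "continuous_on S f" "continuous_on S g"
    and S: "\<And>x. u + complex_of_real x \<in> S"
  shows "integrable lborel (gauss_integrand h f g u)"
proof (rule Bochner_Integration.integrable_bound)
  define B where "B = C * C' / sqrt (pi * h) * exp ((max 0 (Re u - h/4 + a) + 1)\<^sup>2 / h)"
  show "integrable lborel (\<lambda>\<tau>. B * exp (- (1/h * \<bar>\<tau>\<bar>)))"
    using integrable_exp_neg_abs[of "1/h"] h by simp
  have "norm (gauss_integrand h f g u \<tau>) \<le> norm (B * exp (- (1/h * \<bar>\<tau>\<bar>)))" for \<tau>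
  proof -
    have "u - of_real (h/4) + of_real \<tau> \<in> S" "u - of_real (h/4) - of_real \<tau> \<in> S"
      using S[of "\<tau>-h/4"] S[of "-\<tau>-h/4"] by (simp_all add: algebra_simps)
    from norm_gauss_integrand[OF h f g this] show ?thesis
      unfolding B_def real_norm_def by (rule order_trans[OF _ abs_ge_self])
  qed
  then show "AE \<tau> in lborel. norm (gauss_integrand h f g u \<tau>) \<le> norm (B * exp (- (1/h * \<bar>\<tau>\<bar>)))"
    by simp
  show "gauss_integrand h f g u \<in> borel_measurable lborel"
    by (rule measurable_gauss_integrand[OF cont S])
qed

lemma gauss_prod_holomorphic:
  assumes h: "h > 0" and f: "q_growth h a C (sector d \<epsilon>) f" and g: "q_growth h a C' (sector d \<epsilon>) g"
    and hol: "f holomorphic_on sector d \<epsilon>" "g holomorphic_on sector d \<epsilon>"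
  shows "gauss_prod h f g holomorphic_on sector d \<epsilon>"
proof -
  have cont: "continuous_on (sector d \<epsilon>) f" "continuous_on (sector d \<epsilon>) g"
    using hol by (simp_all add: holomorphic_on_imp_continuous_on)
  have "(\<lambda>u. LINT \<tau>|lborel. gauss_integrand h f g u \<tau>) holomorphic_on sector d \<epsilon>"
  proof (rule holomorphic_on_parameter_integral[OF open_sector])
    have "(f \<circ> (\<lambda>u. u - of_real (h/4) + of_real \<tau>)) holomorphic_on sector d \<epsilon>" for \<tau>
    proof (rule holomorphic_on_compose_gen[OF _ hol(1)])
      show "(\<lambda>u. u - of_real (h/4) + of_real \<tau>) ` sector d \<epsilon> \<subseteq> sector d \<epsilon>"
        by (simp only: image_subset_iff sector_translate) simp
    qed (intro holomorphic_intros)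
    then have f_hol: "(\<lambda>u. f (u - of_real (h/4) + of_real \<tau>)) holomorphic_on sector d \<epsilon>" for \<tau>
      unfolding o_def .
    have "(g \<circ> (\<lambda>u. u - of_real (h/4) - of_real \<tau>)) holomorphic_on sector d \<epsilon>" for \<tau>
    proof (rule holomorphic_on_compose_gen[OF _ hol(2)])
      show "(\<lambda>u. u - of_real (h/4) - of_real \<tau>) ` sector d \<epsilon> \<subseteq> sector d \<epsilon>"
        by (simp only: image_subset_iff sector_translate) simp
    qed (intro holomorphic_intros)
    then have g_hol: "(\<lambda>u. g (u - of_real (h/4) - of_real \<tau>)) holomorphic_on sector d \<epsilon>" for \<tau>
      unfolding o_def .
    show "(\<lambda>u. gauss_integrand h f g u \<tau>) holomorphic_on sector d \<epsilon>" for \<tau>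
      unfolding gauss_integrand_def by (intro holomorphic_on_mult holomorphic_on_const f_hol g_hol)
    show "gauss_integrand h f g u \<in> borel_measurable lborel" if "u \<in> sector d \<epsilon>" for u
      by (rule measurable_gauss_integrand[OF cont]) (simp only: sector_translate that)
  next
    fix z assume z: "z \<in> sector d \<epsilon>"
    then obtain r where r: "r > 0" "cball z r \<subseteq> sector d \<epsilon>"
      using open_sector open_contains_cball by blast
    define B where "B = C * C' / sqrt (pi * h) * exp ((max 0 (Re z + r - h/4 + a) + 1)\<^sup>2 / h)"
    have C: "C \<ge> 0" "C' \<ge> 0" 
      using q_growth_constant_nonneg[OF f z] q_growth_constant_nonneg[OF g z] by auto
    have "norm (gauss_integrand h f g w t) \<le> B * exp (- (1/h * \<bar>t\<bar>))" if w: "w \<in> cball z r" for w t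
    proof -
      have "Re w \<le> Re z + r"
        using w abs_Re_le_cmod[of "w - z"] by (auto simp: dist_norm norm_minus_commute)
      then have "(max 0 (Re w - h/4 + a) + 1)\<^sup>2 \<le> (max 0 (Re z + r - h/4 + a) + 1)\<^sup>2"
        by (intro power_mono) auto
      then have "exp ((max 0 (Re w - h/4 + a) + 1)\<^sup>2 / h) \<le> exp ((max 0 (Re z + r - h/4 + a) + 1)\<^sup>2 / h)"
        using h by (simp add: divide_right_mono)
      then have "C * C' / sqrt (pi * h) * exp ((max 0 (Re w - h/4 + a) + 1)\<^sup>2 / h) \<le> B"
        unfolding B_def using C h by (intro mult_left_mono) auto
      then have "C * C' / sqrt (pi * h) * exp ((max 0 (Re w - h/4 + a) + 1)\<^sup>2 / h) * exp (- (1/h * \<bar>t\<bar>))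
          \<le> B * exp (- (1/h * \<bar>t\<bar>))"
        by (intro mult_right_mono) auto
      moreover have "w \<in> sector d \<epsilon>" using w r(2) by blast
      ultimately show ?thesis
        using norm_gauss_integrand[OF h f g, of w t] unfolding sector_translate
        by (blast intro: order_trans)
    qed
    moreover have "integrable lborel (\<lambda>t. B * exp (- (1/h * \<bar>t\<bar>)))"
      using integrable_exp_neg_abs[of "1/h"] h by simp
    ultimately show "\<exists>r>0. \<exists>G. cball z r \<subseteq> sector d \<epsilon> \<and> integrable lborel G \<and>
        (\<forall>w\<in>cball z r. \<forall>t. norm (gauss_integrand h f g w t) \<le> G t)"
      using r by blast
  qed
  then show ?thesis unfolding gauss_prod_def .
qed

lemma gauss_prod_growth:
  assumes h: "h > 0" and f: "q_growth h a C (sector d \<epsilon>) f" and g: "q_growth h a C' (sector d \<epsilon>) g"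
    and hol: "f holomorphic_on sector d \<epsilon>" "g holomorphic_on sector d \<epsilon>"
  shows "\<exists>K. q_growth (h/2) (a + 1 - h/4) K (sector d \<epsilon>) (gauss_prod h f g)"
proof -
  have cont: "continuous_on (sector d \<epsilon>) f" "continuous_on (sector d \<epsilon>) g"
    using hol by (simp_all add: holomorphic_on_imp_continuous_on)
  define J where "J = (LINT t|lborel. exp (- (1/h * \<bar>t\<bar>)))"
  have J: "J \<ge> 0" unfolding J_def by (rule integral_nonneg_AE) simp
  define K where "K = C * C' / sqrt (pi * h) * exp (1 / h) * J"
  have "norm (gauss_prod h f g u) \<le> K * exp ((max 0 (Re u + (a + 1 - h/4)))\<^sup>2 / (2 * (h/2)))"
    if u: "u \<in> sector d \<epsilon>" for u
  proof -
    define y where "y = Re u - h/4 + a"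
    have C: "C \<ge> 0" "C' \<ge> 0"
      using q_growth_constant_nonneg[OF f u] q_growth_constant_nonneg[OF g u] by auto
    have int: "integrable lborel (\<lambda>t. C * C' / sqrt (pi * h) * exp ((max 0 y + 1)\<^sup>2 / h) * exp (- (1/h * \<bar>t\<bar>)))"
      using integrable_exp_neg_abs[of "1/h"] h by simp
    have "norm (gauss_prod h f g u) \<le>
        (LINT t|lborel. C * C' / sqrt (pi * h) * exp ((max 0 y + 1)\<^sup>2 / h) * exp (- (1/h * \<bar>t\<bar>)))"
      unfolding gauss_prod_def y_def
    proof (rule Bochner_Integration.integral_norm_bound_integral[OF _ int[unfolded y_def]])
      show "integrable lborel (gauss_integrand h f g u)"
        by (rule integrable_gauss_integrand[OF h f g cont]) (simp only: sector_translate u)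
      show "norm (gauss_integrand h f g u t) \<le> C * C' / sqrt (pi * h) *
          exp ((max 0 (Re u - h/4 + a) + 1)\<^sup>2 / h) * exp (- (1/h * \<bar>t\<bar>))" for t
        by (rule norm_gauss_integrand[OF h f g]) (simp_all only: sector_translate u)
    qed
    also have "\<dots> = C * C' / sqrt (pi * h) * exp ((max 0 y + 1)\<^sup>2 / h) * J"
      unfolding J_def by simp
    also have "\<dots> \<le> C * C' / sqrt (pi * h) * exp (1/h + (max 0 (y + 1))\<^sup>2 / h) * J"
    proof -
      have "(max 0 y + 1)\<^sup>2 \<le> 1 + (max 0 (y + 1))\<^sup>2" by (cases "y \<ge> 0") auto
      then have "(max 0 y + 1)\<^sup>2 / h \<le> 1/h + (max 0 (y + 1))\<^sup>2 / h"
        using h by (simp add: divide_right_mono flip: add_divide_distrib)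
      then show ?thesis using C h J by (intro mult_right_mono mult_left_mono) auto
    qed
    also have "\<dots> = K * exp ((max 0 (Re u + (a + 1 - h/4)))\<^sup>2 / (2 * (h/2)))"
    proof -
      have y1: "Re u + (a + 1 - h/4) = y + 1" unfolding y_def by simp
      show ?thesis unfolding K_def exp_add y1 by simp
    qed
    finally show ?thesis .
  qed
  then show ?thesis unfolding q_growth_def by blast
qed

text \<open>
Fubini's theorem and the linear change of variables from \<open>(s, t)\<close> to the mean \<open>v - c\<close> and half the
difference \<open>\<tau>\<close>, whose Jacobian is \<open>2\<close>.
\<close>

lemma integral_product_rotated:
  fixes F G :: "real \<Rightarrow> complex" and c :: real
  assumes F: "integrable lborel F" and G: "integrable lborel G"
  shows "(LINT s|lborel. F s) * (LINT t|lborel. G t) =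
    (LINT v|lborel. LINT \<tau>|lborel. 2 * (F (v - c + \<tau>) * G (v - c - \<tau>)))"
proof -
  have [measurable]: "F \<in> borel_measurable borel" "G \<in> borel_measurable borel"
    using F G by (auto dest: borel_measurable_integrable)
  have inner: "integrable lborel (\<lambda>v. G (2 * v - 2 * c - s))" for s
    using lborel_integrable_real_affine[OF G, of 2 "- 2 * c - s"] by (simp add: algebra_simps)
  have inner_value: "(LINT v|lborel. H (2 * v - 2 * c - s)) = (1/2) *\<^sub>R (LINT t|lborel. H t)"
    for s and H :: "real \<Rightarrow> 'b :: {banach, second_countable_topology}"
    using lborel_integral_real_affine[of 2 H "- 2 * c - s"] by (simp add: algebra_simps)
  have int: "integrable (lborel \<Otimes>\<^sub>M lborel) (\<lambda>(s, v). F s * G (2 * v - 2 * c - s))"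
  proof (rule lborel_pair.Fubini_integrable)
    show "(\<lambda>(s, v). F s * G (2 * v - 2 * c - s)) \<in> borel_measurable (lborel \<Otimes>\<^sub>M lborel)"
      by measurable
    have "(LINT v|lborel. norm (case (s, v) of (s, v) \<Rightarrow> F s * G (2 * v - 2 * c - s))) =
        norm (F s) * ((1/2) * (LINT t|lborel. norm (G t)))" for s
      using inner_value[of "\<lambda>t. norm (G t)" s] by (simp add: norm_mult)
    then show "integrable lborel (\<lambda>s. LINT v|lborel. norm (case (s, v) of (s, v) \<Rightarrow> F s * G (2 * v - 2 * c - s)))"
      using F by (simp only:) simp
    show "AE s in lborel. integrable lborel (\<lambda>v. case (s, v) of (s, v) \<Rightarrow> F s * G (2 * v - 2 * c - s))"
      using inner by simp
  qed
  have "(LINT v|lborel. LINT \<tau>|lborel. 2 * (F (v - c + \<tau>) * G (v - c - \<tau>))) =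
      2 * (LINT v|lborel. LINT s|lborel. F s * G (2 * v - 2 * c - s))"
  proof -
    have "(LINT \<tau>|lborel. F (v - c + \<tau>) * G (v - c - \<tau>)) = (LINT s|lborel. F s * G (2 * v - 2 * c - s))" for v
      using lborel_integral_real_affine[of 1 "\<lambda>s. F s * G (2 * v - 2 * c - s)" "v - c"]
      by (simp add: algebra_simps)
    then show ?thesis by simp
  qed
  also have "(LINT v|lborel. LINT s|lborel. F s * G (2 * v - 2 * c - s)) =
      (LINT s|lborel. LINT v|lborel. F s * G (2 * v - 2 * c - s))"
    by (rule lborel_pair.Fubini_integral[OF int])
  also have "\<dots> = (LINT s|lborel. F s * ((1/2) *\<^sub>R (LINT t|lborel. G t)))"
    by (simp add: inner_value)
  finally show ?thesis by (simp add: scaleR_conv_of_real)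
qed

text \<open>
The parallelogram law \<open>(Z + \<tau>)\<^sup>2 + (Z - \<tau>)\<^sup>2 = 2 Z\<^sup>2 + 2 \<tau>\<^sup>2\<close> in the exponents. The shift by
\<open>ln q / 4\<close> accounts for the different constants \<open>ln q / 2\<close> and \<open>ln q / 4\<close> in the kernels of level 1
and 2.
\<close>

lemma qLaplace_kernel_product:
  fixes \<tau> :: real
  assumes q: "q > 1"
  shows "2 / (e_fun q (V - of_real (ln q / 4) + of_real \<tau> - w) * e_fun q (V - of_real (ln q / 4) - of_real \<tau> - w))
     = of_real (exp (- (\<tau>\<^sup>2 / ln q)) / sqrt (pi * ln q)) / e_fun (sqrt q) (V - w)"
proof -
  define h where "h = ln q"
  have h: "h > 0" unfolding h_def using q by simp
  define Z where "Z = V - w + of_real (h/4)"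
  have e1: "e_fun q (V - of_real (h/4) + of_real x - w) = of_real (sqrt (2 * pi * h)) * exp ((Z + of_real x)\<^sup>2 / (2 * of_real h))" for x
  proof -
    have "of_real (h/2) + (V - of_real (h/4) + of_real x - w) = Z + of_real x"
      unfolding Z_def by (simp add: complex_eq_iff)
    then show ?thesis unfolding e_fun_eq[OF q] h_def[symmetric] by (simp only:)
  qed
  have "V - of_real (h/4) - of_real \<tau> = V - of_real (h/4) + of_real (- \<tau>)" by simp
  then have e2: "e_fun q (V - of_real (h/4) - of_real \<tau> - w) = of_real (sqrt (2 * pi * h)) * exp ((Z - of_real \<tau>)\<^sup>2 / (2 * of_real h))"
    using e1[of "- \<tau>"] by simp
  have e3: "e_fun (sqrt q) (V - w) = of_real (sqrt (pi * h)) * exp (Z\<^sup>2 / of_real h)"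
    using q unfolding Z_def h_def by (simp add: e_fun_eq ln_sqrt add.commute)
  have sq: "complex_of_real (sqrt (2 * pi * h)) * of_real (sqrt (2 * pi * h)) = 2 * of_real (sqrt (pi * h)) * of_real (sqrt (pi * h))"
  proof -
    have "sqrt (2 * pi * h) * sqrt (2 * pi * h) = 2 * (sqrt (pi * h) * sqrt (pi * h))" using h by simp
    from arg_cong[OF this, of complex_of_real] show ?thesis
      by (simp only: of_real_mult of_real_numeral mult.assoc)
  qed
  have "(Z + of_real \<tau>)\<^sup>2 / (2 * of_real h) + (Z - of_real \<tau>)\<^sup>2 / (2 * of_real h) = Z\<^sup>2 / of_real h + of_real (\<tau>\<^sup>2 / h)"
    by (simp add: power2_sum power2_diff add_divide_distrib diff_divide_distrib)
  then have "exp ((Z + of_real \<tau>)\<^sup>2 / (2 * of_real h)) * exp ((Z - of_real \<tau>)\<^sup>2 / (2 * of_real h))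
      = exp (Z\<^sup>2 / of_real h) * of_real (exp (\<tau>\<^sup>2 / h))"
    unfolding mult_exp_exp by (simp only: exp_add exp_of_real)
  then have "e_fun q (V - of_real (h/4) + of_real \<tau> - w) * e_fun q (V - of_real (h/4) - of_real \<tau> - w)
      = 2 * of_real (sqrt (pi * h)) * of_real (sqrt (pi * h)) * (exp (Z\<^sup>2 / of_real h) * of_real (exp (\<tau>\<^sup>2 / h)))"
    unfolding e1 e2 sq[symmetric] by (simp only: mult_ac)
  moreover have "complex_of_real (exp (- (\<tau>\<^sup>2 / h)) / sqrt (pi * h)) = 1 / of_real (exp (\<tau>\<^sup>2 / h)) / of_real (sqrt (pi * h))"
    by (simp add: exp_minus divide_inverse)
  moreover have "2 / (2 * s * s * (E * T)) = 1 / T / s / (s * E)" for s E T :: complex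
    by (simp add: mult.commute mult.left_commute)
  ultimately show ?thesis
    unfolding h_def[symmetric] e3 by simp
qed

lemma qLaplace_gauss_prod:
  assumes q: "q > 1"
    and f: "q_growth (ln q) a C {w. Im w = d} f" and g: "q_growth (ln q) a C' {w. Im w = d} g"
    and cont: "continuous_on {w. Im w = d} f" "continuous_on {w. Im w = d} g"
    and w: "Re w < ln q / 2 - a"
  shows "qLaplace (sqrt q) d (gauss_prod (ln q) f g) w = qLaplace q d f w * qLaplace q d g w"
proof -
  define h where "h = ln q"
  define F where "F s = f (Complex s d) / e_fun q (Complex s d - w)" for s
  define G where "G s = g (Complex s d) / e_fun q (Complex s d - w)" for s
  have "integrable lborel F" "integrable lborel G"
    unfolding F_def G_def by (rule qLaplace_integrable[OF q _ _ w], fact+)+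
  then have "qLaplace q d f w * qLaplace q d g w =
      (LINT v|lborel. LINT \<tau>|lborel. 2 * (F (v - h/4 + \<tau>) * G (v - h/4 - \<tau>)))"
    unfolding qLaplace_def F_def[symmetric] G_def[symmetric] by (rule integral_product_rotated)
  also have "(\<lambda>v \<tau>. 2 * (F (v - h/4 + \<tau>) * G (v - h/4 - \<tau>))) =
      (\<lambda>v \<tau>. gauss_integrand h f g (Complex v d) \<tau> / e_fun (sqrt q) (Complex v d - w))"
  proof (intro ext)
    fix v \<tau> :: real
    have pts: "Complex (v - h/4 + \<tau>) d = Complex v d - of_real (h/4) + of_real \<tau>"
      "Complex (v - h/4 - \<tau>) d = Complex v d - of_real (h/4) - of_real \<tau>"
      by (simp_all add: complex_eq_iff)
    show "2 * (F (v - h/4 + \<tau>) * G (v - h/4 - \<tau>)) =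
        gauss_integrand h f g (Complex v d) \<tau> / e_fun (sqrt q) (Complex v d - w)"
    proof -
      have eq: "2 * ((x / e1) * (y / e2)) = x * y * X / Y" if "2 / (e1 * e2) = X / Y" for x y e1 e2 X Y :: complex
      proof -
        have "2 * ((x / e1) * (y / e2)) = x * y * (2 / (e1 * e2))" by simp
        also have "\<dots> = x * y * X / Y" unfolding that by simp
        finally show ?thesis .
      qed
      show ?thesis
        unfolding F_def G_def pts gauss_integrand_def
        by (rule eq) (rule qLaplace_kernel_product[OF q, folded h_def])
    qed
  qed
  finally show ?thesis unfolding qLaplace_def gauss_prod_def h_def by simp
qed

section \<open>The Borel transform of a product\<close>

text \<open>
The coefficients of the Cauchy product, deformed by \<open>q\<^bsup>-k(n-k)\<^esup>\<close> where \<open>h = ln q\<close>.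
\<close>

definition q_star :: "real \<Rightarrow> complex fps \<Rightarrow> complex fps \<Rightarrow> complex fps" where
  "q_star h A B = Abs_fps (\<lambda>n. \<Sum>k\<le>n. fps_nth A k * fps_nth B (n - k) * of_real (exp (- (h * real k * real (n - k)))))"

lemma triangular_add:
  fixes k m :: nat
  shows "(k + m) * (k + m - 1) div 2 = k * (k - 1) div 2 + m * (m - 1) div 2 + k * m"
proof -
  have even_prod: "2 * (n * (n - 1) div 2) = n * (n - 1)" for n :: nat
    by (cases n) auto
  have "2 * ((k + m) * (k + m - 1) div 2) = 2 * (k * (k - 1) div 2 + m * (m - 1) div 2 + k * m)"
    unfolding distrib_left even_prod by (cases k; cases m) (auto simp: algebra_simps)
  then show ?thesis by simp
qed

text \<open>
With \<open>t(n) = n(n-1)/2\<close> one has \<open>t(k + m) = t(k) + t(m) + km\<close>.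
\<close>

lemma qBorel_mult:
  assumes q: "q > 1"
  shows "qBorel q (f1 * f2) = q_star (ln q) (qBorel q f1) (qBorel q f2)"
proof (rule fps_ext)
  fix n
  have "fps_nth (qBorel q (f1 * f2)) n =
      (\<Sum>k\<le>n. fps_nth f1 k * fps_nth f2 (n - k) / of_real q ^ (n * (n - 1) div 2))"
    by (simp add: qBorel_def fps_mult_nth sum_divide_distrib atLeast0AtMost)
  also have "\<dots> = fps_nth (q_star (ln q) (qBorel q f1) (qBorel q f2)) n"
    unfolding q_star_def fps_nth_Abs_fps
  proof (intro sum.cong refl)
    fix k assume "k \<in> {..n}"
    then have n: "n = k + (n - k)" by simp
    have "exp (ln q * real (k * (n - k))) = q ^ (k * (n - k))"
      using q by (simp only: exp_of_nat2_mult) simp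
    moreover have "- (ln q * real k * real (n - k)) = - (ln q * real (k * (n - k)))" by simp
    ultimately have "exp (- (ln q * real k * real (n - k))) = inverse (q ^ (k * (n - k)))"
      by (simp only: exp_minus)
    then have e: "complex_of_real (exp (- (ln q * real k * real (n - k)))) = inverse (of_real q ^ (k * (n - k)))"
      by simp
    show "fps_nth f1 k * fps_nth f2 (n - k) / of_real q ^ (n * (n - 1) div 2) =
        fps_nth (qBorel q f1) k * fps_nth (qBorel q f2) (n - k) * complex_of_real (exp (- (ln q * real k * real (n - k))))"
      unfolding e qBorel_def fps_nth_Abs_fps
      using triangular_add[of k "n - k", folded n] by (simp add: power_add field_simps)
  qed
  finally show "fps_nth (qBorel q (f1 * f2)) n = fps_nth (q_star (ln q) (qBorel q f1) (qBorel q f2)) n" .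
qed

lemma q_star_commute: "q_star h A B = q_star h B A"
proof (rule fps_ext)
  fix n
  show "fps_nth (q_star h A B) n = fps_nth (q_star h B A) n"
    unfolding q_star_def fps_nth_Abs_fps
    by (rule sum.reindex_bij_witness[of _ "\<lambda>k. n - k" "\<lambda>k. n - k"]) (auto simp: mult_ac)
qed

lemma q_star_add_left: "q_star h (A + A') B = q_star h A B + q_star h A' B"
  by (rule fps_ext) (simp add: q_star_def algebra_simps sum.distrib)

lemma q_star_add_right: "q_star h A (B + B') = q_star h A B + q_star h A B'"
  by (rule fps_ext) (simp add: q_star_def algebra_simps sum.distrib)

lemma fps_conv_radius_ge_coefficient_bound:
  fixes g :: "complex fps"
  assumes "\<And>n. norm (fps_nth g n) \<le> M * exp (b * real n)"
  shows "fps_conv_radius g \<ge> ereal (exp (- b - 1))"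
proof -
  have "summable (\<lambda>n. fps_nth g n * exp (complex_of_real (- b - 1)) ^ n)"
    by (rule summable_norm_cancel, rule norm_eval_fps_exp_le(1)[OF assms]) simp
  from conv_radius_geI[OF this] show ?thesis
    unfolding fps_conv_radius_def norm_exp_eq_Re by simp
qed

lemma eval_fps_exp_holomorphic:
  fixes g :: "complex fps"
  assumes "\<And>n. norm (fps_nth g n) \<le> M * exp (b * real n)"
  shows "(\<lambda>w. eval_fps g (exp w)) holomorphic_on {w. Re w < - b - 1}"
proof -
  have "(eval_fps g \<circ> exp) holomorphic_on {w. Re w < - b - 1}"
  proof (rule holomorphic_on_compose_gen[where t = "eball 0 (fps_conv_radius g)"])
    show "exp ` {w. Re w < - b - 1} \<subseteq> eball 0 (fps_conv_radius g)"
    proof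
      fix z assume "z \<in> exp ` {w. Re w < - b - 1}"
      then have "ereal (norm z) < ereal (exp (- b - 1))" by auto
      then show "z \<in> eball 0 (fps_conv_radius g)"
        using fps_conv_radius_ge_coefficient_bound[of g M b, OF assms]
        unfolding in_eball_iff dist_0_norm by (rule less_le_trans)
    qed
  qed (intro holomorphic_intros order_refl)+
  then show ?thesis by (simp add: o_def)
qed

text \<open>
A zero of order \<open>K\<close> at the origin can be divided out before the geometric estimate is applied.
\<close>

lemma norm_eval_fps_exp_le_vanishing:
  fixes g :: "complex fps"
  assumes g: "\<And>n. norm (fps_nth g n) \<le> M * exp (b * real n)" and zero: "\<And>n. n < K \<Longrightarrow> fps_nth g n = 0"
    and r: "Re w \<le> - b - 1"
  shows "norm (eval_fps g (exp w)) \<le> 2 * M * exp (real K * (b + Re w))"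
proof -
  have "(\<lambda>n. fps_nth g n * exp w ^ n) sums eval_fps g (exp w)"
    unfolding eval_fps_def
    by (rule summable_sums, rule summable_norm_cancel, rule norm_eval_fps_exp_le(1)[OF g r])
  then have "(\<lambda>n. fps_nth g (n + K) * exp w ^ (n + K)) sums eval_fps g (exp w)"
    by (subst sums_iff_shift) (simp add: zero)
  then have "(\<lambda>n. exp w ^ K * (fps_nth (fps_shift K g) n * exp w ^ n)) sums eval_fps g (exp w)"
    by (simp add: power_add mult_ac)
  moreover have bound: "norm (fps_nth (fps_shift K g) n) \<le> (M * exp (b * real K)) * exp (b * real n)" for n
    using g[of "n + K"] unfolding fps_shift_nth mult.assoc[of M] mult_exp_exp by (simp add: algebra_simps)
  have "(\<lambda>n. exp w ^ K * (fps_nth (fps_shift K g) n * exp w ^ n)) sums (exp w ^ K * eval_fps (fps_shift K g) (exp w))"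
    unfolding eval_fps_def
    by (intro sums_mult summable_sums summable_norm_cancel[OF norm_eval_fps_exp_le(1)[OF bound r]])
  ultimately have "eval_fps g (exp w) = exp w ^ K * eval_fps (fps_shift K g) (exp w)"
    by (rule sums_unique2)
  then have "norm (eval_fps g (exp w)) = exp (real K * Re w) * norm (eval_fps (fps_shift K g) (exp w))"
    by (simp add: norm_mult norm_power exp_of_nat_mult)
  also have "\<dots> \<le> exp (real K * Re w) * (2 * (M * exp (b * real K)))"
    by (intro mult_left_mono norm_eval_fps_exp_le(2)[OF bound r]) simp
  also have "\<dots> = 2 * M * exp (real K * (b + Re w))"
    by (simp add: algebra_simps exp_add)
  finally show ?thesis .
qed

text \<open>
If \<open>k \<ge> N\<close> and \<open>n - k \<ge> N\<close> then \<open>k (n - k) - N (n - N) = (k - N) (n - k - N)\<close> is nonnegative. Hence two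
factors vanishing to order \<open>N\<close> enlarge the radius of convergence of the deformed product by
\<open>exp (h N)\<close>. The number \<open>n + 1\<close> of summands is absorbed by replacing \<open>a\<close> by \<open>a + 1\<close>.
\<close>

lemma norm_q_star_nth_le:
  fixes A B :: "complex fps"
  assumes h: "h \<ge> 0" and A: "\<And>n. norm (fps_nth A n) \<le> C * exp (a * real n)"
    and B: "\<And>n. norm (fps_nth B n) \<le> C' * exp (a * real n)"
    and zero: "\<And>n. n < N \<Longrightarrow> fps_nth A n = 0" "\<And>n. n < N \<Longrightarrow> fps_nth B n = 0"
  shows "norm (fps_nth (q_star h A B) n) \<le> C * C' * exp (h * (real N)\<^sup>2) * exp ((a + 1 - h * real N) * real n)"
    and "n < 2 * N \<Longrightarrow> fps_nth (q_star h A B) n = 0"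
proof -
  have C: "C \<ge> 0" "C' \<ge> 0"
    using order_trans[OF norm_ge_zero A[of 0]] order_trans[OF norm_ge_zero B[of 0]] by simp_all
  have term_le: "norm (fps_nth A k * fps_nth B (n - k) * of_real (exp (- (h * real k * real (n - k)))))
      \<le> C * C' * exp (a * real n - h * (real N * (real n - real N)))" if k: "k \<le> n" for k
  proof (cases "k < N \<or> n - k < N")
    case True
    then show ?thesis using zero C by auto
  next
    case False
    have n: "real n = real k + real (n - k)" using k by simp
    have "0 \<le> h * ((real k - real N) * (real (n - k) - real N))" using False h by simp
    also have "\<dots> = h * real k * real (n - k) - h * (real N * (real n - real N))"
      unfolding n by (simp add: algebra_simps)
    finally have le: "- (h * real k * real (n - k)) \<le> - (h * (real N * (real n - real N)))" by simp
    have "norm (fps_nth A k * fps_nth B (n - k) * of_real (exp (- (h * real k * real (n - k))))) =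
        norm (fps_nth A k) * norm (fps_nth B (n - k)) * exp (- (h * real k * real (n - k)))"
      by (simp add: norm_mult)
    also have "\<dots> \<le> (C * exp (a * real k)) * (C' * exp (a * real (n - k))) * exp (- (h * (real N * (real n - real N))))"
      using A B C le by (intro mult_mono) auto
    also have "\<dots> = C * C' * exp (a * real n - h * (real N * (real n - real N)))"
      unfolding n diff_conv_add_uminus distrib_left exp_add by (simp add: mult_ac)
    finally show ?thesis .
  qed
  have "norm (fps_nth (q_star h A B) n) \<le> (\<Sum>k\<le>n. C * C' * exp (a * real n - h * (real N * (real n - real N))))"
    unfolding q_star_def fps_nth_Abs_fps by (rule sum_norm_le) (use term_le in auto)
  also have "\<dots> = C * C' * ((1 + real n) * exp (a * real n - h * (real N * (real n - real N))))"
    by (simp add: algebra_simps)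
  also have "\<dots> \<le> C * C' * (exp (real n) * exp (a * real n - h * (real N * (real n - real N))))"
    using C by (intro mult_left_mono mult_right_mono) (auto simp: exp_ge_add_one_self)
  also have "exp (real n) * exp (a * real n - h * (real N * (real n - real N))) =
      exp (h * (real N)\<^sup>2) * exp ((a + 1 - h * real N) * real n)"
    unfolding mult_exp_exp by (simp add: algebra_simps power2_eq_square)
  finally show "norm (fps_nth (q_star h A B) n) \<le> C * C' * exp (h * (real N)\<^sup>2) * exp ((a + 1 - h * real N) * real n)"
    by (simp only: mult.assoc)
  show "fps_nth (q_star h A B) n = 0" if "n < 2 * N"
    unfolding q_star_def fps_nth_Abs_fps
  proof (intro sum.neutral ballI)
    fix k assume "k \<in> {..n}"
    then have "k < N \<or> n - k < N" using that by auto
    then show "fps_nth A k * fps_nth B (n - k) * of_real (exp (- (h * real k * real (n - k)))) = 0"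
      using zero by auto
  qed
qed

text \<open>
The part \<open>k < N\<close> of the series \<open>\<Sum> A\<^sub>k \<xi>\<^sup>k g(q\<^bsup>-k\<^esup> \<xi>)\<close>, with \<open>\<xi> = exp w\<close>. In the logarithmic coordinate the
dilation by \<open>q\<^bsup>-k\<^esup>\<close> is the translation by \<open>- h k\<close>.
\<close>

definition taylor_shift_sum :: "real \<Rightarrow> nat \<Rightarrow> complex fps \<Rightarrow> (complex \<Rightarrow> complex) \<Rightarrow> complex \<Rightarrow> complex" where
  "taylor_shift_sum h N A g w = (\<Sum>k<N. fps_nth A k * exp (of_nat k * w) * g (w - of_real (h * real k)))"

definition taylor_poly :: "nat \<Rightarrow> complex fps \<Rightarrow> complex \<Rightarrow> complex" where
  "taylor_poly N A w = (\<Sum>k<N. fps_nth A k * exp (of_nat k * w))"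

text \<open>
The contribution of a fixed \<open>k\<close> is \<open>\<Sum>\<^sub>m A\<^sub>k B\<^sub>m q\<^bsup>-km\<^esup> \<xi>\<^bsup>k+m\<^esup>\<close>, the value of the series \<open>B\<close> at
\<open>q\<^bsup>-k\<^esup> \<xi>\<close> multiplied by \<open>A\<^sub>k \<xi>\<^sup>k\<close>.
\<close>

lemma q_star_cutoff_sums:
  assumes B: "\<And>n. norm (fps_nth B n) \<le> C * exp (a * real n)" and w: "Re w \<le> - a - 1" and h: "h \<ge> 0"
  shows "(\<lambda>n. fps_nth (q_star h (fps_cutoff N A) B) n * exp w ^ n) sums
     taylor_shift_sum h N A (\<lambda>w. eval_fps B (exp w)) w"
proof -
  define T where "T k n = (if k \<le> n then fps_nth A k * fps_nth B (n - k) *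
      of_real (exp (- (h * real k * real (n - k)))) * exp w ^ n else 0)" for k n
  have "T k sums (fps_nth A k * exp (of_nat k * w) * eval_fps B (exp (w - of_real (h * real k))))" for k
  proof -
    have "(\<lambda>m. fps_nth B m * exp (w - of_real (h * real k)) ^ m) sums eval_fps B (exp (w - of_real (h * real k)))"
      unfolding eval_fps_def
      by (rule summable_sums, rule summable_norm_cancel, rule norm_eval_fps_exp_le(1)[OF B])
        (use w mult_nonneg_nonneg[OF h of_nat_0_le_iff[of k]] in simp)
    from sums_mult[OF this, of "fps_nth A k * exp (of_nat k * w)"]
    have "(\<lambda>m. T k (m + k)) sums (fps_nth A k * exp (of_nat k * w) * eval_fps B (exp (w - of_real (h * real k))))"
    proof (rule sums_cong[THEN iffD1, rotated])
      fix m
      have "exp (w - of_real (h * real k)) ^ m = exp w ^ m * of_real (exp (- (h * real k * real m)))"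
        by (simp add: exp_of_nat_mult[symmetric] exp_of_real[symmetric] mult_exp_exp algebra_simps)
      then show "fps_nth A k * exp (of_nat k * w) * (fps_nth B m * exp (w - of_real (h * real k)) ^ m) = T k (m + k)"
        unfolding T_def exp_of_nat_mult by (simp add: power_add mult_ac)
    qed
    then show ?thesis unfolding sums_iff_shift by (simp add: T_def)
  qed
  then have "(\<lambda>n. \<Sum>k<N. T k n) sums taylor_shift_sum h N A (\<lambda>w. eval_fps B (exp w)) w"
    unfolding taylor_shift_sum_def by (intro sums_sum)
  moreover have "(\<Sum>k<N. T k n) = fps_nth (q_star h (fps_cutoff N A) B) n * exp w ^ n" for n
  proof -
    have "(\<Sum>k<N. T k n) = (\<Sum>k\<in>{..<N} \<inter> {..n}. fps_nth A k * fps_nth B (n - k) *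
        of_real (exp (- (h * real k * real (n - k)))) * exp w ^ n)"
      unfolding T_def by (subst sum.inter_restrict) (auto intro!: sum.cong)
    also have "\<dots> = (\<Sum>k\<in>{..n} \<inter> {..<N}. fps_nth A k * fps_nth B (n - k) *
        of_real (exp (- (h * real k * real (n - k)))) * exp w ^ n)"
      by (simp only: Int_commute)
    also have "\<dots> = (\<Sum>k\<le>n. fps_nth (fps_cutoff N A) k * fps_nth B (n - k) *
        of_real (exp (- (h * real k * real (n - k)))) * exp w ^ n)"
      by (subst sum.inter_restrict) (auto intro!: sum.cong)
    also have "\<dots> = fps_nth (q_star h (fps_cutoff N A) B) n * exp w ^ n"
      by (simp add: q_star_def sum_distrib_right)
    finally show ?thesis .
  qed
  ultimately show ?thesis by simp
qed

section \<open>Continuation of the Borel transform of a product\<close>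

lemma eval_fps_cutoff_exp: "eval_fps (fps_cutoff N A) (exp w) = taylor_poly N A w"
proof -
  have "(\<lambda>n. fps_nth (fps_cutoff N A) n * exp w ^ n) sums (\<Sum>n<N. fps_nth (fps_cutoff N A) n * exp w ^ n)"
    by (rule sums_finite) auto
  then show ?thesis
    unfolding eval_fps_def taylor_poly_def by (simp add: sums_iff exp_of_nat_mult)
qed

text \<open>
The condition on \<open>N\<close> makes it at most linear in \<open>y\<close>, and a polynomial factor in \<open>y\<close> is absorbed by
replacing \<open>y\<close> by \<open>y + 1\<close> in the Gaussian.
\<close>

lemma quadratic_index_bound:
  fixes h y :: real
  assumes h: "h > 0" and N: "\<And>k. k < N \<Longrightarrow> h * real k \<le> y"
  shows "((real N)\<^sup>2 + 2 * real N + 2) * exp ((max 0 y)\<^sup>2 / h) \<le> 9 * exp ((max 0 (y + 1))\<^sup>2 / h)"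
proof -
  define P where "P = max 0 y"
  have P: "P \<ge> 0" unfolding P_def by simp
  have "h * (real N - 1) \<le> P"
  proof (cases N)
    case (Suc n)
    then show ?thesis using N[of n] unfolding P_def by simp
  qed (use h P in simp)
  then have "real N \<le> 1 + P / h" using h by (simp add: field_simps)
  moreover have "real N + 2 \<le> 3 * (1 + X)" if "real N \<le> 1 + X" "0 \<le> X" for X
    using that by simp
  ultimately have "real N + 2 \<le> 3 * (1 + P / h)"
    using divide_nonneg_pos[OF P h] by blast
  also have "\<dots> \<le> 3 * exp (P / h)"
    by (intro mult_left_mono exp_ge_add_one_self) simp
  finally have "(real N + 2)\<^sup>2 \<le> (3 * exp (P / h))\<^sup>2" by (intro power_mono) auto
  moreover have "(3 * exp (P / h))\<^sup>2 = 9 * exp (2 * P / h)"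
    by (simp add: power_mult_distrib exp_double[symmetric])
  moreover have "(real N)\<^sup>2 + 2 * real N + 2 \<le> (real N + 2)\<^sup>2"
    by (simp add: power2_sum)
  ultimately have "(real N)\<^sup>2 + 2 * real N + 2 \<le> 9 * exp (2 * P / h)"
    by linarith
  then have "((real N)\<^sup>2 + 2 * real N + 2) * exp (P\<^sup>2 / h) \<le> 9 * exp (2 * P / h) * exp (P\<^sup>2 / h)"
    by (intro mult_right_mono) auto
  also have "\<dots> = 9 * exp ((2 * P + P\<^sup>2) / h)" by (simp add: mult_exp_exp add_divide_distrib)
  also have "2 * P + P\<^sup>2 \<le> (max 0 (y + 1))\<^sup>2"
  proof (cases "y \<ge> 0")
    case True
    then show ?thesis unfolding P_def by (simp add: power2_eq_square algebra_simps)
  qed (simp add: P_def)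
  then have "9 * exp ((2 * P + P\<^sup>2) / h) \<le> 9 * exp ((max 0 (y + 1))\<^sup>2 / h)"
    using h by (simp add: divide_right_mono)
  finally show ?thesis unfolding P_def .
qed

text \<open>
Two germs \<open>A\<close>, \<open>B\<close> with continuations \<open>f\<close>, \<open>g\<close> of level 1, described by common constants.
\<close>

locale level1_pair =
  fixes h d \<epsilon> a C :: real and A B :: "complex fps" and f g :: "complex \<Rightarrow> complex"
  assumes h: "h > 0" and \<epsilon>: "\<epsilon> > 0"
    and f_hol: "f holomorphic_on sector d \<epsilon>" and g_hol: "g holomorphic_on sector d \<epsilon>"
    and f_growth: "q_growth h a C (sector d \<epsilon>) f" and g_growth: "q_growth h a C (sector d \<epsilon>) g"
    and A_le: "\<And>n. norm (fps_nth A n) \<le> C * exp (a * real n)"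
    and B_le: "\<And>n. norm (fps_nth B n) \<le> C * exp (a * real n)"
    and f_germ: "\<And>w. w \<in> sector d \<epsilon> \<Longrightarrow> Re w < - a \<Longrightarrow> f w = eval_fps A (exp w)"
    and g_germ: "\<And>w. w \<in> sector d \<epsilon> \<Longrightarrow> Re w < - a \<Longrightarrow> g w = eval_fps B (exp w)"
begin

lemma C: "C \<ge> 0"
  using q_growth_constant_nonneg[OF f_growth ray_in_sector[OF \<epsilon>]] .

text \<open>
Up to \<open>N\<close> the double series is summed over lines with the help of \<open>g\<close> and of \<open>f\<close>; the last term
removes the square \<open>k, m < N\<close>, which the first two both count.
\<close>

definition star_head :: "nat \<Rightarrow> complex \<Rightarrow> complex" where
  "star_head N w = taylor_shift_sum h N A g w + taylor_shift_sum h N B f w - taylor_shift_sum h N A (taylor_poly N B) w"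

definition star_tail :: "nat \<Rightarrow> complex \<Rightarrow> complex" where
  "star_tail N w = eval_fps (q_star h (A - fps_cutoff N A) (B - fps_cutoff N B)) (exp w)"

lemma star_tail_nth:
  "norm (fps_nth (q_star h (A - fps_cutoff N A) (B - fps_cutoff N B)) n)
     \<le> C * C * exp (h * (real N)\<^sup>2) * exp ((a + 1 - h * real N) * real n)"
  "n < 2 * N \<Longrightarrow> fps_nth (q_star h (A - fps_cutoff N A) (B - fps_cutoff N B)) n = 0"
proof -
  have le: "norm (fps_nth (A - fps_cutoff N A) n) \<le> C * exp (a * real n)"
    "norm (fps_nth (B - fps_cutoff N B) n) \<le> C * exp (a * real n)" for n
    using A_le[of n] B_le[of n] C by auto
  have zero: "fps_nth (A - fps_cutoff N A) n = 0" "fps_nth (B - fps_cutoff N B) n = 0" if "n < N" for n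
    using that by auto
  show "norm (fps_nth (q_star h (A - fps_cutoff N A) (B - fps_cutoff N B)) n)
     \<le> C * C * exp (h * (real N)\<^sup>2) * exp ((a + 1 - h * real N) * real n)"
    by (rule norm_q_star_nth_le(1)[OF _ le zero]) (use h in simp_all)
  show "fps_nth (q_star h (A - fps_cutoff N A) (B - fps_cutoff N B)) n = 0" if "n < 2 * N"
    by (rule norm_q_star_nth_le(2)[OF _ le zero that]) (use h in simp_all)
qed

lemma norm_star_tail_le:
  assumes "Re w + a + 2 \<le> h * real N"
  shows "norm (star_tail N w) \<le> 2 * C\<^sup>2 * exp (2 * real N * (Re w + a + 1) - h * (real N)\<^sup>2)"
proof -
  have "norm (star_tail N w) \<le> 2 * (C * C * exp (h * (real N)\<^sup>2)) * exp (real (2 * N) * ((a + 1 - h * real N) + Re w))"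
    unfolding star_tail_def by (rule norm_eval_fps_exp_le_vanishing[OF star_tail_nth]) (use assms in simp_all)
  also have "\<dots> = 2 * C\<^sup>2 * (exp (h * (real N)\<^sup>2) * exp (real (2 * N) * ((a + 1 - h * real N) + Re w)))"
    by (simp add: power2_eq_square)
  also have "exp (h * (real N)\<^sup>2) * exp (real (2 * N) * ((a + 1 - h * real N) + Re w)) =
      exp (2 * real N * (Re w + a + 1) - h * (real N)\<^sup>2)"
    unfolding mult_exp_exp by (simp add: power2_eq_square algebra_simps)
  finally show ?thesis .
qed

lemma star_tail_holomorphic: "star_tail N holomorphic_on {w. Re w < h * real N - a - 2}"
proof -
  have "- (a + 1 - h * real N) - 1 = h * real N - a - 2" by simp
  with eval_fps_exp_holomorphic[OF star_tail_nth(1)[of N]] show ?thesis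
    unfolding star_tail_def[abs_def] by simp
qed

lemma star_head_holomorphic: "star_head N holomorphic_on sector d \<epsilon>"
proof -
  have shift: "(\<lambda>w. \<phi> (w - of_real x)) holomorphic_on sector d \<epsilon>" if "\<phi> holomorphic_on sector d \<epsilon>" for \<phi> x
  proof -
    have "(\<phi> \<circ> (\<lambda>w. w - of_real x)) holomorphic_on sector d \<epsilon>"
      by (rule holomorphic_on_compose_gen[OF _ that]) (auto intro!: holomorphic_intros)
    then show ?thesis by (simp only: o_def)
  qed
  have sum: "taylor_shift_sum h N D \<phi> holomorphic_on sector d \<epsilon>" if \<phi>: "\<phi> holomorphic_on sector d \<epsilon>" for D \<phi>
  proof -
    have "(\<lambda>w. exp (of_nat k * w)) holomorphic_on sector d \<epsilon>" for k by (intro holomorphic_intros)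
    then show ?thesis
      unfolding taylor_shift_sum_def[abs_def]
      by (intro holomorphic_on_sum holomorphic_on_mult holomorphic_on_const shift[OF \<phi>])
  qed
  have "taylor_poly N B holomorphic_on sector d \<epsilon>"
    unfolding taylor_poly_def[abs_def] by (intro holomorphic_intros)
  then show ?thesis
    unfolding star_head_def[abs_def] by (intro holomorphic_on_add holomorphic_on_diff sum f_hol g_hol)
qed

text \<open>
With \<open>y = Re w + a + 2\<close>, a term of the first two sums has an exponent
\<open>k y + (y - h k)\<^sup>2 / (2h) = (y\<^sup>2 + (h k)\<^sup>2) / (2h)\<close>, and a term of the third one has the exponent
\<open>k y + m y - h k m = y\<^sup>2 / h - (y - h k) (y - h m) / h\<close>. As long as \<open>h k \<le> y\<close> and \<open>h m \<le> y\<close> both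
are at most \<open>y\<^sup>2 / h\<close>.
\<close>

lemma norm_star_head_le:
  assumes w: "w \<in> sector d \<epsilon>" and N: "\<And>k. k < N \<Longrightarrow> h * real k \<le> Re w + a + 2"
  shows "norm (star_head N w) \<le> ((real N)\<^sup>2 + 2 * real N) * (C\<^sup>2 * exp ((max 0 (Re w + a + 2))\<^sup>2 / h))"
proof -
  define y where "y = Re w + a + 2"
  define E where "E = C\<^sup>2 * exp ((max 0 y)\<^sup>2 / h)"
  have coeff: "norm (fps_nth D k * exp (of_nat k * w)) \<le> C * exp (real k * y)"
    if "\<And>n. norm (fps_nth D n) \<le> C * exp (a * real n)" for D k
  proof -
    have "norm (fps_nth D k * exp (of_nat k * w)) \<le> C * exp (a * real k) * exp (real k * Re w)"
      using that[of k] by (simp add: norm_mult mult_right_mono)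
    also have "\<dots> = C * exp (real k * (Re w + a))"
      unfolding mult.assoc mult_exp_exp by (simp add: algebra_simps)
    also have "\<dots> \<le> C * exp (real k * y)"
      using C unfolding y_def by (intro mult_left_mono) (simp_all add: mult_left_mono)
    finally show ?thesis .
  qed
  have y0: "0 \<le> y" "max 0 y = y" if "k < N" for k
    using N[of 0] that unfolding y_def by auto
  have single: "norm (taylor_shift_sum h N D \<phi> w) \<le> real N * E"
    if D: "\<And>n. norm (fps_nth D n) \<le> C * exp (a * real n)" and \<phi>: "q_growth h a C (sector d \<epsilon>) \<phi>" for D \<phi>
  proof -
    have "norm (fps_nth D k * exp (of_nat k * w) * \<phi> (w - of_real (h * real k))) \<le> E" if k: "k < N" for k
    proof -
      have hk: "h * real k \<le> y" "0 \<le> h * real k" using N[OF k] h unfolding y_def by auto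
      have "norm (\<phi> (w - of_real (h * real k))) \<le> C * exp ((max 0 (Re (w - of_real (h * real k)) + a))\<^sup>2 / (2*h))"
        by (rule q_growthD[OF \<phi>]) (simp only: sector_translate w)
      also have "\<dots> \<le> C * exp ((y - h * real k)\<^sup>2 / (2*h))"
        using C hk h unfolding y_def by (intro mult_left_mono) (auto intro!: divide_right_mono power_mono)
      finally have "norm (fps_nth D k * exp (of_nat k * w) * \<phi> (w - of_real (h * real k)))
          \<le> (C * exp (real k * y)) * (C * exp ((y - h * real k)\<^sup>2 / (2*h)))"
        unfolding norm_mult[of _ "\<phi> _"] using coeff[OF D, of k] C by (intro mult_mono) auto
      also have "\<dots> = C\<^sup>2 * exp (real k * y + (y - h * real k)\<^sup>2 / (2*h))"
        by (simp add: exp_add power2_eq_square)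
      also have "real k * y + (y - h * real k)\<^sup>2 / (2*h) = (y\<^sup>2 + (h * real k)\<^sup>2) / (2*h)"
        using h by (simp add: field_simps power2_eq_square)
      also have "C\<^sup>2 * exp \<dots> \<le> C\<^sup>2 * exp ((max 0 y)\<^sup>2 / h)"
      proof -
        have "(h * real k)\<^sup>2 \<le> y\<^sup>2" using hk by (intro power_mono) auto
        then have "(y\<^sup>2 + (h * real k)\<^sup>2) / (2*h) \<le> (y\<^sup>2 + y\<^sup>2) / (2*h)"
          using h by (intro divide_right_mono) auto
        then show ?thesis unfolding y0(2)[OF k] by (intro mult_left_mono) auto
      qed
      finally show ?thesis unfolding E_def .
    qed
    then have "norm (taylor_shift_sum h N D \<phi> w) \<le> (\<Sum>k<N. E)"
      unfolding taylor_shift_sum_def by (intro sum_norm_le) auto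
    then show ?thesis by simp
  qed
  have "norm (taylor_shift_sum h N A (taylor_poly N B) w) \<le> (\<Sum>k<N. \<Sum>m<N. E)"
    unfolding taylor_shift_sum_def taylor_poly_def sum_distrib_left
  proof (intro sum_norm_le)
    fix k m assume "k \<in> {..<N}" "m \<in> {..<N}"
    then have k: "k < N" and m: "m < N" by auto
    have "exp (of_nat m * (w - complex_of_real (h * real k))) = exp (of_nat m * w) * of_real (exp (- (h * real k * real m)))"
      unfolding exp_of_real[symmetric] mult_exp_exp by (simp add: algebra_simps)
    then have "norm (fps_nth A k * exp (of_nat k * w) * (fps_nth B m * exp (of_nat m * (w - complex_of_real (h * real k)))))
        = norm (fps_nth A k * exp (of_nat k * w)) * norm (fps_nth B m * exp (of_nat m * w)) * exp (- (h * real k * real m))"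
      by (simp add: norm_mult)
    also have "\<dots> \<le> (C * exp (real k * y)) * (C * exp (real m * y)) * exp (- (h * real k * real m))"
      using coeff[OF A_le, of k] coeff[OF B_le, of m] C by (intro mult_right_mono mult_mono) auto
    also have "\<dots> = C\<^sup>2 * exp (real k * y + real m * y - h * real k * real m)"
      unfolding diff_conv_add_uminus exp_add by (simp add: power2_eq_square)
    also have "\<dots> \<le> E"
    proof -
      have "0 \<le> (y - h * real k) * (y - h * real m)"
        using N[OF k] N[OF m] unfolding y_def by simp
      then have "h * (real k * y + real m * y - h * real k * real m) \<le> y\<^sup>2"
        by (simp add: algebra_simps power2_eq_square)
      then have "real k * y + real m * y - h * real k * real m \<le> y\<^sup>2 / h"
        using h by (simp add: pos_le_divide_eq mult.commute)
      then show ?thesis unfolding E_def y0(2)[OF k] by (intro mult_left_mono) auto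
    qed
    finally show "norm (fps_nth A k * exp (of_nat k * w) * (fps_nth B m * exp (of_nat m * (w - complex_of_real (h * real k))))) \<le> E" .
  qed
  then have double: "norm (taylor_shift_sum h N A (taylor_poly N B) w) \<le> (real N)\<^sup>2 * E"
    by (simp add: power2_eq_square mult.assoc)
  have "norm (star_head N w) \<le> real N * E + real N * E + (real N)\<^sup>2 * E"
    unfolding star_head_def
    using norm_triangle_ineq4[of "taylor_shift_sum h N A g w + taylor_shift_sum h N B f w" "taylor_shift_sum h N A (taylor_poly N B) w"]
      norm_triangle_ineq[of "taylor_shift_sum h N A g w" "taylor_shift_sum h N B f w"]
      single[OF A_le g_growth] single[OF B_le f_growth] double
    by linarith
  then show ?thesis unfolding E_def y_def by (simp add: algebra_simps)
qed

text \<open>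
Bilinearity: with \<open>A = A' + A''\<close> and \<open>B = B' + B''\<close>, split at order \<open>N\<close>, the deformed product of
\<open>A\<close> and \<open>B\<close> is \<open>A' B + A B' - A' B' + A'' B''\<close>.
\<close>

lemma star_head_add_star_tail:
  assumes w: "w \<in> sector d \<epsilon>" "Re w < - a - 2"
  shows "star_head N w + star_tail N w = eval_fps (q_star h A B) (exp w)"
proof -
  let ?cA = "fps_cutoff N A" and ?cB = "fps_cutoff N B"
  have h0: "h \<ge> 0" using h by simp
  have cB_le: "norm (fps_nth ?cB n) \<le> C * exp (a * real n)" for n using B_le[of n] C by auto
  have shift: "Re (w - of_real (h * real k)) < - a" for k
    using w(2) mult_nonneg_nonneg[OF h0 of_nat_0_le_iff[of k]] by simp
  have "(\<lambda>n. fps_nth (q_star h ?cA B) n * exp w ^ n) sums taylor_shift_sum h N A (\<lambda>w. eval_fps B (exp w)) w"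
    by (rule q_star_cutoff_sums[OF B_le]) (use w h in auto)
  also have "taylor_shift_sum h N A (\<lambda>w. eval_fps B (exp w)) w = taylor_shift_sum h N A g w"
    unfolding taylor_shift_sum_def using g_germ[of "w - of_real (h * real _)"] shift w(1)
    by (intro sum.cong) (simp_all only: sector_translate)
  finally have s1: "(\<lambda>n. fps_nth (q_star h ?cA B) n * exp w ^ n) sums taylor_shift_sum h N A g w" .
  have "(\<lambda>n. fps_nth (q_star h ?cB A) n * exp w ^ n) sums taylor_shift_sum h N B (\<lambda>w. eval_fps A (exp w)) w"
    by (rule q_star_cutoff_sums[OF A_le]) (use w h in auto)
  also have "taylor_shift_sum h N B (\<lambda>w. eval_fps A (exp w)) w = taylor_shift_sum h N B f w"
    unfolding taylor_shift_sum_def using f_germ[of "w - of_real (h * real _)"] shift w(1)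
    by (intro sum.cong) (simp_all only: sector_translate)
  finally have s2: "(\<lambda>n. fps_nth (q_star h ?cB A) n * exp w ^ n) sums taylor_shift_sum h N B f w" .
  have "(\<lambda>n. fps_nth (q_star h ?cA ?cB) n * exp w ^ n) sums taylor_shift_sum h N A (\<lambda>w. eval_fps ?cB (exp w)) w"
    by (rule q_star_cutoff_sums[OF cB_le]) (use w h in auto)
  then have s3: "(\<lambda>n. fps_nth (q_star h ?cA ?cB) n * exp w ^ n) sums taylor_shift_sum h N A (taylor_poly N B) w"
    unfolding eval_fps_cutoff_exp .
  have s4: "(\<lambda>n. fps_nth (q_star h (A - ?cA) (B - ?cB)) n * exp w ^ n) sums star_tail N w"
    unfolding star_tail_def eval_fps_def
    by (rule summable_sums, rule summable_norm_cancel, rule norm_eval_fps_exp_le(1)[OF star_tail_nth(1)])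
       (use w(2) mult_nonneg_nonneg[OF h0 of_nat_0_le_iff[of N]] in linarith)
  have "q_star h A B = q_star h ?cA B + q_star h (A - ?cA) B"
    using q_star_add_left[of h ?cA "A - ?cA" B] by simp
  also have "q_star h (A - ?cA) B = q_star h (A - ?cA) ?cB + q_star h (A - ?cA) (B - ?cB)"
    using q_star_add_right[of h "A - ?cA" ?cB "B - ?cB"] by simp
  also have "q_star h (A - ?cA) ?cB = q_star h ?cB A - q_star h ?cA ?cB"
    using q_star_add_left[of h ?cA "A - ?cA" ?cB] q_star_commute[of h A ?cB] by (simp add: algebra_simps)
  finally have split: "q_star h A B = q_star h ?cA B + (q_star h ?cB A - q_star h ?cA ?cB + q_star h (A - ?cA) (B - ?cB))" .
  have "(\<lambda>n. fps_nth (q_star h A B) n * exp w ^ n) sums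
      (taylor_shift_sum h N A g w + (taylor_shift_sum h N B f w - taylor_shift_sum h N A (taylor_poly N B) w + star_tail N w))"
    unfolding split fps_add_nth fps_sub_nth distrib_right left_diff_distrib
    by (intro sums_add sums_diff s1 s2 s3 s4)
  then show ?thesis unfolding eval_fps_def star_head_def by (simp add: sums_iff)
qed

text \<open>
The least \<open>N\<close> for which the point lies in the region where the remaining power series is
controlled; being least, it also meets the condition under which the finite sums are bounded.
\<close>

definition cut_level :: "complex \<Rightarrow> nat" where
  "cut_level w = nat (\<lfloor>(Re w + a + 2) / h\<rfloor> + 1)"

lemma cut_level: "Re w + a + 2 < h * real (cut_level w)" "k < cut_level w \<Longrightarrow> h * real k \<le> Re w + a + 2"
proof -
  have "(Re w + a + 2) / h < real (cut_level w)" unfolding cut_level_def by linarith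
  then show "Re w + a + 2 < h * real (cut_level w)" using h by (simp add: field_simps)
  show "h * real k \<le> Re w + a + 2" if "k < cut_level w"
  proof -
    have "real k \<le> (Re w + a + 2) / h" using that unfolding cut_level_def by linarith
    then show ?thesis using h by (simp add: field_simps)
  qed
qed

definition star_ext :: "complex \<Rightarrow> complex" where
  "star_ext w = star_head (cut_level w) w + star_tail (cut_level w) w"

lemma star_head_add_star_tail_holomorphic:
  "(\<lambda>w. star_head N w + star_tail N w) holomorphic_on sector d \<epsilon> \<inter> {w. Re w < h * real N - a - 2}"
  using star_head_holomorphic[of N] star_tail_holomorphic[of N]
  by (intro holomorphic_on_add) (auto intro: holomorphic_on_subset)

text \<open>
Both sides are analytic on a sector cut off at some modulus and coincide with the power series
close to \<open>0\<close>; hence the order of the cut does not matter.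
\<close>

lemma star_ext_eq:
  assumes w: "w \<in> sector d \<epsilon>" "Re w + a + 2 < h * real N"
  shows "star_ext w = star_head N w + star_tail N w"
  unfolding star_ext_def
proof (rule strip_identity[OF \<epsilon>, where \<rho> = "min (h * real N) (h * real (cut_level w)) - a - 2" and r = "- a - 2"
      and f = "\<lambda>z. star_head (cut_level w) z + star_tail (cut_level w) z" and g = "\<lambda>z. star_head N z + star_tail N z"])
  show "(\<lambda>z. star_head (cut_level w) z + star_tail (cut_level w) z) holomorphic_on
      sector d \<epsilon> \<inter> {z. Re z < min (h * real N) (h * real (cut_level w)) - a - 2}"
    using star_head_add_star_tail_holomorphic by (rule holomorphic_on_subset) auto
  show "(\<lambda>z. star_head N z + star_tail N z) holomorphic_on
      sector d \<epsilon> \<inter> {z. Re z < min (h * real N) (h * real (cut_level w)) - a - 2}"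
    using star_head_add_star_tail_holomorphic by (rule holomorphic_on_subset) auto
  show "star_head (cut_level w) z + star_tail (cut_level w) z = star_head N z + star_tail N z"
    if "z \<in> sector d \<epsilon>" "Re z < - a - 2" for z
    using star_head_add_star_tail[OF that] by simp
  show "Re w < min (h * real N) (h * real (cut_level w)) - a - 2"
    using w(2) cut_level(1)[of w] by (simp add: min_def)
qed (rule w)

lemma star_ext_holomorphic: "star_ext holomorphic_on sector d \<epsilon>"
proof -
  have "star_ext holomorphic_on (\<Union>N. sector d \<epsilon> \<inter> {w. Re w < h * real N - a - 2})"
  proof (rule holomorphic_on_UN_open)
    fix N :: nat
    show "star_ext holomorphic_on sector d \<epsilon> \<inter> {w. Re w < h * real N - a - 2}"
      by (rule holomorphic_transform[OF star_head_add_star_tail_holomorphic], rule star_ext_eq[symmetric]) auto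
    show "open (sector d \<epsilon> \<inter> {w. Re w < h * real N - a - 2})"
      by (intro open_Int open_sector open_halfspace_Re_lt)
  qed
  moreover have "sector d \<epsilon> \<subseteq> (\<Union>N. sector d \<epsilon> \<inter> {w. Re w < h * real N - a - 2})"
  proof
    fix w assume "w \<in> sector d \<epsilon>"
    then show "w \<in> (\<Union>N. sector d \<epsilon> \<inter> {w. Re w < h * real N - a - 2})"
      using cut_level(1)[of w] by (intro UN_I[of "cut_level w"]) auto
  qed
  ultimately show ?thesis by (rule holomorphic_on_subset)
qed

lemma star_ext_germ: "w \<in> sector d \<epsilon> \<Longrightarrow> Re w < - a - 2 \<Longrightarrow> star_ext w = eval_fps (q_star h A B) (exp w)"
  using star_head_add_star_tail star_ext_def by simp

lemma norm_star_tail_le_growth: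
  assumes "Re w + a + 2 \<le> h * real N"
  shows "norm (star_tail N w) \<le> 2 * (C\<^sup>2 * exp ((max 0 (Re w + a + 2))\<^sup>2 / h))"
proof -
  define y where "y = Re w + a + 2"
  define P where "P = max 0 y"
  have "2 * real N * (Re w + a + 1) - h * (real N)\<^sup>2 \<le> 2 * real N * P - h * (real N)\<^sup>2"
    unfolding P_def y_def by (intro diff_right_mono mult_left_mono) auto
  also have "\<dots> \<le> P\<^sup>2 / h"
  proof -
    have "0 \<le> (P - h * real N)\<^sup>2" by simp
    then have "h * (2 * real N * P - h * (real N)\<^sup>2) \<le> P\<^sup>2"
      by (simp add: power2_eq_square algebra_simps)
    then show ?thesis using h by (simp add: pos_le_divide_eq mult.commute)
  qed
  finally have "exp (2 * real N * (Re w + a + 1) - h * (real N)\<^sup>2) \<le> exp (P\<^sup>2 / h)" by simp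
  then have "2 * C\<^sup>2 * exp (2 * real N * (Re w + a + 1) - h * (real N)\<^sup>2) \<le> 2 * C\<^sup>2 * exp (P\<^sup>2 / h)"
    by (intro mult_left_mono) auto
  then show ?thesis using norm_star_tail_le[OF assms] unfolding P_def y_def by simp
qed

lemma star_head_growth:
  assumes w: "w \<in> sector d \<epsilon>" and N: "\<And>k. k < N \<Longrightarrow> h * real k \<le> Re w + a + 2"
  shows "norm (star_head N w) + 2 * (C\<^sup>2 * exp ((max 0 (Re w + a + 2))\<^sup>2 / h))
     \<le> 9 * C\<^sup>2 * exp ((max 0 (Re w + a + 3))\<^sup>2 / h)"
proof -
  define y where "y = Re w + a + 2"
  have "norm (star_head N w) + 2 * (C\<^sup>2 * exp ((max 0 y)\<^sup>2 / h))
      \<le> C\<^sup>2 * (((real N)\<^sup>2 + 2 * real N + 2) * exp ((max 0 y)\<^sup>2 / h))"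
    using norm_star_head_le[OF w N] unfolding y_def by (simp add: algebra_simps)
  also have "\<dots> \<le> C\<^sup>2 * (9 * exp ((max 0 (y + 1))\<^sup>2 / h))"
    by (rule mult_left_mono[OF quadratic_index_bound[OF h]]) (use N in \<open>auto simp: y_def\<close>)
  finally show ?thesis unfolding y_def by (simp add: add.assoc)
qed

lemma norm_star_ext_le:
  assumes w: "w \<in> sector d \<epsilon>"
  shows "norm (star_ext w) \<le> 9 * C\<^sup>2 * exp ((max 0 (Re w + a + 3))\<^sup>2 / h)"
  unfolding star_ext_def
  using norm_triangle_ineq[of "star_head (cut_level w) w" "star_tail (cut_level w) w"] star_head_growth[OF w, of "cut_level w", OF cut_level(2)]
    norm_star_tail_le_growth[OF less_imp_le[OF cut_level(1)[of w]]]
  by linarith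

lemma star_ext_growth: "q_growth (h/2) (a + 3) (9 * C\<^sup>2) (sector d \<epsilon>) star_ext"
  unfolding q_growth_def using norm_star_ext_le by (simp add: add.assoc)

text \<open>
A majorant that does not depend on \<open>N\<close>: where \<open>N\<close> is large enough for the point, the difference
is the remaining power series; elsewhere \<open>N\<close> is so small that the finite sums themselves satisfy the
bound.
\<close>

lemma norm_star_ext_minus_star_head_le:
  assumes w: "w \<in> sector d \<epsilon>"
  shows "norm (star_ext w - star_head N w) \<le> 18 * C\<^sup>2 * exp ((max 0 (Re w + a + 3))\<^sup>2 / h)"
proof (cases "Re w + a + 2 < h * real N")
  case True
  have "norm (star_ext w - star_head N w) = norm (star_tail N w)" using star_ext_eq[OF w True] by simp
  also have "\<dots> \<le> 9 * C\<^sup>2 * exp ((max 0 (Re w + a + 3))\<^sup>2 / h)"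
    using norm_star_tail_le_growth[OF less_imp_le[OF True]] star_head_growth[OF w, of "cut_level w", OF cut_level(2)]
      norm_ge_zero[of "star_head (cut_level w) w"] by linarith
  also have "\<dots> \<le> 18 * C\<^sup>2 * exp ((max 0 (Re w + a + 3))\<^sup>2 / h)"
    by (intro mult_right_mono) auto
  finally show ?thesis .
next
  case False
  have "h * real k \<le> Re w + a + 2" if "k < N" for k
  proof -
    have "h * real k \<le> h * real N" using that h by simp
    then show ?thesis using False by linarith
  qed
  from star_head_growth[OF w this] have "norm (star_head N w) \<le> 9 * C\<^sup>2 * exp ((max 0 (Re w + a + 3))\<^sup>2 / h)"
    by (smt (verit) exp_ge_zero mult_nonneg_nonneg zero_le_power2)
  then show ?thesis
    using norm_star_ext_le[OF w] norm_triangle_ineq4[of "star_ext w" "star_head N w"] by linarith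
qed

text \<open>
Once the modulus lies below \<open>q\<^sup>N\<close>, up to a constant, the exponent \<open>2 N (Re w + a + 1) - h N\<^sup>2\<close> of
the remainder is eventually below \<open>- N\<close>.
\<close>

lemma star_head_tendsto_star_ext:
  assumes w: "w \<in> sector d \<epsilon>"
  shows "(\<lambda>N. star_ext w - star_head N w) \<longlonglongrightarrow> 0"
proof (rule Lim_null_comparison)
  define M where "M = max (Re w + a + 2) (2 * (Re w + a + 1) + 1) / h"
  obtain N0 :: nat where N0: "M < real N0" using reals_Archimedean2 by blast
  have "norm (star_ext w - star_head N w) \<le> 2 * C\<^sup>2 * exp (-1) ^ N" if "N \<ge> N0" for N
  proof -
    have "M < real N" using N0 that by (meson less_le_trans of_nat_mono)
    then have N: "Re w + a + 2 < h * real N" "2 * (Re w + a + 1) + 1 < h * real N"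
      using h unfolding M_def by (auto simp: field_simps)
    have "norm (star_ext w - star_head N w) \<le> 2 * C\<^sup>2 * exp (2 * real N * (Re w + a + 1) - h * (real N)\<^sup>2)"
      using star_ext_eq[OF w N(1)] norm_star_tail_le[OF less_imp_le[OF N(1)]] by simp
    also have "2 * real N * (Re w + a + 1) - h * (real N)\<^sup>2 = real N * (2 * (Re w + a + 1) - h * real N)"
      by (simp add: power2_eq_square algebra_simps)
    also have "2 * C\<^sup>2 * exp \<dots> \<le> 2 * C\<^sup>2 * exp (real N * (-1))"
    proof -
      have "real N * (2 * (Re w + a + 1) - h * real N) \<le> real N * (-1)"
        using N(2) by (intro mult_left_mono) auto
      then show ?thesis by (intro mult_left_mono) auto
    qed
    also have "exp (real N * (-1)) = exp (-1) ^ N" by (rule exp_of_nat_mult)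
    finally show ?thesis .
  qed
  then show "\<forall>\<^sub>F N in sequentially. norm (star_ext w - star_head N w) \<le> 2 * C\<^sup>2 * exp (-1) ^ N"
    unfolding eventually_sequentially by blast
  show "(\<lambda>N. 2 * C\<^sup>2 * exp (-1::real) ^ N) \<longlonglongrightarrow> 0"
    by (intro tendsto_mult_right_zero LIMSEQ_realpow_zero) auto
qed

end

section \<open>The Laplace transform of the continuation\<close>

lemma integrable_gaussian_quotient:
  fixes \<kappa> a b :: real
  assumes \<kappa>: "\<kappa> > 0" and ab: "a < b"
  shows "integrable lborel (\<lambda>t. exp ((max 0 (t + a))\<^sup>2 / (2*\<kappa>) - (t + b)\<^sup>2 / (2*\<kappa>)))"
proof -
  obtain K where K: "\<And>s. (max 0 (s + a))\<^sup>2 / (2*\<kappa>) - (s + b)\<^sup>2 / (2*\<kappa>) \<le> K - (b - a) / \<kappa> * \<bar>s\<bar>"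
    using gaussian_quotient_exponent[OF \<kappa> ab, of b] by auto
  show ?thesis
  proof (rule Bochner_Integration.integrable_bound)
    show "integrable lborel (\<lambda>t. exp K * exp (- ((b - a) / \<kappa> * \<bar>t\<bar>)))"
      using integrable_exp_neg_abs[of "(b - a) / \<kappa>"] \<kappa> ab by simp
    have "exp ((max 0 (t + a))\<^sup>2 / (2*\<kappa>) - (t + b)\<^sup>2 / (2*\<kappa>)) \<le> exp K * exp (- ((b - a) / \<kappa> * \<bar>t\<bar>))" for t
      using K[of t] by (simp add: mult_exp_exp)
    then show "AE t in lborel. norm (exp ((max 0 (t + a))\<^sup>2 / (2*\<kappa>) - (t + b)\<^sup>2 / (2*\<kappa>)))
        \<le> norm (exp K * exp (- ((b - a) / \<kappa> * \<bar>t\<bar>)))" by simp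
  qed measurable
qed

text \<open>
Young's inequality \<open>k P \<le> P\<^sup>2 / (2h) + h k\<^sup>2 / 2\<close>: monomials have growth of level 1.
\<close>

lemma exp_multiple_q_growth:
  assumes h: "h > 0"
  shows "q_growth h a (exp (h * (real k)\<^sup>2 / 2 - real k * a)) S (\<lambda>w. exp (of_nat k * w))"
  unfolding q_growth_def
proof
  fix w :: complex assume "w \<in> S"
  define P where "P = max 0 (Re w + a)"
  have "0 \<le> (P - h * real k)\<^sup>2" by simp
  then have "2 * h * (real k * P) \<le> P\<^sup>2 + (h * real k)\<^sup>2"
    by (simp add: power2_eq_square algebra_simps)
  then have "real k * P \<le> (P\<^sup>2 + (h * real k)\<^sup>2) / (2 * h)"
    using h by (simp add: pos_le_divide_eq mult.commute)
  also have "\<dots> = P\<^sup>2 / (2*h) + h * (real k)\<^sup>2 / 2"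
    using h by (simp add: field_simps power2_eq_square)
  finally have "real k * P \<le> P\<^sup>2 / (2*h) + h * (real k)\<^sup>2 / 2" .
  moreover have "real k * (Re w + a) \<le> real k * P" unfolding P_def by (intro mult_left_mono) auto
  ultimately have "real k * Re w \<le> (h * (real k)\<^sup>2 / 2 - real k * a) + P\<^sup>2 / (2*h)"
    unfolding distrib_left by linarith
  then show "norm (exp (of_nat k * w)) \<le> exp (h * (real k)\<^sup>2 / 2 - real k * a) * exp ((max 0 (Re w + a))\<^sup>2 / (2*h))"
    unfolding mult_exp_exp P_def[symmetric] by simp
qed

text \<open>
Completing the square in the exponent of the Gaussian exchanges the factor \<open>exp (k \<tau>)\<close> for the
translation of \<open>\<tau>\<close> by \<open>h k\<close>.
\<close>

lemma qLaplace_exp_times_shift_integrand: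
  fixes r v d :: real and k :: nat
  assumes q: "q > 1"
  defines "h \<equiv> ln q"
  shows "gauss_integrand h (\<lambda>w. exp (of_nat k * w)) g (Complex r d) (r - h/4 + h * real k - v) =
     exp (of_nat k * Complex v d) * g (Complex v d - of_real (h * real k)) / e_fun (sqrt q) (Complex v d - Complex r d)"
proof -
  have h: "h > 0" unfolding h_def using q by simp
  define D where "D = r - h/4 - v"
  define \<tau> where "\<tau> = r - h/4 + h * real k - v"
  have pts: "Complex r d - of_real (h/4) + of_real \<tau> = Complex v d + of_real (2 * D + h * real k)"
    "Complex r d - of_real (h/4) - of_real \<tau> = Complex v d - of_real (h * real k)"
    unfolding \<tau>_def D_def by (simp_all add: complex_eq_iff)
  have \<tau>: "\<tau> = D + h * real k" unfolding \<tau>_def D_def by simp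
  have e: "e_fun (sqrt q) (Complex v d - Complex r d) = of_real (sqrt (pi * h) * exp (D\<^sup>2 / h))"
  proof -
    have "of_real (h/4) + (Complex v d - Complex r d) = of_real (- D)"
      unfolding D_def by (simp add: complex_eq_iff)
    moreover have "e_fun (sqrt q) z = of_real (sqrt (pi * h)) * exp ((of_real (h/4) + z)\<^sup>2 / of_real h)" for z
      using q unfolding h_def by (simp add: e_fun_eq ln_sqrt)
    ultimately have "e_fun (sqrt q) (Complex v d - Complex r d) = of_real (sqrt (pi * h)) * exp (of_real ((- D)\<^sup>2 / h))"
      by (simp only: of_real_power of_real_divide)
    then show ?thesis by (simp only: exp_of_real of_real_mult power2_minus)
  qed
  have "real k * (2 * D + h * real k) - \<tau>\<^sup>2 / h = - (D\<^sup>2 / h)"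
    unfolding \<tau> using h by (simp add: field_simps power2_eq_square)
  then have expo: "exp (real k * (2 * D + h * real k)) * exp (- (\<tau>\<^sup>2 / h)) = inverse (exp (D\<^sup>2 / h))"
    unfolding mult_exp_exp by (simp add: exp_minus[symmetric])
  have "exp (of_nat k * (Complex v d + of_real (2 * D + h * real k))) * of_real (exp (- (\<tau>\<^sup>2 / h)) / sqrt (pi * h))
     = exp (of_nat k * Complex v d) * of_real (exp (real k * (2 * D + h * real k)) * exp (- (\<tau>\<^sup>2 / h)) / sqrt (pi * h))"
  proof -
    have "of_nat k * (Complex v d + of_real (2 * D + h * real k)) =
        of_nat k * Complex v d + complex_of_real (real k * (2 * D + h * real k))"
      by (simp add: distrib_left)
    then have "exp (of_nat k * (Complex v d + of_real (2 * D + h * real k))) =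
        exp (of_nat k * Complex v d) * of_real (exp (real k * (2 * D + h * real k)))"
      by (simp only: exp_add exp_of_real)
    then show ?thesis by (simp only: of_real_mult mult.assoc times_divide_eq_right[symmetric])
  qed
  also have "\<dots> = exp (of_nat k * Complex v d) / e_fun (sqrt q) (Complex v d - Complex r d)"
    unfolding expo e by (simp add: divide_inverse)
  finally have "exp (of_nat k * (Complex v d + of_real (2 * D + h * real k))) * of_real (exp (- (\<tau>\<^sup>2 / h)) / sqrt (pi * h))
     = exp (of_nat k * Complex v d) / e_fun (sqrt q) (Complex v d - Complex r d)" .
  moreover have swap: "x * y * z = x * z * y" for x y z :: complex by simp
  ultimately show ?thesis
    unfolding \<tau>_def[symmetric] gauss_integrand_def pts
    by (subst swap) (simp only: times_divide_eq_left)
qed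

lemma qLaplace_exp_times_shift:
  fixes g :: "complex \<Rightarrow> complex" and d \<epsilon> C' :: real
  assumes q: "q > 1" and \<epsilon>: "\<epsilon> > 0" 
    and g: "q_growth (ln q) a C (sector d \<epsilon>) g" "continuous_on (sector d \<epsilon>) g"
  shows "integrable lborel (\<lambda>v. exp (of_nat k * Complex v d) * g (Complex v d - of_real (ln q * real k)) /
           e_fun (sqrt q) (Complex v d - Complex r d))" (is ?int)
    and "qLaplace (sqrt q) d (\<lambda>w. exp (of_nat k * w) * g (w - of_real (ln q * real k))) (Complex r d)
       = gauss_prod (ln q) (\<lambda>w. exp (of_nat k * w)) g (Complex r d)" (is ?eq)
    and "integrable lborel (gauss_integrand (ln q) (\<lambda>w. exp (of_nat k * w)) g (Complex r d))" (is ?int')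
proof -
  let ?F = "gauss_integrand (ln q) (\<lambda>w. exp (of_nat k * w)) g (Complex r d)"
  have h: "ln q > 0" using q by simp
  show int': ?int'
    by (rule integrable_gauss_integrand[OF h exp_multiple_q_growth[OF h] g(1) _ g(2)])
       (use \<epsilon> in \<open>auto intro!: continuous_intros\<close>)
  have F: "?F ((r - ln q / 4 + ln q * real k) + (-1) * v) =
      exp (of_nat k * Complex v d) * g (Complex v d - of_real (ln q * real k)) / e_fun (sqrt q) (Complex v d - Complex r d)" for v
    using qLaplace_exp_times_shift_integrand[OF q, of k g r d v] by simp
  show ?int
    unfolding F[symmetric] by (rule lborel_integrable_real_affine[OF int']) simp
  show ?eq
    unfolding qLaplace_def gauss_prod_def F[symmetric]
    using lborel_integral_real_affine[of "-1" ?F "r - ln q / 4 + ln q * real k"] by simp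
qed

lemma gauss_integrand_taylor_poly:
  "gauss_integrand h (taylor_poly N A) g u \<tau> =
     (\<Sum>k<N. fps_nth A k * gauss_integrand h (\<lambda>w. exp (of_nat k * w)) g u \<tau>)"
  by (simp add: gauss_integrand_def taylor_poly_def sum_distrib_right sum_divide_distrib mult.assoc)

lemma qLaplace_taylor_shift_sum:
  fixes g :: "complex \<Rightarrow> complex"
  assumes q: "q > 1" and \<epsilon>: "\<epsilon> > 0"
    and g: "q_growth (ln q) a C (sector d \<epsilon>) g" "continuous_on (sector d \<epsilon>) g"
  shows "integrable lborel (\<lambda>v. taylor_shift_sum (ln q) N A g (Complex v d) / e_fun (sqrt q) (Complex v d - Complex r d))"
    and "qLaplace (sqrt q) d (taylor_shift_sum (ln q) N A g) (Complex r d) = gauss_prod (ln q) (taylor_poly N A) g (Complex r d)"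
    and "integrable lborel (gauss_integrand (ln q) (taylor_poly N A) g (Complex r d))"
proof -
  define T where "T k v = exp (of_nat k * Complex v d) * g (Complex v d - of_real (ln q * real k)) /
      e_fun (sqrt q) (Complex v d - Complex r d)" for k v
  have split: "taylor_shift_sum (ln q) N A g (Complex v d) / e_fun (sqrt q) (Complex v d - Complex r d) =
      (\<Sum>k<N. fps_nth A k * T k v)" for v
    by (simp add: taylor_shift_sum_def T_def sum_divide_distrib mult.assoc)
  have T: "integrable lborel (T k)"
    and T_eq: "(LINT v|lborel. T k v) = gauss_prod (ln q) (\<lambda>w. exp (of_nat k * w)) g (Complex r d)" for k
    using qLaplace_exp_times_shift(1,2)[OF q \<epsilon> g, of k r] unfolding qLaplace_def T_def[abs_def] .
  note mono = qLaplace_exp_times_shift[OF q \<epsilon> g]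
  show "integrable lborel (\<lambda>v. taylor_shift_sum (ln q) N A g (Complex v d) / e_fun (sqrt q) (Complex v d - Complex r d))"
    unfolding split by (intro Bochner_Integration.integrable_sum integrable_mult_right T)
  show "integrable lborel (gauss_integrand (ln q) (taylor_poly N A) g (Complex r d))"
    unfolding gauss_integrand_taylor_poly[abs_def]
    by (intro Bochner_Integration.integrable_sum integrable_mult_right mono(3))
  have "qLaplace (sqrt q) d (taylor_shift_sum (ln q) N A g) (Complex r d) = (\<Sum>k<N. fps_nth A k * (LINT v|lborel. T k v))"
    unfolding qLaplace_def split
    by (subst Bochner_Integration.integral_sum) (intro integrable_mult_right T, simp)
  also have "\<dots> = (\<Sum>k<N. fps_nth A k * gauss_prod (ln q) (\<lambda>w. exp (of_nat k * w)) g (Complex r d))"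
    by (simp only: T_eq)
  also have "\<dots> = gauss_prod (ln q) (taylor_poly N A) g (Complex r d)"
    unfolding gauss_prod_def gauss_integrand_taylor_poly
    by (subst Bochner_Integration.integral_sum) (intro integrable_mult_right mono(3), simp)
  finally show "qLaplace (sqrt q) d (taylor_shift_sum (ln q) N A g) (Complex r d) = gauss_prod (ln q) (taylor_poly N A) g (Complex r d)" .
qed

lemma gauss_integrand_swap: "gauss_integrand h f g u (- \<tau>) = gauss_integrand h g f u \<tau>"
  by (simp add: gauss_integrand_def mult_ac)

lemma gauss_prod_commute: "gauss_prod h f g u = gauss_prod h g f u"
  using lborel_integral_real_affine[of "-1" "gauss_integrand h f g u" 0]
  unfolding gauss_prod_def by (simp add: gauss_integrand_swap)

lemma gauss_integrand_diff:
  "gauss_integrand h (\<lambda>w. f w - f' w) (\<lambda>w. g w - g' w) u \<tau> =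
     gauss_integrand h f g u \<tau> - gauss_integrand h f' g u \<tau> - (gauss_integrand h f g' u \<tau> - gauss_integrand h f' g' u \<tau>)"
  by (simp add: gauss_integrand_def algebra_simps)

lemma taylor_poly_q_growth:
  assumes h: "h > 0"
  shows "\<exists>K. q_growth h a K S (taylor_poly N A)"
proof -
  define K where "K = (\<Sum>k<N. norm (fps_nth A k) * exp (h * (real k)\<^sup>2 / 2 - real k * a))"
  have "norm (taylor_poly N A w) \<le> K * exp ((max 0 (Re w + a))\<^sup>2 / (2*h))" if w: "w \<in> S" for w
  proof -
    have "norm (taylor_poly N A w) \<le> (\<Sum>k<N. norm (fps_nth A k) * exp (h * (real k)\<^sup>2 / 2 - real k * a) * exp ((max 0 (Re w + a))\<^sup>2 / (2*h)))"
      unfolding taylor_poly_def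
    proof (rule sum_norm_le)
      fix k
      show "norm (fps_nth A k * exp (of_nat k * w)) \<le>
          norm (fps_nth A k) * exp (h * (real k)\<^sup>2 / 2 - real k * a) * exp ((max 0 (Re w + a))\<^sup>2 / (2*h))"
        using q_growthD[OF exp_multiple_q_growth[OF h, of a k S] w] by (simp add: norm_mult mult.assoc mult_left_mono)
    qed
    then show ?thesis unfolding K_def by (simp add: sum_distrib_right)
  qed
  then show ?thesis unfolding q_growth_def by blast
qed

lemma norm_taylor_poly_le:
  assumes D: "\<And>n. norm (fps_nth D n) \<le> C * exp (a * real n)" and C: "C \<ge> 0"
  shows "norm (taylor_poly N D w) \<le> C * (real N * exp (real N * max 0 (a + Re w)))"
proof -
  have "norm (taylor_poly N D w) \<le> (\<Sum>k<N. C * exp (real N * max 0 (a + Re w)))"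
    unfolding taylor_poly_def
  proof (rule sum_norm_le)
    fix k assume k: "k \<in> {..<N}"
    have "norm (fps_nth D k * exp (of_nat k * w)) \<le> C * exp (a * real k) * exp (real k * Re w)"
      using D[of k] by (simp add: norm_mult mult_right_mono)
    also have "\<dots> = C * exp (real k * (a + Re w))"
      unfolding mult.assoc mult_exp_exp by (simp add: algebra_simps)
    also have "\<dots> \<le> C * exp (real N * max 0 (a + Re w))"
    proof -
      have "real k * (a + Re w) \<le> real k * max 0 (a + Re w)" by (intro mult_left_mono) auto
      also have "\<dots> \<le> real N * max 0 (a + Re w)" using k by (intro mult_right_mono) auto
      finally show ?thesis using C by (intro mult_left_mono) auto
    qed
    finally show "norm (fps_nth D k * exp (of_nat k * w)) \<le> C * exp (real N * max 0 (a + Re w))" .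
  qed
  then show ?thesis by (simp add: mult_ac)
qed

lemma norm_taylor_remainder_le:
  fixes D :: "complex fps"
  assumes D: "\<And>n. norm (fps_nth D n) \<le> C * exp (a * real n)" and C: "C \<ge> 0" and w: "Re w \<le> - a - 1"
  shows "norm (eval_fps D (exp w) - taylor_poly N D w) \<le> 2 * C * exp (real N * (a + Re w))"
proof -
  have D': "norm (fps_nth (D - fps_cutoff N D) n) \<le> C * exp (a * real n)"
    and cut: "norm (fps_nth (fps_cutoff N D) n) \<le> C * exp (a * real n)" for n
    using D[of n] C by auto
  have "eval_fps D (exp w) - eval_fps (fps_cutoff N D) (exp w) = eval_fps (D - fps_cutoff N D) (exp w)"
    unfolding eval_fps_def fps_sub_nth left_diff_distrib
    by (rule suminf_diff; rule summable_norm_cancel; rule norm_eval_fps_exp_le(1)[OF _ w]; rule D cut)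
  also have "norm \<dots> \<le> 2 * C * exp (real N * (a + Re w))"
    by (rule norm_eval_fps_exp_le_vanishing[OF D' _ w]) simp
  finally show ?thesis unfolding eval_fps_cutoff_exp .
qed

text \<open>
The point \<open>z\<close> stays near \<open>0\<close>, where the Taylor remainder of \<open>B\<close> is at most of the order
\<open>exp (N (Re z + a))\<close>. At \<open>w\<close>, possibly far out, the remainder of the other factor consists of \<open>F\<close>, which is
of level 1, and of a Taylor polynomial of the order \<open>exp (N (Re w + a))\<close>. Since
\<open>(Re w + a) + (Re z + a) = 2 (x + a) \<le> - 2\<close>, the small factor wins in both cases.
\<close>

lemma norm_remainder_product_le:
  fixes A B :: "complex fps" and x \<tau> :: real
  assumes h: "h > 0" and C: "C \<ge> 0"
    and A: "\<And>n. norm (fps_nth A n) \<le> C * exp (a * real n)" and B: "\<And>n. norm (fps_nth B n) \<le> C * exp (a * real n)"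
    and x: "x + a \<le> - 1" "\<tau> \<ge> 0" and w: "Re w = x + \<tau>" and z: "Re z = x - \<tau>"
    and F: "norm F \<le> C * exp ((max 0 (Re w + a))\<^sup>2 / (2*h))"
  shows "norm (F - taylor_poly N A w) * norm (eval_fps B (exp z) - taylor_poly N B z)
     \<le> 2 * C\<^sup>2 * ((1 + real N) * exp (-1) ^ N) * exp (\<tau>\<^sup>2 / (2*h))"
proof -
  define T where "T = exp (\<tau>\<^sup>2 / (2*h))"
  define E where "E = exp (-1::real) ^ N"
  define M where "M = exp (real N * (a + Re z))"
  have T: "T \<ge> 1" unfolding T_def using h by simp
  have E: "E = exp (real N * (-1))" unfolding E_def by (rule exp_of_nat_mult[symmetric])
  have E0: "E \<ge> 0" unfolding E_def by simp
  have "(max 0 (Re w + a))\<^sup>2 \<le> \<tau>\<^sup>2" using x w by (intro power_mono) auto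
  then have "exp ((max 0 (Re w + a))\<^sup>2 / (2*h)) \<le> T" unfolding T_def using h by (simp add: divide_right_mono)
  then have "norm F \<le> C * T" using F C by (meson mult_left_mono order_trans)
  then have "norm (F - taylor_poly N A w) \<le> C * T + C * (real N * exp (real N * max 0 (a + Re w)))"
    using norm_triangle_ineq4[of F "taylor_poly N A w"] norm_taylor_poly_le[OF A C, of N w] by linarith
  moreover have "norm (eval_fps B (exp z) - taylor_poly N B z) \<le> 2 * C * M"
    unfolding M_def by (rule norm_taylor_remainder_le[OF B C]) (use x z in linarith)
  ultimately have "norm (F - taylor_poly N A w) * norm (eval_fps B (exp z) - taylor_poly N B z)
      \<le> (C * T + C * (real N * exp (real N * max 0 (a + Re w)))) * (2 * C * M)"
    using C T by (intro mult_mono) auto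
  also have "\<dots> = 2 * C\<^sup>2 * (T * M + real N * (exp (real N * max 0 (a + Re w)) * M))"
    by (simp add: algebra_simps power2_eq_square)
  also have "\<dots> \<le> 2 * C\<^sup>2 * (T * E + real N * E)"
  proof (intro mult_left_mono add_mono)
    show "M \<le> E" unfolding E M_def exp_le_cancel_iff using x z by (intro mult_left_mono) auto
    have "max 0 (a + Re w) + (a + Re z) \<le> -1" using x w z by (simp add: max_def)
    then have "real N * (max 0 (a + Re w) + (a + Re z)) \<le> real N * (-1)" by (intro mult_left_mono) auto
    then show "exp (real N * max 0 (a + Re w)) * M \<le> E"
      unfolding E M_def mult_exp_exp exp_le_cancel_iff by (simp add: distrib_left)
  qed (use T in auto)
  also have "\<dots> \<le> 2 * C\<^sup>2 * (T * E + real N * (E * T))"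
    using T E0 mult_left_mono[of 1 T E] by (intro mult_left_mono add_left_mono) auto
  also have "\<dots> = 2 * C\<^sup>2 * ((1 + real N) * E) * T" by (simp add: algebra_simps)
  finally show ?thesis unfolding T_def E_def .
qed

context level1_pair
begin

lemma ray_continuous:
  assumes "\<phi> holomorphic_on sector d \<epsilon>"
  shows "continuous_on {w. Im w = d} \<phi>"
  using holomorphic_on_imp_continuous_on[OF assms] ray_subset_sector[OF \<epsilon>] by (rule continuous_on_subset)

text \<open>
For either sign of \<open>\<tau>\<close> one of the two arguments is close to \<open>0\<close>, and the roles of the two
germs can be exchanged.
\<close>

lemma gauss_prod_remainder_tendsto_0:
  assumes r: "r \<le> - a - 1"
  shows "(\<lambda>N. gauss_prod h (\<lambda>w. f w - taylor_poly N A w) (\<lambda>w. g w - taylor_poly N B w) (Complex r d)) \<longlonglongrightarrow> 0"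
proof (rule Lim_null_comparison)
  define x where "x = r - h/4"
  define J where "J = (LINT t|lborel. exp (- (1/h * \<bar>t\<bar>)))"
  define K where "K = 2 * C\<^sup>2 * exp (1 / (2*h)) / sqrt (pi * h)"
  have x: "x + a \<le> - 1" unfolding x_def using r h by simp
  have "norm (gauss_integrand h (\<lambda>w. f w - taylor_poly N A w) (\<lambda>w. g w - taylor_poly N B w) (Complex r d) \<tau>)
      \<le> K * ((1 + real N) * exp (-1) ^ N) * exp (- (1/h * \<bar>\<tau>\<bar>))" for N \<tau>
  proof -
    let ?p = "Complex r d - of_real (h/4) + of_real \<tau>" and ?m = "Complex r d - of_real (h/4) - of_real \<tau>"
    have p: "?p \<in> sector d \<epsilon>" "Re ?p = x + \<tau>" and m: "?m \<in> sector d \<epsilon>" "Re ?m = x - \<tau>"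
      using \<epsilon> unfolding x_def by (auto simp: sector_def larg_def)
    let ?Q = "2 * C\<^sup>2 * ((1 + real N) * exp (-1) ^ N) * exp (\<tau>\<^sup>2 / (2*h))"
    have prod: "norm (f ?p - taylor_poly N A ?p) * norm (g ?m - taylor_poly N B ?m) \<le> ?Q"
    proof (cases "\<tau> \<ge> 0")
      case True
      have "g ?m = eval_fps B (exp ?m)" by (rule g_germ[OF m(1)]) (use m(2) x True in linarith)
      then show ?thesis
        using norm_remainder_product_le[OF h C A_le B_le x True p(2) m(2) q_growthD[OF f_growth p(1)], of N] by simp
    next
      case False
      then have \<tau>: "- \<tau> \<ge> 0" by simp
      have p': "Re ?p = x - (- \<tau>)" and m': "Re ?m = x + (- \<tau>)" using p m by auto
      have "f ?p = eval_fps A (exp ?p)" by (rule f_germ[OF p(1)]) (use p(2) x False in linarith)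
      then show ?thesis
        using norm_remainder_product_le[OF h C B_le A_le x(1) \<tau> m' p' q_growthD[OF g_growth m(1)], of N]
        by (simp add: mult.commute)
    qed
    have "norm (gauss_integrand h (\<lambda>w. f w - taylor_poly N A w) (\<lambda>w. g w - taylor_poly N B w) (Complex r d) \<tau>) =
        norm (f ?p - taylor_poly N A ?p) * norm (g ?m - taylor_poly N B ?m) * (exp (- (\<tau>\<^sup>2 / h)) / sqrt (pi * h))"
      using h unfolding gauss_integrand_def norm_mult by (simp add: norm_divide)
    also have "\<dots> \<le> ?Q * (exp (- (\<tau>\<^sup>2 / h)) / sqrt (pi * h))"
      using prod h by (intro mult_right_mono) auto
    also have "\<dots> = 2 * C\<^sup>2 / sqrt (pi * h) * ((1 + real N) * exp (-1) ^ N) * (exp (\<tau>\<^sup>2 / (2*h)) * exp (- (\<tau>\<^sup>2 / h)))"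
      by (simp only: divide_inverse mult_ac)
    also have "\<dots> \<le> 2 * C\<^sup>2 / sqrt (pi * h) * ((1 + real N) * exp (-1) ^ N) * (exp (1 / (2*h)) * exp (- (1/h * \<bar>\<tau>\<bar>)))"
    proof (rule mult_left_mono)
      have "0 \<le> (\<bar>\<tau>\<bar> - 1)\<^sup>2" by simp
      then have "2 * \<bar>\<tau>\<bar> - \<tau>\<^sup>2 \<le> 1" by (simp add: power2_diff)
      then have "(2 * \<bar>\<tau>\<bar> - \<tau>\<^sup>2) / (2*h) \<le> 1 / (2*h)" using h by (intro divide_right_mono) auto
      moreover have "(2 * \<bar>\<tau>\<bar> - \<tau>\<^sup>2) / (2*h) = \<tau>\<^sup>2 / (2*h) - \<tau>\<^sup>2 / h + 1/h * \<bar>\<tau>\<bar>"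
        using h by (simp add: field_simps)
      ultimately show "exp (\<tau>\<^sup>2 / (2*h)) * exp (- (\<tau>\<^sup>2 / h)) \<le> exp (1 / (2*h)) * exp (- (1/h * \<bar>\<tau>\<bar>))"
        unfolding mult_exp_exp by simp
    qed (use h in simp)
    also have "\<dots> = K * ((1 + real N) * exp (-1) ^ N) * exp (- (1/h * \<bar>\<tau>\<bar>))"
      unfolding K_def by (simp only: divide_inverse mult_ac)
    finally show ?thesis .
  qed
  note bound = this
  have "norm (gauss_prod h (\<lambda>w. f w - taylor_poly N A w) (\<lambda>w. g w - taylor_poly N B w) (Complex r d))
      \<le> (LINT t|lborel. K * ((1 + real N) * exp (-1) ^ N) * exp (- (1/h * \<bar>t\<bar>)))" for N
    unfolding gauss_prod_def
  proof (rule order_trans[OF integral_norm_bound Bochner_Integration.integral_mono'])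
    show "integrable lborel (\<lambda>t. K * ((1 + real N) * exp (-1) ^ N) * exp (- (1/h * \<bar>t\<bar>)))"
      by (intro integrable_mult_right integrable_exp_neg_abs) (use h in simp)
    show "0 \<le> K * ((1 + real N) * exp (-1) ^ N) * exp (- (1/h * \<bar>t\<bar>))" for t
      using bound norm_ge_zero order_trans by blast
  qed (rule bound)
  then have "norm (gauss_prod h (\<lambda>w. f w - taylor_poly N A w) (\<lambda>w. g w - taylor_poly N B w) (Complex r d))
      \<le> K * J * (exp (-1) ^ N + real N * exp (-1) ^ N)" for N
    unfolding integral_mult_right_zero J_def[symmetric] by (simp add: algebra_simps)
  then show "\<forall>\<^sub>F N in sequentially. norm (gauss_prod h (\<lambda>w. f w - taylor_poly N A w) (\<lambda>w. g w - taylor_poly N B w) (Complex r d))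
      \<le> K * J * (exp (-1) ^ N + real N * exp (-1) ^ N)" by simp
  have "(\<lambda>N. real N * exp (-1::real) ^ N) \<longlonglongrightarrow> 0"
    using powser_times_n_limit_0[of "exp (-1::real)"] by simp
  then show "(\<lambda>N. K * J * (exp (-1) ^ N + real N * exp (-1) ^ N)) \<longlonglongrightarrow> 0"
    by (intro tendsto_mult_right_zero tendsto_add_zero LIMSEQ_realpow_zero) auto
qed

text \<open>
Dominated convergence: the majorant of level 2 is integrable against the kernel of level 2 because
the modulus \<open>exp r\<close> of the variable is small.
\<close>

lemma qLaplace_star_ext_minus_star_head_tendsto_0:
  assumes q: "q > 1" and hq: "h = ln q" and r: "r < h/4 - (a + 3)"
  shows "(\<lambda>N. LINT t|lborel. (star_ext (Complex t d) - star_head N (Complex t d)) / e_fun (sqrt q) (Complex t d - Complex r d)) \<longlonglongrightarrow> 0"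
proof -
  define E where "E N w = star_ext w - star_head N w" for N w
  have sq: "sqrt q > 1" "ln (sqrt q) = h/2" using q hq by (simp_all add: ln_sqrt)
  have growth: "q_growth (ln (sqrt q)) (a + 3) (18 * C\<^sup>2) {w. Im w = d} (E N)" for N
    unfolding q_growth_def sq E_def
    using norm_star_ext_minus_star_head_le ray_subset_sector[OF \<epsilon>] by (auto simp: add.assoc)
  have cont: "continuous_on {w. Im w = d} (E N)" for N
    unfolding E_def[abs_def]
    by (intro ray_continuous holomorphic_on_diff star_ext_holomorphic star_head_holomorphic)
  have int: "integrable lborel (\<lambda>t. E N (Complex t d) / e_fun (sqrt q) (Complex t d - Complex r d))" for N
    by (rule qLaplace_integrable[OF sq(1) growth cont]) (use r in \<open>simp add: sq\<close>)
  define G where "G t = 18 * C\<^sup>2 / sqrt (2 * pi * (h/2)) *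
      exp ((max 0 (t + (a + 3)))\<^sup>2 / (2 * (h/2)) - (t + (h/4 - r))\<^sup>2 / (2 * (h/2)))" for t
  have G: "integrable lborel G"
    unfolding G_def by (intro integrable_mult_right integrable_gaussian_quotient) (use h r in auto)
  have bound: "norm (E N (Complex t d) / e_fun (sqrt q) (Complex t d - Complex r d)) \<le> G t" for N t
    using norm_qLaplace_integrand[OF sq(1) growth, of N t "Complex r d"] unfolding sq G_def by simp
  have lim: "(\<lambda>N. E N (Complex t d) / e_fun (sqrt q) (Complex t d - Complex r d)) \<longlonglongrightarrow> 0" for t
    unfolding E_def divide_inverse
    by (intro tendsto_mult_left_zero star_head_tendsto_star_ext ray_in_sector \<epsilon>)
  have "(\<lambda>N. LINT t|lborel. E N (Complex t d) / e_fun (sqrt q) (Complex t d - Complex r d)) \<longlonglongrightarrow> (LINT (t::real)|lborel. (0::complex))"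
  proof (rule integral_dominated_convergence[where w = G and f = "\<lambda>_::real. 0::complex"
        and s = "\<lambda>N t. E N (Complex t d) / e_fun (sqrt q) (Complex t d - Complex r d)"])
    show "(\<lambda>t. E N (Complex t d) / e_fun (sqrt q) (Complex t d - Complex r d)) \<in> borel_measurable lborel" for N
      using int by (rule borel_measurable_integrable)
    show "AE t in lborel. (\<lambda>N. E N (Complex t d) / e_fun (sqrt q) (Complex t d - Complex r d)) \<longlonglongrightarrow> 0"
      by (intro AE_I2 lim)
    show "AE t in lborel. norm (E N (Complex t d) / e_fun (sqrt q) (Complex t d - Complex r d)) \<le> G t" for N
      by (intro AE_I2 bound)
  qed (use G in simp_all)
  then show ?thesis by (simp add: E_def)
qed

text \<open>
The transforms of the finite sums are the Gaussian products with Taylor polynomials, so that the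
difference of the two sides equals, for each \<open>N\<close>, the transform of the remainder of the continuation
minus the Gaussian product of the Taylor remainders. The former difference does not depend on \<open>N\<close> and
the latter tends to \<open>0\<close>.
\<close>

lemma qLaplace_star_ext_on_ray:
  assumes q: "q > 1" and hq: "h = ln q" and r: "r < - a - 3"
  shows "qLaplace (sqrt q) d star_ext (Complex r d) = gauss_prod h f g (Complex r d)"
proof -
  let ?u = "Complex r d"
  let ?L = "\<lambda>\<phi> t. \<phi> (Complex t d) / e_fun (sqrt q) (Complex t d - ?u)"
  have sq: "sqrt q > 1" "ln (sqrt q) = h/2" using q hq by (simp_all add: ln_sqrt)
  have fc: "continuous_on (sector d \<epsilon>) f" "continuous_on (sector d \<epsilon>) g"
    using f_hol g_hol by (simp_all add: holomorphic_on_imp_continuous_on)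
  have pc: "continuous_on S (taylor_poly N D)" for S N and D :: "complex fps"
    unfolding taylor_poly_def[abs_def] by (intro continuous_intros)
  have inS: "?u + complex_of_real x \<in> sector d \<epsilon>" for x by (simp add: \<epsilon>)
  have star_ext_int: "integrable lborel (?L star_ext)"
  proof (rule qLaplace_integrable[OF sq(1)])
    show "q_growth (ln (sqrt q)) (a + 3) (9 * C\<^sup>2) {w. Im w = d} star_ext"
      using star_ext_growth ray_subset_sector[OF \<epsilon>] unfolding q_growth_def sq by blast
    show "continuous_on {w. Im w = d} star_ext" by (rule ray_continuous[OF star_ext_holomorphic])
    show "Re ?u < ln (sqrt q) / 2 - (a + 3)" using r h by (simp add: sq)
  qed
  have step: "qLaplace (sqrt q) d star_ext ?u - gauss_prod h f g ?u =
      (LINT t|lborel. (star_ext (Complex t d) - star_head N (Complex t d)) / e_fun (sqrt q) (Complex t d - ?u))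
      - gauss_prod h (\<lambda>w. f w - taylor_poly N A w) (\<lambda>w. g w - taylor_poly N B w) ?u" for N
  proof -
    obtain KA KB where KA: "q_growth h a KA (sector d \<epsilon>) (taylor_poly N A)"
      and KB: "q_growth h a KB (sector d \<epsilon>) (taylor_poly N B)"
      using taylor_poly_q_growth[OF h] by blast
    note LA = qLaplace_taylor_shift_sum[OF q \<epsilon> g_growth[unfolded hq] fc(2), of N A r, folded hq]
    note LB = qLaplace_taylor_shift_sum[OF q \<epsilon> f_growth[unfolded hq] fc(1), of N B r, folded hq]
    note LAB = qLaplace_taylor_shift_sum[OF q \<epsilon> KB[unfolded hq] pc, of N A r, folded hq]
    have "(\<lambda>t. ?L (star_head N) t) = (\<lambda>t. ?L (taylor_shift_sum h N A g) t + ?L (taylor_shift_sum h N B f) t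
        - ?L (taylor_shift_sum h N A (taylor_poly N B)) t)"
      unfolding star_head_def by (simp add: add_divide_distrib diff_divide_distrib)
    then have star_head_int: "integrable lborel (?L (star_head N))"
      and star_head_eq: "(LINT t|lborel. ?L (star_head N) t) =
        gauss_prod h (taylor_poly N A) g ?u + gauss_prod h (taylor_poly N B) f ?u - gauss_prod h (taylor_poly N A) (taylor_poly N B) ?u"
      using LA(1) LB(1) LAB(1) unfolding LA(2)[symmetric] LB(2)[symmetric] LAB(2)[symmetric] qLaplace_def by simp_all
    have "gauss_prod h (\<lambda>w. f w - taylor_poly N A w) (\<lambda>w. g w - taylor_poly N B w) ?u =
        gauss_prod h f g ?u - gauss_prod h (taylor_poly N A) g ?u
        - (gauss_prod h f (taylor_poly N B) ?u - gauss_prod h (taylor_poly N A) (taylor_poly N B) ?u)"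
      using integrable_gauss_integrand[OF h f_growth g_growth fc inS] LA(3)
        integrable_gauss_integrand[OF h f_growth KB fc(1) pc inS] LAB(3)
      unfolding gauss_prod_def gauss_integrand_diff by simp
    moreover have "(LINT t|lborel. (star_ext (Complex t d) - star_head N (Complex t d)) / e_fun (sqrt q) (Complex t d - ?u)) =
        qLaplace (sqrt q) d star_ext ?u - (LINT t|lborel. ?L (star_head N) t)"
      using star_ext_int star_head_int unfolding qLaplace_def diff_divide_distrib by simp
    ultimately show ?thesis
      unfolding star_head_eq gauss_prod_commute[of h "taylor_poly N B" f] by simp
  qed
  have "(\<lambda>N. (LINT t|lborel. (star_ext (Complex t d) - star_head N (Complex t d)) / e_fun (sqrt q) (Complex t d - ?u))
      - gauss_prod h (\<lambda>w. f w - taylor_poly N A w) (\<lambda>w. g w - taylor_poly N B w) ?u) \<longlonglongrightarrow> 0 - 0"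
    by (intro tendsto_diff qLaplace_star_ext_minus_star_head_tendsto_0[OF q hq] gauss_prod_remainder_tendsto_0)
       (use r h in auto)
  then show ?thesis unfolding step[symmetric] by (simp add: LIMSEQ_const_iff)
qed

text \<open>
On the ray the integration path of the Laplace transform and the line on which \<open>f\<close> and \<open>g\<close> are
evaluated coincide; off the ray they do not, and the identity theorem replaces a deformation of the path.
\<close>

lemma gauss_prod_eq_qLaplace_star_ext:
  assumes q: "q > 1" and hq: "h = ln q" and w: "w \<in> sector d \<epsilon>" "Re w < - a - 3"
  shows "gauss_prod h f g w = qLaplace (sqrt q) d star_ext w"
proof -
  define S where "S = sector d \<epsilon> \<inter> {w. Re w < - a - 3}"
  define U where "U = {w. Im w = d \<and> Re w < - a - 3}"
  \<comment> \<open>any point of the ray to the left of \<open>- a - 3\<close> would do\<close>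
  define \<xi> where "\<xi> = Complex (- a - 4) d"
  have sq: "sqrt q > 1" "ln (sqrt q) = h/2" using q hq by (simp_all add: ln_sqrt)
  have "qLaplace (sqrt q) d star_ext holomorphic_on {w. Re w < ln (sqrt q) / 2 - (a + 3)}"
  proof (rule qLaplace_holomorphic[OF sq(1)])
    show "q_growth (ln (sqrt q)) (a + 3) (9 * C\<^sup>2) {w. Im w = d} star_ext"
      using star_ext_growth ray_subset_sector[OF \<epsilon>] unfolding q_growth_def sq by blast
    show "continuous_on {w. Im w = d} star_ext" by (rule ray_continuous[OF star_ext_holomorphic])
  qed
  then have "qLaplace (sqrt q) d star_ext holomorphic_on S"
    by (rule holomorphic_on_subset) (use h in \<open>auto simp: S_def sq\<close>)
  moreover have "gauss_prod h f g holomorphic_on S"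
    using gauss_prod_holomorphic[OF h f_growth g_growth f_hol g_hol]
    by (rule holomorphic_on_subset) (auto simp: S_def)
  ultimately have hol: "(\<lambda>w. gauss_prod h f g w - qLaplace (sqrt q) d star_ext w) holomorphic_on S"
    by (intro holomorphic_on_diff)
  have "gauss_prod h f g w - qLaplace (sqrt q) d star_ext w = 0"
  proof (rule analytic_continuation[OF hol])
    show "open S" unfolding S_def by (intro open_Int open_sector open_halfspace_Re_lt)
    show "connected S" unfolding S_def
      by (intro convex_connected convex_Int convex_sector convex_halfspace_Re_lt)
    show "U \<subseteq> S" using ray_subset_sector[OF \<epsilon>] unfolding U_def S_def by auto
    show "\<xi> \<in> S" using \<epsilon> unfolding \<xi>_def S_def by simp
    show "\<xi> islimpt U"
      unfolding islimpt_approachable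
    proof (intro allI impI)
      fix e :: real assume e: "e > 0"
      let ?x = "Complex (- a - 4 - e/2) d"
      have "?x - \<xi> = complex_of_real (- (e/2))" unfolding \<xi>_def by (simp add: complex_eq_iff)
      then have "dist ?x \<xi> = e/2" unfolding dist_norm using e by (simp only: norm_of_real)
      then show "\<exists>x'\<in>U. x' \<noteq> \<xi> \<and> dist x' \<xi> < e"
        using e unfolding U_def by (intro bexI[of _ ?x]) auto
    qed
    show "gauss_prod h f g z - qLaplace (sqrt q) d star_ext z = 0" if "z \<in> U" for z
    proof -
      have "z = Complex (Re z) d" "Re z < - a - 3" using that unfolding U_def by (auto simp: complex_eq_iff)
      then show ?thesis using qLaplace_star_ext_on_ray[OF q hq, of "Re z"] by simp
    qed
    show "w \<in> S" using w unfolding S_def by simp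
  qed
  then show ?thesis by simp
qed

end

section \<open>Summability of the product\<close>

lemma q_growth_mono:
  assumes "q_growth \<kappa> a C S \<phi>" and "\<kappa> > 0" "a \<le> a'" "0 \<le> C" "C \<le> C'" "S' \<subseteq> S"
  shows "q_growth \<kappa> a' C' S' \<phi>"
  unfolding q_growth_def
proof
  fix w assume "w \<in> S'"
  then have "norm (\<phi> w) \<le> C * exp ((max 0 (Re w + a))\<^sup>2 / (2*\<kappa>))"
    using q_growthD[OF assms(1)] assms(6) by blast
  also have "\<dots> \<le> C' * exp ((max 0 (Re w + a'))\<^sup>2 / (2*\<kappa>))"
  proof (intro mult_mono)
    have "(max 0 (Re w + a))\<^sup>2 \<le> (max 0 (Re w + a'))\<^sup>2" using assms(3) by (intro power_mono) auto
    then show "exp ((max 0 (Re w + a))\<^sup>2 / (2*\<kappa>)) \<le> exp ((max 0 (Re w + a'))\<^sup>2 / (2*\<kappa>))"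
      using assms(2) by (simp add: divide_right_mono)
  qed (use assms in auto)
  finally show "norm (\<phi> w) \<le> C' * exp ((max 0 (Re w + a'))\<^sup>2 / (2*\<kappa>))" .
qed

lemma is_continuation_mono:
  "is_continuation d \<epsilon> g \<phi> \<Longrightarrow> \<epsilon>' \<le> \<epsilon> \<Longrightarrow> is_continuation d \<epsilon>' g \<phi>"
  using sector_mono[of \<epsilon>' \<epsilon> d] unfolding is_continuation_def
  by (meson IntD1 IntD2 IntI holomorphic_on_subset subsetD)

lemma level1_pair_exists:
  assumes q: "q > 1" and H: "g1 \<in> H1 q d" "g2 \<in> H1 q d"
  obtains \<epsilon> a C \<phi>1 \<phi>2 where "level1_pair (ln q) d \<epsilon> a C g1 g2 \<phi>1 \<phi>2"
    "is_continuation d \<epsilon> (lift_germ g1) \<phi>1" "is_continuation d \<epsilon> (lift_germ g2) \<phi>2"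
proof -
  have h: "ln q > 0" using q by simp
  obtain \<epsilon>1 \<phi>1 a1 C1 where 1: "\<epsilon>1 > 0" "is_continuation d \<epsilon>1 (lift_germ g1) \<phi>1"
    "C1 \<ge> 0" "q_growth (ln q) a1 C1 (sector d \<epsilon>1) \<phi>1" "\<And>n. norm (fps_nth g1 n) \<le> C1 * exp (a1 * real n)"
    "\<And>w. w \<in> sector d \<epsilon>1 \<Longrightarrow> Re w < - a1 \<Longrightarrow> \<phi>1 w = eval_fps g1 (exp w)"
    by (rule H1_growth[OF q H(1)], rule that)
  obtain \<epsilon>2 \<phi>2 a2 C2 where 2: "\<epsilon>2 > 0" "is_continuation d \<epsilon>2 (lift_germ g2) \<phi>2"
    "C2 \<ge> 0" "q_growth (ln q) a2 C2 (sector d \<epsilon>2) \<phi>2" "\<And>n. norm (fps_nth g2 n) \<le> C2 * exp (a2 * real n)"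
    "\<And>w. w \<in> sector d \<epsilon>2 \<Longrightarrow> Re w < - a2 \<Longrightarrow> \<phi>2 w = eval_fps g2 (exp w)"
    by (rule H1_growth[OF q H(2)], rule that)
  define \<epsilon> a C where "\<epsilon> = min \<epsilon>1 \<epsilon>2" "a = max a1 a2" "C = max C1 C2"
  have \<epsilon>: "\<epsilon> > 0" "\<epsilon> \<le> \<epsilon>1" "\<epsilon> \<le> \<epsilon>2" and a: "a1 \<le> a" "a2 \<le> a" and C: "C1 \<le> C" "C2 \<le> C"
    unfolding \<epsilon>_a_C_def using 1(1) 2(1) by auto
  have sub: "sector d \<epsilon> \<subseteq> sector d \<epsilon>1" "sector d \<epsilon> \<subseteq> sector d \<epsilon>2"
    using \<epsilon> by (auto intro!: sector_mono)
  have cont: "is_continuation d \<epsilon> (lift_germ g1) \<phi>1" "is_continuation d \<epsilon> (lift_germ g2) \<phi>2"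
    using is_continuation_mono 1(2) 2(2) \<epsilon> by blast+
  have coeff: "norm (fps_nth g n) \<le> C * exp (a * real n)"
    if "\<And>n. norm (fps_nth g n) \<le> C' * exp (a' * real n)" "C' \<le> C" "a' \<le> a" "0 \<le> C'" for g :: "complex fps" and C' a' n
  proof -
    have "C' * exp (a' * real n) \<le> C * exp (a * real n)"
      using that by (intro mult_mono) (auto simp: mult_right_mono)
    then show ?thesis using that(1)[of n] by linarith
  qed
  have "level1_pair (ln q) d \<epsilon> a C g1 g2 \<phi>1 \<phi>2"
  proof
    show "q_growth (ln q) a C (sector d \<epsilon>) \<phi>1" by (rule q_growth_mono[OF 1(4) h a(1) 1(3) C(1) sub(1)])
    show "q_growth (ln q) a C (sector d \<epsilon>) \<phi>2" by (rule q_growth_mono[OF 2(4) h a(2) 2(3) C(2) sub(2)])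
    show "norm (fps_nth g1 n) \<le> C * exp (a * real n)" for n by (rule coeff[OF 1(5) C(1) a(1) 1(3)])
    show "norm (fps_nth g2 n) \<le> C * exp (a * real n)" for n by (rule coeff[OF 2(5) C(2) a(2) 2(3)])
    show "\<phi>1 w = eval_fps g1 (exp w)" if "w \<in> sector d \<epsilon>" "Re w < - a" for w
      using 1(6)[of w] that sub a by auto
    show "\<phi>2 w = eval_fps g2 (exp w)" if "w \<in> sector d \<epsilon>" "Re w < - a" for w
      using 2(6)[of w] that sub a by auto
  qed (use h \<epsilon> cont in \<open>auto simp: is_continuation_def\<close>)
  with cont show ?thesis by (intro that)
qed

theorem theorem1p1:
  fixes q d :: real and f1 f2 :: "complex fps"
  assumes "q > 1"
    and "generic_q_Gevrey q f1" and "generic_q_Gevrey q f2"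
    and "f1 \<in> Gq_summable1 q d" and "f2 \<in> Gq_summable1 q d"
  shows "f1 * f2 \<in> Gq_summable12 q d \<and>
    (\<exists>R>0. \<forall>w \<in> disc R. Gq_sum12 q d (f1 * f2) w = Gq_sum1 q d f1 w * Gq_sum1 q d f2 w)"
proof -
  let ?h = "ln q"
  have q: "q > 1" by fact
  have h: "?h > 0" using q by simp
  have sq: "sqrt q > 1" "ln (sqrt q) = ?h/2" using q by (simp_all add: ln_sqrt)
  have germs: "qBorel q f1 \<in> H1 q d" "qBorel q f2 \<in> H1 q d"
    using assms(4,5) unfolding Gq_summable1_def by auto
  obtain \<epsilon> a C \<phi>1 \<phi>2
    where pair: "level1_pair ?h d \<epsilon> a C (qBorel q f1) (qBorel q f2) \<phi>1 \<phi>2"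
      and cont1: "is_continuation d \<epsilon> (lift_germ (qBorel q f1)) \<phi>1"
      and cont2: "is_continuation d \<epsilon> (lift_germ (qBorel q f2)) \<phi>2"
    by (rule level1_pair_exists[OF q germs], rule that)
  interpret level1_pair ?h d \<epsilon> a C "qBorel q f1" "qBorel q f2" \<phi>1 \<phi>2 by (rule pair)
  define \<Phi> where "\<Phi> = gauss_prod ?h \<phi>1 \<phi>2"
  note borel = qBorel_mult[OF q, of f1 f2]
  have star_ext_cont: "is_continuation d \<epsilon> (lift_germ (qBorel q (f1 * f2))) star_ext"
    unfolding is_continuation_def
  proof (intro conjI star_ext_holomorphic exI[of _ "exp (- a - 2)"] ballI)
    fix w assume "w \<in> sector d \<epsilon> \<inter> disc (exp (- a - 2))"
    then show "star_ext w = lift_germ (qBorel q (f1 * f2)) w"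
      using star_ext_germ[of w] by (simp add: disc_eq lift_germ_def borel)
  qed simp
  have H2: "qBorel q (f1 * f2) \<in> H2 q d"
  proof -
    \<comment> \<open>the general estimate with nothing cut off, that is, for \<open>N = 0\<close>\<close>
    have "norm (fps_nth (qBorel q (f1 * f2)) n) \<le> C * C * exp (?h * (real 0)\<^sup>2) * exp ((a + 1 - ?h * real 0) * real n)" for n
      unfolding borel by (rule norm_q_star_nth_le(1)[OF _ A_le B_le]) (use h in auto)
    from fps_conv_radius_ge_coefficient_bound[OF this]
    have "fps_conv_radius (qBorel q (f1 * f2)) > 0"
      by (rule less_le_trans[rotated]) simp
    moreover have "\<exists>A>0. star_ext \<in> O[to_infinity_in (sector d \<epsilon>)](\<lambda>w. e_fun (sqrt q) (complex_of_real (ln A) + w))"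
      using star_ext_growth unfolding sq(2)[symmetric] by (rule q_growth_imp_bigo_e_fun[OF sq(1)]) simp
    ultimately show ?thesis
      unfolding H2_def H1_def using star_ext_cont \<epsilon> by blast
  qed
  have L_star_ext: "qLaplace2 q d (phi0 q d (f1 * f2)) = qLaplace (sqrt q) d star_ext"
    unfolding qLaplace2_def phi0_def by (rule qLaplace_continuation[OF star_ext_cont \<epsilon>])
  have \<Phi>_cont: "is_continuation d \<epsilon> (qLaplace2 q d (phi0 q d (f1 * f2))) \<Phi>"
    unfolding is_continuation_def L_star_ext \<Phi>_def
  proof (intro conjI exI[of _ "exp (- a - 3)"] ballI)
    show "gauss_prod ?h \<phi>1 \<phi>2 holomorphic_on sector d \<epsilon>"
      by (rule gauss_prod_holomorphic[OF h f_growth g_growth f_hol g_hol])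
    fix w assume "w \<in> sector d \<epsilon> \<inter> disc (exp (- a - 3))"
    then show "gauss_prod ?h \<phi>1 \<phi>2 w = qLaplace (sqrt q) d star_ext w"
      using gauss_prod_eq_qLaplace_star_ext[OF q refl, of w] by (simp add: disc_eq)
  qed simp
  obtain K where K: "q_growth (?h/2) (a + 1 - ?h/4) K (sector d \<epsilon>) \<Phi>"
    using gauss_prod_growth[OF h f_growth g_growth f_hol g_hol] unfolding \<Phi>_def by blast
  have "\<Phi> \<in> Htilde2 q d \<epsilon>"
    unfolding Htilde2_def
  proof (intro CollectI conjI)
    show "\<Phi> holomorphic_on sector d \<epsilon>" using \<Phi>_cont unfolding is_continuation_def by blast
    show "\<Phi> \<in> O[to_zero_in (sector d \<epsilon>)](\<lambda>_. 1)" by (rule q_growth_imp_bigo_1[OF K])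
    show "\<exists>A>0. \<Phi> \<in> O[to_infinity_in (sector d \<epsilon>)](\<lambda>w. e_fun (sqrt q) (complex_of_real (ln A) + w))"
      using K unfolding sq(2)[symmetric]
      by (rule q_growth_imp_bigo_e_fun[OF sq(1) _ q_growth_constant_nonneg[OF K ray_in_sector[OF \<epsilon>]]])
  qed
  then have summable: "f1 * f2 \<in> Gq_summable12 q d"
    unfolding Gq_summable12_def using H2 \<Phi>_cont \<epsilon> by blast
  have "Gq_sum12 q d (f1 * f2) w = Gq_sum1 q d f1 w * Gq_sum1 q d f2 w" if w: "w \<in> disc (exp (?h/2 - a))" for w
  proof -
    have "Gq_sum12 q d (f1 * f2) w =
        qLaplace (sqrt q) d (continuation d (qLaplace2 q d (phi0 q d (f1 * f2)))) w"
      by (simp add: Gq_sum12_def phi1_def qLaplace2_def)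
    also have "\<dots> = qLaplace (sqrt q) d \<Phi> w"
      by (simp only: qLaplace_continuation[OF \<Phi>_cont \<epsilon>])
    also have "\<dots> = qLaplace q d \<phi>1 w * qLaplace q d \<phi>2 w"
      unfolding \<Phi>_def
    proof (rule qLaplace_gauss_prod[OF q])
      show "q_growth ?h a C {w. Im w = d} \<phi>1" "q_growth ?h a C {w. Im w = d} \<phi>2"
        using f_growth g_growth q_growth_mono[OF _ h order_refl C order_refl ray_subset_sector[OF \<epsilon>]] by blast+
      show "continuous_on {w. Im w = d} \<phi>1" "continuous_on {w. Im w = d} \<phi>2"
        by (rule ray_continuous[OF f_hol], rule ray_continuous[OF g_hol])
      show "Re w < ?h / 2 - a" using w by (simp add: disc_eq)
    qed
    also have "\<dots> = Gq_sum1 q d f1 w * Gq_sum1 q d f2 w"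
      unfolding Gq_sum1_def qLaplace_continuation[OF cont1 \<epsilon>] qLaplace_continuation[OF cont2 \<epsilon>] ..
    finally show ?thesis .
  qed
  then show ?thesis using summable by (intro conjI exI[of _ "exp (?h/2 - a)"]) auto
qed

end
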